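(* Let $R$ be a standard graded one-dimensional Gorenstein ring with uncountable residue field $k=R_0$. If $R$ is of graded countable Cohen-Macaulay type, then $R$ is a hypersurface ring.
   Context: A standard graded ring is a Noetherian commutative graded ring $R=\bigoplus_{i\ge 0}R_i$ with $R_0=k$ a field and $R=R_0[R_1]$; its irrelevant maximal ideal is $\mathfrak m=\bigoplus_{i\ge1}R_i$, and $R/\mathfrak m=k$. Graded countable Cohen-Macaulay type: a standard graded Cohen-Macaulay ring $R$ has graded countable Cohen-Macaulay type if there are only countably many (finitely many allowed) indecomposable objects, up to isomorphism and shift in degree, in the category whose objects are the finitely generated graded maximal Cohen-Macaulay $R$-modules and whose morphisms are graded $R$-homomorphisms of degree zero. The shift is $M(n)_i=M_{i+n}$. A (standard graded) hypersurface ring is a ring isomorphic, as a graded $k$-algebra, to $k[y_1,\dots,y_n]/(f)$ with all $y_i$ of degree 1 and $f$ a homogeneous element of the irrelevant ideal (polynomial rings are included). *)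

theory Defs
  imports "HOL-Algebra.Algebra" "HOL-Library.Countable_Set" "HOL-Library.Extended_Nat"
begin

section \<open>Modules\<close>

text \<open>In the type \<^typ>\<open>('a, 'm) module\<close> the fields \<^const>\<open>monoid.mult\<close> and \<^const>\<open>monoid.one\<close>
  inherited from rings carry no meaning for a module and are never used below.\<close>

definition self_module :: "('a, 'b) ring_scheme \<Rightarrow> ('a, 'a) module" where
  "self_module R = \<lparr>carrier = carrier R, monoid.mult = monoid.mult R, monoid.one = monoid.one R,
     ring.zero = ring.zero R, ring.add = ring.add R, module.smult = monoid.mult R\<rparr>"

definition generated_submodule ::
  "('a, 'b) ring_scheme \<Rightarrow> ('a, 'm) module \<Rightarrow> 'm set \<Rightarrow> 'm set" where
  "generated_submodule R M U = \<Inter>{H. submodule H R M \<and> U \<subseteq> H}"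

definition finitely_generated_module ::
  "('a, 'b) ring_scheme \<Rightarrow> ('a, 'm) module \<Rightarrow> bool" where
  "finitely_generated_module R M \<longleftrightarrow> module R M \<and>
     (\<exists>U. finite U \<and> U \<subseteq> carrier M \<and> generated_submodule R M U = carrier M)"

definition module_hom ::
  "('a, 'b) ring_scheme \<Rightarrow> ('a, 'm) module \<Rightarrow> ('a, 'n) module \<Rightarrow> ('m \<Rightarrow> 'n) set" where
  "module_hom R M N = {h \<in> carrier M \<rightarrow> carrier N.
     (\<forall>x\<in>carrier M. \<forall>y\<in>carrier M. h (x \<oplus>\<^bsub>M\<^esub> y) = h x \<oplus>\<^bsub>N\<^esub> h y) \<and>
     (\<forall>a\<in>carrier R. \<forall>x\<in>carrier M. h (a \<odot>\<^bsub>M\<^esub> x) = a \<odot>\<^bsub>N\<^esub> h x)}"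

definition module_kernel ::
  "('a, 'm) module \<Rightarrow> ('a, 'n) module \<Rightarrow> ('m \<Rightarrow> 'n) \<Rightarrow> 'm set" where
  "module_kernel M N h = {x \<in> carrier M. h x = \<zero>\<^bsub>N\<^esub>}"


section \<open>Dimension, depth, localization\<close>

text \<open>Supremum of the lengths of chains of prime ideals (so the zero ring gets dimension 0).\<close>

definition krull_dim :: "('a, 'b) ring_scheme \<Rightarrow> enat" where
  "krull_dim R = Sup {enat n | n. \<exists>P :: nat \<Rightarrow> 'a set.
     (\<forall>i\<le>n. primeideal (P i) R) \<and> (\<forall>i<n. P i \<subset> P (Suc i))}"

text \<open>The submodule \<open>(x\<^sub>1, \<dots>, x\<^sub>r) M\<close>.\<close>

definition seq_smult ::
  "('a, 'b) ring_scheme \<Rightarrow> ('a, 'm) module \<Rightarrow> 'a list \<Rightarrow> 'm set" where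
  "seq_smult R M xs = generated_submodule R M {x \<odot>\<^bsub>M\<^esub> m | x m. x \<in> set xs \<and> m \<in> carrier M}"

text \<open>Each \<open>x\<^sub>i\<close> is a nonzerodivisor on \<open>M / (x\<^sub>1, \<dots>, x\<^bsub>i-1\<^esub>) M\<close> and
  \<open>M / (x\<^sub>1, \<dots>, x\<^sub>r) M \<noteq> 0\<close>, written out without forming the quotient modules.\<close>

definition regular_sequence ::
  "('a, 'b) ring_scheme \<Rightarrow> ('a, 'm) module \<Rightarrow> 'a list \<Rightarrow> bool" where
  "regular_sequence R M xs \<longleftrightarrow> set xs \<subseteq> carrier R \<and>
     (\<forall>i<length xs. \<forall>m\<in>carrier M.
        xs ! i \<odot>\<^bsub>M\<^esub> m \<in> seq_smult R M (take i xs) \<longrightarrow> m \<in> seq_smult R M (take i xs)) \<and>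
     seq_smult R M xs \<noteq> carrier M"

definition depth ::
  "('a, 'b) ring_scheme \<Rightarrow> 'a set \<Rightarrow> ('a, 'm) module \<Rightarrow> enat" where
  "depth R J M = Sup {enat (length xs) | xs. set xs \<subseteq> J \<and> regular_sequence R M xs}"

text \<open>The fraction \<open>a / s\<close> in the localization at the prime \<open>P\<close>, as an equivalence class of pairs.\<close>

definition fraction :: "('a, 'b) ring_scheme \<Rightarrow> 'a set \<Rightarrow> 'a \<Rightarrow> 'a \<Rightarrow> ('a \<times> 'a) set" where
  "fraction R P a s = {(b, t). b \<in> carrier R \<and> t \<in> carrier R - P \<and>
     (\<exists>u\<in>carrier R - P. u \<otimes>\<^bsub>R\<^esub> (a \<otimes>\<^bsub>R\<^esub> t) = u \<otimes>\<^bsub>R\<^esub> (b \<otimes>\<^bsub>R\<^esub> s))}"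

definition localization :: "('a, 'b) ring_scheme \<Rightarrow> 'a set \<Rightarrow> ('a \<times> 'a) set ring" where
  "localization R P =
    \<lparr>carrier = {fraction R P a s | a s. a \<in> carrier R \<and> s \<in> carrier R - P},
     monoid.mult = (\<lambda>U V. \<Union>(a, s)\<in>U. \<Union>(b, t)\<in>V. fraction R P (a \<otimes>\<^bsub>R\<^esub> b) (s \<otimes>\<^bsub>R\<^esub> t)),
     monoid.one = fraction R P \<one>\<^bsub>R\<^esub> \<one>\<^bsub>R\<^esub>,
     ring.zero = fraction R P \<zero>\<^bsub>R\<^esub> \<one>\<^bsub>R\<^esub>,
     ring.add = (\<lambda>U V. \<Union>(a, s)\<in>U. \<Union>(b, t)\<in>V.
       fraction R P ((a \<otimes>\<^bsub>R\<^esub> t) \<oplus>\<^bsub>R\<^esub> (b \<otimes>\<^bsub>R\<^esub> s)) (s \<otimes>\<^bsub>R\<^esub> t))\<rparr>"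

text \<open>In a local ring the maximal ideal is the set of nonunits.\<close>

definition cohen_macaulay_ring :: "('a, 'b) ring_scheme \<Rightarrow> bool" where
  "cohen_macaulay_ring R \<longleftrightarrow> cring R \<and> noetherian_ring R \<and>
     (\<forall>P. maximalideal P R \<longrightarrow>
        (let S = localization R P
         in depth S (carrier S - Units S) (self_module S) = krull_dim S))"


section \<open>Gorenstein rings\<close>

text \<open>The usual extension property. The test modules \<open>N\<close> range over one type only; as they include
  \<^term>\<open>self_module R\<close>, Baer's criterion shows that this loses nothing.\<close>

definition injective_module :: "('a, 'b) ring_scheme \<Rightarrow> ('a, 'm) module \<Rightarrow> bool" where
  "injective_module R E \<longleftrightarrow> module R E \<and>
     (\<forall>(N :: ('a, 'a) module) H. module R N \<and> submodule H R N \<longrightarrow>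
        (\<forall>g\<in>module_hom R (N\<lparr>carrier := H\<rparr>) E.
           \<exists>h\<in>module_hom R N E. \<forall>x\<in>H. h x = g x))"

text \<open>A finite injective resolution \<open>0 \<rightarrow> R \<rightarrow> I\<^sub>0 \<rightarrow> \<dots> \<rightarrow> I\<^sub>n \<rightarrow> 0\<close>. Taking the terms in the type
  \<^typ>\<open>'a list\<close> is no restriction: over a Noetherian ring \<open>R\<close>, with \<open>\<kappa> = max |R| \<aleph>\<^sub>0\<close>, a module of
  cardinality at most \<open>\<kappa>\<close> has an injective hull of cardinality at most \<open>\<kappa>\<close>, so the minimal
  injective resolution of \<open>R\<close> has an isomorphic copy in that type.\<close>

definition finite_self_injective_dim :: "('a, 'b) ring_scheme \<Rightarrow> bool" where
  "finite_self_injective_dim R \<longleftrightarrow>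
     (\<exists>n (I :: nat \<Rightarrow> ('a, 'a list) module) e d.
        (\<forall>i. injective_module R (I i)) \<and>
        (\<forall>i>n. carrier (I i) = {\<zero>\<^bsub>I i\<^esub>}) \<and>
        e \<in> module_hom R (self_module R) (I 0) \<and> inj_on e (carrier R) \<and>
        (\<forall>i. d i \<in> module_hom R (I i) (I (Suc i))) \<and>
        e ` carrier R = module_kernel (I 0) (I 1) (d 0) \<and>
        (\<forall>i. d i ` carrier (I i) = module_kernel (I (Suc i)) (I (Suc (Suc i))) (d (Suc i))))"

definition gorenstein_ring :: "('a, 'b) ring_scheme \<Rightarrow> bool" where
  "gorenstein_ring R \<longleftrightarrow> cring R \<and> noetherian_ring R \<and>
     (\<forall>P. maximalideal P R \<longrightarrow> finite_self_injective_dim (localization R P))"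


section \<open>Graded rings and graded modules\<close>

definition internal_direct_sum :: "('a, 'b) ring_scheme \<Rightarrow> ('i \<Rightarrow> 'a set) \<Rightarrow> bool" where
  "internal_direct_sum A C \<longleftrightarrow> (\<forall>i. additive_subgroup (C i) A) \<and>
     (\<forall>x\<in>carrier A. \<exists>!c. (\<forall>i. c i \<in> C i) \<and> finite {i. c i \<noteq> \<zero>\<^bsub>A\<^esub>} \<and>
        x = (\<Oplus>\<^bsub>A\<^esub> i\<in>{i. c i \<noteq> \<zero>\<^bsub>A\<^esub>}. c i))"

definition graded_ring :: "('a, 'b) ring_scheme \<Rightarrow> (nat \<Rightarrow> 'a set) \<Rightarrow> bool" where
  "graded_ring R G \<longleftrightarrow> cring R \<and> internal_direct_sum R G \<and>
     (\<forall>i j. \<forall>x\<in>G i. \<forall>y\<in>G j. x \<otimes>\<^bsub>R\<^esub> y \<in> G (i + j))"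

definition standard_graded_ring :: "('a, 'b) ring_scheme \<Rightarrow> (nat \<Rightarrow> 'a set) \<Rightarrow> bool" where
  "standard_graded_ring R G \<longleftrightarrow> noetherian_ring R \<and> graded_ring R G \<and>
     subfield (G 0) R \<and> generate_ring R (G 0 \<union> G 1) = carrier R"

text \<open>\<open>\<Oplus>\<^bsub>i\<ge>1\<^esub> R\<^sub>i\<close>\<close>

definition irrelevant_ideal :: "('a, 'b) ring_scheme \<Rightarrow> (nat \<Rightarrow> 'a set) \<Rightarrow> 'a set" where
  "irrelevant_ideal R G =
     {\<Oplus>\<^bsub>R\<^esub> i\<in>A. x i | A x. finite A \<and> 0 \<notin> A \<and> (\<forall>i\<in>A. x i \<in> G i)}"

text \<open>A graded module is a pair of a module and the family of its homogeneous components.\<close>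

type_synonym ('a, 'm) graded_mod = "('a, 'm) module \<times> (int \<Rightarrow> 'm set)"

fun graded_module ::
  "('a, 'b) ring_scheme \<Rightarrow> (nat \<Rightarrow> 'a set) \<Rightarrow> ('a, 'm) graded_mod \<Rightarrow> bool" where
  "graded_module R G (M, D) \<longleftrightarrow> module R M \<and> internal_direct_sum M D \<and>
     (\<forall>i j. \<forall>a\<in>G i. \<forall>x\<in>D j. a \<odot>\<^bsub>M\<^esub> x \<in> D (int i + j))"

fun shift :: "int \<Rightarrow> ('a, 'm) graded_mod \<Rightarrow> ('a, 'm) graded_mod" where
  "shift n (M, D) = (M, \<lambda>i. D (i + n))"

text \<open>The inverse of a bijective homomorphism of degree 0 is again of degree 0.\<close>

fun graded_isomorphic ::
  "('a, 'b) ring_scheme \<Rightarrow> ('a, 'm) graded_mod \<Rightarrow> ('a, 'n) graded_mod \<Rightarrow> bool" where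
  "graded_isomorphic R (M, D) (N, E) \<longleftrightarrow>
     (\<exists>h\<in>module_hom R M N. bij_betw h (carrier M) (carrier N) \<and> (\<forall>i. h ` D i \<subseteq> E i))"

text \<open>Depth is taken with respect to the irrelevant maximal ideal.\<close>

fun graded_MCM ::
  "('a, 'b) ring_scheme \<Rightarrow> (nat \<Rightarrow> 'a set) \<Rightarrow> ('a, 'm) graded_mod \<Rightarrow> bool" where
  "graded_MCM R G (M, D) \<longleftrightarrow> graded_module R G (M, D) \<and> finitely_generated_module R M \<and>
     carrier M \<noteq> {\<zero>\<^bsub>M\<^esub>} \<and> depth R (irrelevant_ideal R G) M = krull_dim R"

fun indecomposable_graded_MCM ::
  "('a, 'b) ring_scheme \<Rightarrow> (nat \<Rightarrow> 'a set) \<Rightarrow> ('a, 'm) graded_mod \<Rightarrow> bool" where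
  "indecomposable_graded_MCM R G (M, D) \<longleftrightarrow> graded_MCM R G (M, D) \<and>
     \<not> (\<exists>H K. submodule H R M \<and> submodule K R M \<and>
          graded_MCM R G (M\<lparr>carrier := H\<rparr>, \<lambda>i. D i \<inter> H) \<and>
          graded_MCM R G (M\<lparr>carrier := K\<rparr>, \<lambda>i. D i \<inter> K) \<and>
          H \<inter> K = {\<zero>\<^bsub>M\<^esub>} \<and> H <+>\<^bsub>M\<^esub> K = carrier M)"

text \<open>A finitely generated module is isomorphic to some \<open>R\<^sup>n / K\<close>, whose elements are cosets of type
  \<^typ>\<open>(nat \<Rightarrow> 'a) set\<close>; hence modules of that type represent all isomorphism classes.\<close>

definition graded_countable_CM_type ::
  "('a, 'b) ring_scheme \<Rightarrow> (nat \<Rightarrow> 'a set) \<Rightarrow> bool" where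
  "graded_countable_CM_type R G \<longleftrightarrow> standard_graded_ring R G \<and> cohen_macaulay_ring R \<and>
     (\<exists>\<C> :: ('a, (nat \<Rightarrow> 'a) set) graded_mod set. countable \<C> \<and>
        (\<forall>M :: ('a, (nat \<Rightarrow> 'a) set) graded_mod. indecomposable_graded_MCM R G M \<longrightarrow>
           (\<exists>N\<in>\<C>. \<exists>n. graded_isomorphic R M (shift n N))))"


section \<open>Hypersurface rings\<close>

text \<open>The polynomial ring \<open>k[y\<^sub>0, \<dots>, y\<^bsub>n-1\<^esub>]\<close> over a subring \<open>k\<close> of \<open>R\<close>, on the carrier
  \<^const>\<open>ring.indexed_pset\<close>: monomials are multisets of indices, polynomials are coefficient
  functions. The sum defining the product ranges over the divisors of the monomial \<open>m\<close>.\<close>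

definition mpoly_ring :: "('a, 'b) ring_scheme \<Rightarrow> 'a set \<Rightarrow> nat \<Rightarrow> (nat multiset \<Rightarrow> 'a) ring" where
  "mpoly_ring R k n =
    \<lparr>carrier = ring.indexed_pset R {..<n} k,
     monoid.mult = (\<lambda>p q m. \<Oplus>\<^bsub>R\<^esub> l\<in>{l. l \<subseteq># m}. p l \<otimes>\<^bsub>R\<^esub> q (m - l)),
     monoid.one = ring.indexed_const R \<one>\<^bsub>R\<^esub>,
     ring.zero = ring.indexed_const R \<zero>\<^bsub>R\<^esub>,
     ring.add = ring.indexed_padd R\<rparr>"

definition mpoly_grading ::
  "('a, 'b) ring_scheme \<Rightarrow> 'a set \<Rightarrow> nat \<Rightarrow> nat \<Rightarrow> (nat multiset \<Rightarrow> 'a) set" where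
  "mpoly_grading R k n i =
     {p \<in> carrier (mpoly_ring R k n). \<forall>m. p m \<noteq> \<zero>\<^bsub>R\<^esub> \<longrightarrow> size m = i}"

text \<open>The case \<open>f = 0\<close> is allowed and gives the polynomial rings. Compatibility of \<open>\<phi>\<close> with the
  elements of \<open>G 0\<close> makes it an isomorphism of algebras over the field \<open>G 0\<close>.\<close>

definition hypersurface_ring :: "('a, 'b) ring_scheme \<Rightarrow> (nat \<Rightarrow> 'a set) \<Rightarrow> bool" where
  "hypersurface_ring R G \<longleftrightarrow>
     (\<exists>n f d \<phi>. let S = mpoly_ring R (G 0) n; SG = mpoly_grading R (G 0) n; I = PIdl\<^bsub>S\<^esub> f in
        f \<in> SG d \<and> f \<in> irrelevant_ideal S SG \<and>
        \<phi> \<in> ring_iso R (S Quot I) \<and>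
        (\<forall>c\<in>G 0. \<phi> c = I +>\<^bsub>S\<^esub> ring.indexed_const R c) \<and>
        (\<forall>i. \<phi> ` G i = (\<lambda>p. I +>\<^bsub>S\<^esub> p) ` SG i))"

end

theory Submission
  imports Defs
begin

text \<open>
  Write \<open>k = R\<^sub>0\<close> and let \<open>\<mm>\<close> be the irrelevant ideal. Cohen-Macaulayness at \<open>\<mm>\<close> gives a
  nonzerodivisor in \<open>\<mm>\<close>, and because \<open>k\<close> is infinite even a linear one, \<open>z\<close>
  (\<open>exists_irrelevant_nonzerodivisor\<close>, \<open>exists_linear_nonzerodivisor\<close>). The heart of the proof is that
  \<open>R\<^sub>1 = k z + k x\<close> for some \<open>x\<close> (\<open>linear_forms_spanned_by_two\<close>). Then \<open>R\<close> is a graded quotient of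
  \<open>k[y\<^sub>0, y\<^sub>1]\<close> by \<open>y\<^sub>0 \<mapsto> z\<close>, \<open>y\<^sub>1 \<mapsto> x\<close>, and since \<open>z\<close> can be cancelled, the kernel is generated by
  one form \<open>y\<^sub>1\<^sup>d - y\<^sub>0 g\<close>, with \<open>d\<close> least such that \<open>x\<^sup>d \<in> z R\<close>, or is zero if there is no such \<open>d\<close>
  (\<open>hypersurface\<close>).

  Suppose that \<open>R\<^sub>1\<close> is not spanned by \<open>z\<close> and one further form. Two facts are played against each other.

  The Gorenstein property forbids \<open>R\<^sub>1 R\<^sub>1 \<subseteq> z R\<close> (\<open>not_gorenstein_if_minimal_multiplicity\<close>): otherwise the
  socle of \<open>R/zR\<close> would contain all of \<open>R\<^sub>1/kz\<close>, of dimension at least two. That this contradicts finite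
  injective dimension is shown by hand in the locale \<open>socle_too_large\<close>, by descending along an injective
  resolution the vanishing of \<open>Ext\<^sup>1(k, -)\<close> on cosyzygies. Hence there are linear forms \<open>f, g\<close> such
  that \<open>z, f, g\<close> are linearly independent and not all of \<open>f\<^sup>2, f g, g\<^sup>2\<close> lie in \<open>z R\<close>.

  Now consider the ideals \<open>I\<^sub>c = (z, f + c g)\<close> for \<open>c \<in> k\<close>, which are maximal Cohen-Macaulay modules
  (\<open>depth_mod2\<close>). An isomorphism \<open>I\<^sub>c \<cong> I\<^sub>d\<close> with \<open>c \<noteq> d\<close> forces \<open>(f + c g) (f + d g) \<in> z R\<close>
  (\<open>isomorphic_family_members\<close>), and three pairwise isomorphic members would put \<open>f\<^sup>2, f g, g\<^sup>2\<close> into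
  \<open>z R\<close> (\<open>closed_products_if_three_products\<close>). So an isomorphism class contains at most two members. A
  decomposition of \<open>I\<^sub>c\<close> yields an idempotent \<open>e/z\<close> with \<open>e\<close> in the span of \<open>z\<close> and \<open>f + c g\<close>
  (\<open>indecomposable_gmod2\<close>), and for a good choice of \<open>f, g\<close> this happens for finitely many \<open>c\<close> only
  (\<open>exists_family_rarely_decomposing\<close>). As \<open>k\<close> is uncountable, uncountably many indecomposable classes
  arise, contradicting countable type.
\<close>

section \<open>Prime ideals avoiding multiplicative sets\<close>

lemma UN_UN_constant:
  assumes "p \<in> A" "q \<in> B" "\<And>a s b t. (a, s) \<in> A \<Longrightarrow> (b, t) \<in> B \<Longrightarrow> F a s b t = C"
  shows "(\<Union>(a, s)\<in>A. \<Union>(b, t)\<in>B. F a s b t) = C"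
proof -
  have "(\<Union>(b, t)\<in>B. F a s b t) = C" if "(a, s) \<in> A" for a s
    using assms(2) assms(3)[OF that] by auto
  then have "(case x of (a, s) \<Rightarrow> \<Union>(b, t)\<in>B. F a s b t) = C" if "x \<in> A" for x
    using that by (cases x) auto
  then show ?thesis using assms(1) by auto
qed

lemma (in noetherian_ring) maximal_member_of_ideal_family:
  assumes "F \<noteq> {}" "\<And>I. I \<in> F \<Longrightarrow> ideal I R"
  obtains I where "I \<in> F" "\<And>J. J \<in> F \<Longrightarrow> I \<subseteq> J \<Longrightarrow> J = I"
proof -
  have "\<Union>C \<in> F" if "C \<noteq> {}" "subset.chain F C" for C
  proof -
    have "subset.chain {I. ideal I R} C"
      using that(2) assms(2) by (auto simp: subset_chain_def)
    then have "\<Union>C \<in> C" using ideal_chain_is_trivial that(1) by blast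
    then show ?thesis using that(2) by (auto simp: subset_chain_def)
  qed
  then show thesis using subset_Zorn_nonempty[OF assms(1)] that by metis
qed

lemma (in ring) idealI':
  assumes "I \<subseteq> carrier R" "\<zero> \<in> I"
    and "\<And>x y. x \<in> I \<Longrightarrow> y \<in> I \<Longrightarrow> x \<oplus> y \<in> I"
    and "\<And>r x. r \<in> carrier R \<Longrightarrow> x \<in> I \<Longrightarrow> r \<otimes> x \<in> I"
    and "\<And>r x. r \<in> carrier R \<Longrightarrow> x \<in> I \<Longrightarrow> x \<otimes> r \<in> I"
  shows "ideal I R"
proof (rule idealI[OF ring_axioms])
  have "\<ominus> x \<in> I" if "x \<in> I" for x
    using assms(4)[of "\<ominus> \<one>" x] that assms(1) by (auto simp: l_minus subset_iff)
  then show "subgroup I (add_monoid R)"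
    using assms by (intro add.subgroupI) auto
qed (use assms in auto)

lemma (in cring) ideal_adjoin:
  assumes "ideal P R" "a \<in> carrier R"
  shows "ideal {p \<oplus> r \<otimes> a | p r. p \<in> P \<and> r \<in> carrier R} R" (is "ideal ?J R")
    and "P \<subseteq> {p \<oplus> r \<otimes> a | p r. p \<in> P \<and> r \<in> carrier R}"
    and "a \<in> {p \<oplus> r \<otimes> a | p r. p \<in> P \<and> r \<in> carrier R}"
proof -
  interpret P: ideal P R by fact
  have sub: "?J \<subseteq> carrier R" using P.Icarr assms(2) by auto
  have mult: "r \<otimes> x \<in> ?J" if "r \<in> carrier R" "x \<in> ?J" for r x
  proof -
    obtain p q where x: "p \<in> P" "q \<in> carrier R" "x = p \<oplus> q \<otimes> a" using \<open>x \<in> ?J\<close> by auto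
    have "r \<otimes> x = r \<otimes> p \<oplus> (r \<otimes> q) \<otimes> a"
      unfolding x(3) using P.Icarr[OF x(1)] x(2) that(1) assms(2) by (simp add: r_distr m_assoc)
    then show ?thesis using x that(1) P.I_l_closed by blast
  qed
  show "ideal ?J R"
  proof (rule idealI')
    show "?J \<subseteq> carrier R" by (rule sub)
    have "\<zero> = \<zero> \<oplus> \<zero> \<otimes> a" using assms(2) by simp
    then show "\<zero> \<in> ?J" using P.zero_closed by blast
    fix x y assume "x \<in> ?J" "y \<in> ?J"
    then obtain p q p' q' where x: "p \<in> P" "q \<in> carrier R" "x = p \<oplus> q \<otimes> a"
       "p' \<in> P" "q' \<in> carrier R" "y = p' \<oplus> q' \<otimes> a" by auto
    have "x \<oplus> y = (p \<oplus> p') \<oplus> (q \<oplus> q') \<otimes> a" unfolding x(3,6) using P.Icarr[OF x(1)] P.Icarr[OF x(4)] x(2,5) assms(2) by algebra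
    then show "x \<oplus> y \<in> ?J" using x by blast
  next
    fix r x assume *: "r \<in> carrier R" "x \<in> ?J"
    then show "r \<otimes> x \<in> ?J" by (rule mult)
    have "x \<otimes> r = r \<otimes> x" using *(1) subsetD[OF sub *(2)] by (simp add: m_comm)
    then show "x \<otimes> r \<in> ?J" using mult[OF *] by simp
  qed
  have "\<exists>q r. p = q \<oplus> r \<otimes> a \<and> q \<in> P \<and> r \<in> carrier R" if "p \<in> P" for p
    using P.Icarr[OF that] assms(2) that by (intro exI[of _ p] exI[of _ \<zero>]) simp
  then show "P \<subseteq> ?J" by blast
  have "\<exists>q r. a = q \<oplus> r \<otimes> a \<and> q \<in> P \<and> r \<in> carrier R"
    using assms(2) by (intro exI[of _ \<zero>] exI[of _ \<one>]) simp
  then show "a \<in> ?J" by blast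
qed

locale noetherian_cring = noetherian_ring R + cring R for R (structure)

text \<open>An ideal \<open>P\<close> maximal among those that contain \<open>I\<close> and miss \<open>S\<close> is prime: if \<open>a\<close> and \<open>b\<close> lie outside, then
  both \<open>P + R a\<close> and \<open>P + R b\<close> meet \<open>S\<close>, and the product of the two witnesses would lie in \<open>P\<close> if
  \<open>a b\<close> did.\<close>

lemma (in noetherian_cring) exists_prime_avoiding:
  assumes I: "ideal I R" and S: "\<one> \<in> S" "\<And>s t. s \<in> S \<Longrightarrow> t \<in> S \<Longrightarrow> s \<otimes> t \<in> S"
    and SR: "S \<subseteq> carrier R" and disj: "I \<inter> S = {}"
  obtains P where "primeideal P R" "I \<subseteq> P" "P \<inter> S = {}"
proof -
  let ?F = "{J. ideal J R \<and> I \<subseteq> J \<and> J \<inter> S = {}}"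
  have "?F \<noteq> {}" using I disj by blast
  then obtain P where "P \<in> ?F" and max: "\<And>J. J \<in> ?F \<Longrightarrow> P \<subseteq> J \<Longrightarrow> J = P"
    using maximal_member_of_ideal_family[of ?F] by blast
  then have P: "ideal P R" "I \<subseteq> P" "P \<inter> S = {}" by auto
  interpret P: ideal P R by fact
  have meets: "\<exists>p\<in>P. \<exists>r\<in>carrier R. p \<oplus> r \<otimes> a \<in> S" if "a \<in> carrier R" "a \<notin> P" for a
  proof -
    let ?J = "{p \<oplus> r \<otimes> a | p r. p \<in> P \<and> r \<in> carrier R}"
    have "?J \<noteq> P" using ideal_adjoin(3)[OF P(1) that(1)] that(2) by metis
    moreover have "ideal ?J R" "P \<subseteq> ?J" by (rule ideal_adjoin[OF P(1) that(1)])+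
    ultimately have "?J \<inter> S \<noteq> {}" using max[of ?J] P(2) by blast
    then show ?thesis by auto
  qed
  have "primeideal P R"
  proof (rule primeidealI[OF P(1) is_cring])
    show "carrier R \<noteq> P" using S(1) P(3) by auto
    fix a b assume ab: "a \<in> carrier R" "b \<in> carrier R" "a \<otimes> b \<in> P"
    show "a \<in> P \<or> b \<in> P"
    proof (rule ccontr)
      assume "\<not> (a \<in> P \<or> b \<in> P)"
      then obtain p r q t where pr: "p \<in> P" "r \<in> carrier R" "p \<oplus> r \<otimes> a \<in> S"
        and qt: "q \<in> P" "t \<in> carrier R" "q \<oplus> t \<otimes> b \<in> S"
        using meets ab by meson
      have c: "p \<in> carrier R" "q \<in> carrier R" using pr qt by (auto intro: P.Icarr)
      have "(p \<oplus> r \<otimes> a) \<otimes> (q \<oplus> t \<otimes> b) = (p \<otimes> (q \<oplus> t \<otimes> b)) \<oplus> ((r \<otimes> a) \<otimes> q \<oplus> (r \<otimes> t) \<otimes> (a \<otimes> b))"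
        using c pr(2) qt(2) ab(1,2) by algebra
      moreover have "\<dots> \<in> P"
        using P.I_r_closed[OF pr(1), of "q \<oplus> t \<otimes> b"] P.I_l_closed[OF qt(1), of "r \<otimes> a"]
          P.I_l_closed[OF ab(3), of "r \<otimes> t"] pr(2) qt(2) ab(1,2) c by simp
      ultimately show False using S(2)[OF pr(3) qt(3)] P(3) by auto
    qed
  qed
  then show thesis using that P by blast
qed

text \<open>The multiplicative set \<open>{s y\<^sup>n | s \<notin> P}\<close> contains \<open>y\<close> and the complement of \<open>P\<close>, so a prime that avoids it
  lies inside \<open>P\<close> and misses \<open>y\<close>. This supplies the chains of primes in the dimension arguments below.\<close>

lemma (in noetherian_cring) exists_prime_below_avoiding:
  assumes P: "primeideal P R" and y: "y \<in> carrier R" and I: "ideal I R"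
    and disj: "\<And>s n. s \<in> carrier R \<Longrightarrow> s \<notin> P \<Longrightarrow> s \<otimes> y [^] (n::nat) \<notin> I"
  obtains Q where "primeideal Q R" "I \<subseteq> Q" "Q \<subseteq> P" "y \<notin> Q"
proof -
  interpret P: primeideal P R by (rule P)
  define S where "S = {s \<otimes> y [^] (n::nat) | s n. s \<in> carrier R \<and> s \<notin> P}"
  have one: "\<one> \<in> carrier R" "\<one> \<notin> P" using P.I_notcarr P.one_imp_carrier by auto
  obtain Q where Q: "primeideal Q R" "I \<subseteq> Q" "Q \<inter> S = {}"
  proof (rule exists_prime_avoiding[OF I, of S])
    have "\<one> = \<one> \<otimes> y [^] (0::nat)" using y by simp
    then show "\<one> \<in> S" unfolding S_def using one by blast
    show "S \<subseteq> carrier R" unfolding S_def using y by auto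
    show "s \<otimes> t \<in> S" if st: "s \<in> S" "t \<in> S" for s t
    proof -
      obtain u n v k where uv: "u \<in> carrier R" "u \<notin> P" "s = u \<otimes> y [^] (n::nat)"
        "v \<in> carrier R" "v \<notin> P" "t = v \<otimes> y [^] (k::nat)" using st unfolding S_def by blast
      have c: "y [^] n \<in> carrier R" "y [^] k \<in> carrier R" using y by auto
      have "s \<otimes> t = (u \<otimes> v) \<otimes> (y [^] n \<otimes> y [^] k)" unfolding uv(3,6) using c uv(1,4) by algebra
      then have "s \<otimes> t = (u \<otimes> v) \<otimes> y [^] (n + k)" using y by (simp add: nat_pow_mult)
      moreover have "u \<otimes> v \<notin> P" using P.I_prime[OF uv(1,4)] uv(2,5) by blast
      ultimately show ?thesis unfolding S_def using uv(1,4) by blast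
    qed
    show "I \<inter> S = {}" unfolding S_def using disj by blast
  qed auto
  have "Q \<subseteq> P"
  proof
    fix q assume q: "q \<in> Q"
    have qR: "q \<in> carrier R" using ideal.Icarr[OF primeideal.axioms(1)[OF Q(1)] q] .
    then have "q = q \<otimes> y [^] (0::nat)" by simp
    then show "q \<in> P" using Q(3) q qR unfolding S_def by blast
  qed
  moreover have "y = \<one> \<otimes> y [^] (1::nat)" using y by (simp add: nat_pow_eone)
  then have "y \<in> S" unfolding S_def using one by blast
  then have "y \<notin> Q" using Q(3) by blast
  ultimately show thesis using that Q(1,2) by blast
qed

section \<open>Localization at a prime ideal\<close>

locale localization_at_prime = primeideal P R for P and R (structure)
begin

abbreviation frac where "frac \<equiv> fraction R P"
abbreviation RP where "RP \<equiv> localization R P"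
definition W where "W = carrier R - P"

lemma mem_W_iff: "s \<in> W \<longleftrightarrow> s \<in> carrier R \<and> s \<notin> P"
  by (simp add: W_def)

lemma WD [simp]: "s \<in> W \<Longrightarrow> s \<in> carrier R" by (simp add: W_def)

lemma W_mult [simp]: "s \<in> W \<Longrightarrow> t \<in> W \<Longrightarrow> s \<otimes> t \<in> W"
  using I_prime by (auto simp: mem_W_iff)

lemma one_W [simp]: "\<one> \<in> W"
  using I_notcarr one_imp_carrier by (auto simp: mem_W_iff)

lemma frac_eq_iff:
  assumes "a \<in> carrier R" "b \<in> carrier R" "s \<in> W" "t \<in> W"
  shows "frac a s = frac b t \<longleftrightarrow> (\<exists>u\<in>W. u \<otimes> (a \<otimes> t) = u \<otimes> (b \<otimes> s))"
proof
  assume "frac a s = frac b t"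
  moreover have "(b, t) \<in> frac b t" using assms one_W unfolding fraction_def W_def[symmetric] by blast
  ultimately have "(b, t) \<in> frac a s" by simp
  then show "\<exists>u\<in>W. u \<otimes> (a \<otimes> t) = u \<otimes> (b \<otimes> s)" unfolding fraction_def W_def[symmetric] by auto
next
  assume "\<exists>u\<in>W. u \<otimes> (a \<otimes> t) = u \<otimes> (b \<otimes> s)"
  then obtain u where u: "u \<in> W" "u \<otimes> (a \<otimes> t) = u \<otimes> (b \<otimes> s)" by blast
  have sub: "(c, v) \<in> frac b t"
    if *: "a \<in> carrier R" "b \<in> carrier R" "s \<in> W" "t \<in> W" "u \<in> W" "u \<otimes> (a \<otimes> t) = u \<otimes> (b \<otimes> s)"
      "(c, v) \<in> frac a s" for a b s t c v
  proof -
    obtain w where w: "w \<in> W" "w \<otimes> (a \<otimes> v) = w \<otimes> (c \<otimes> s)" "c \<in> carrier R" "v \<in> W"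
      using *(7) unfolding fraction_def W_def[symmetric] by blast
    have c: "s \<in> carrier R" "t \<in> carrier R" "u \<in> carrier R" "v \<in> carrier R" "w \<in> carrier R"
      using * w by auto
    have "(u \<otimes> w \<otimes> s) \<otimes> (b \<otimes> v) = (w \<otimes> v) \<otimes> (u \<otimes> (b \<otimes> s))"
      using c w(3) *(1,2) by algebra
    also have "\<dots> = (w \<otimes> v) \<otimes> (u \<otimes> (a \<otimes> t))" using *(6) by simp
    also have "\<dots> = (u \<otimes> t) \<otimes> (w \<otimes> (a \<otimes> v))" using c w(3) *(1,2) by algebra
    also have "\<dots> = (u \<otimes> w \<otimes> s) \<otimes> (c \<otimes> t)" unfolding w(2) using c w(3) *(1,2) by algebra
    finally show ?thesis
      using w *(2,3,5) W_mult unfolding fraction_def W_def[symmetric] by blast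
  qed
  show "frac a s = frac b t"
    using sub[OF assms u] sub[OF assms(2,1,4,3) u(1) u(2)[symmetric]] by auto
qed

lemma frac_eqI:
  assumes "a \<in> carrier R" "b \<in> carrier R" "s \<in> W" "t \<in> W" "a \<otimes> t = b \<otimes> s"
  shows "frac a s = frac b t"
  using assms one_W unfolding frac_eq_iff[OF assms(1-4)] by (metis)

lemma mem_fracD:
  assumes "(b, t) \<in> frac a s" "a \<in> carrier R" "s \<in> W"
  shows "b \<in> carrier R" "t \<in> W" "frac b t = frac a s"
proof -
  obtain u where u: "b \<in> carrier R" "t \<in> W" "u \<in> W" "u \<otimes> (a \<otimes> t) = u \<otimes> (b \<otimes> s)"
    using assms(1) unfolding fraction_def W_def[symmetric] by blast
  then show "b \<in> carrier R" "t \<in> W" "frac b t = frac a s"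
    using frac_eq_iff[OF u(1) assms(2) u(2) assms(3)] by metis+
qed

lemma self_mem_frac: "a \<in> carrier R \<Longrightarrow> s \<in> W \<Longrightarrow> (a, s) \<in> frac a s"
  unfolding fraction_def W_def[symmetric] using one_W by blast

lemma frac_in_carrier [simp]: "a \<in> carrier R \<Longrightarrow> s \<in> W \<Longrightarrow> frac a s \<in> carrier RP"
  unfolding localization_def W_def by auto

lemma frac_cases:
  assumes "x \<in> carrier RP"
  obtains a s where "a \<in> carrier R" "s \<in> W" "x = frac a s"
  using assms unfolding localization_def W_def by auto

lemma one_RP: "\<one>\<^bsub>RP\<^esub> = frac \<one> \<one>" and zero_RP: "\<zero>\<^bsub>RP\<^esub> = frac \<zero> \<one>"
  unfolding localization_def by auto

text \<open>The formulas for sum and product do not depend on the representatives, so that the unions in the definition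
  of the localization collapse to a single fraction.\<close>

lemma frac_cong_ops:
  assumes "a \<in> carrier R" "b \<in> carrier R" "s \<in> W" "t \<in> W"
    "a' \<in> carrier R" "b' \<in> carrier R" "s' \<in> W" "t' \<in> W"
    "frac a' s' = frac a s" "frac b' t' = frac b t"
  shows "frac (a' \<otimes> b') (s' \<otimes> t') = frac (a \<otimes> b) (s \<otimes> t)"
    and "frac (a' \<otimes> t' \<oplus> b' \<otimes> s') (s' \<otimes> t') = frac (a \<otimes> t \<oplus> b \<otimes> s) (s \<otimes> t)"
proof -
  obtain u v where u: "u \<in> W" "u \<otimes> (a' \<otimes> s) = u \<otimes> (a \<otimes> s')"
    and v: "v \<in> W" "v \<otimes> (b' \<otimes> t) = v \<otimes> (b \<otimes> t')"
    using assms frac_eq_iff by meson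
  have c: "s \<in> carrier R" "t \<in> carrier R" "u \<in> carrier R" "v \<in> carrier R" "s' \<in> carrier R" "t' \<in> carrier R"
    using assms u v by auto
  have "(u \<otimes> v) \<otimes> ((a' \<otimes> b') \<otimes> (s \<otimes> t)) = (u \<otimes> (a' \<otimes> s)) \<otimes> (v \<otimes> (b' \<otimes> t))"
    using c assms(1,2,5,6) by algebra
  also have "\<dots> = (u \<otimes> v) \<otimes> ((a \<otimes> b) \<otimes> (s' \<otimes> t'))"
    unfolding u(2) v(2) using c assms(1,2,5,6) by algebra
  finally show "frac (a' \<otimes> b') (s' \<otimes> t') = frac (a \<otimes> b) (s \<otimes> t)"
    using frac_eq_iff[of "a' \<otimes> b'" "a \<otimes> b" "s' \<otimes> t'" "s \<otimes> t"] assms W_mult u(1) v(1)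
    by (meson m_closed)
  have "(u \<otimes> v) \<otimes> ((a' \<otimes> t' \<oplus> b' \<otimes> s') \<otimes> (s \<otimes> t))
      = (u \<otimes> (a' \<otimes> s)) \<otimes> (v \<otimes> t \<otimes> t') \<oplus> (v \<otimes> (b' \<otimes> t)) \<otimes> (u \<otimes> s \<otimes> s')"
    using c assms(1,2,5,6) by algebra
  also have "\<dots> = (u \<otimes> v) \<otimes> ((a \<otimes> t \<oplus> b \<otimes> s) \<otimes> (s' \<otimes> t'))"
    unfolding u(2) v(2) using c assms(1,2,5,6) by algebra
  finally show "frac (a' \<otimes> t' \<oplus> b' \<otimes> s') (s' \<otimes> t') = frac (a \<otimes> t \<oplus> b \<otimes> s) (s \<otimes> t)"
    using frac_eq_iff[of "a' \<otimes> t' \<oplus> b' \<otimes> s'" "a \<otimes> t \<oplus> b \<otimes> s" "s' \<otimes> t'" "s \<otimes> t"] assms W_mult u(1) v(1) c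
    by (meson m_closed a_closed)
qed

lemma frac_mult:
  assumes "a \<in> carrier R" "b \<in> carrier R" "s \<in> W" "t \<in> W"
  shows "frac a s \<otimes>\<^bsub>RP\<^esub> frac b t = frac (a \<otimes> b) (s \<otimes> t)"
proof -
  have "frac (a' \<otimes> b') (s' \<otimes> t') = frac (a \<otimes> b) (s \<otimes> t)"
    if "(a', s') \<in> frac a s" "(b', t') \<in> frac b t" for a' s' b' t'
  proof -
    note A = mem_fracD[OF that(1) assms(1,3)] and B = mem_fracD[OF that(2) assms(2,4)]
    show ?thesis by (rule frac_cong_ops(1)[OF assms A(1) B(1) A(2) B(2) A(3) B(3)])
  qed
  then have "(\<Union>(a', s')\<in>frac a s. \<Union>(b', t')\<in>frac b t. frac (a' \<otimes> b') (s' \<otimes> t'))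
      = frac (a \<otimes> b) (s \<otimes> t)"
    by (intro UN_UN_constant[OF self_mem_frac[OF assms(1,3)] self_mem_frac[OF assms(2,4)]])
  then show ?thesis unfolding localization_def by simp
qed

lemma frac_add:
  assumes "a \<in> carrier R" "b \<in> carrier R" "s \<in> W" "t \<in> W"
  shows "frac a s \<oplus>\<^bsub>RP\<^esub> frac b t = frac (a \<otimes> t \<oplus> b \<otimes> s) (s \<otimes> t)"
proof -
  have "frac (a' \<otimes> t' \<oplus> b' \<otimes> s') (s' \<otimes> t') = frac (a \<otimes> t \<oplus> b \<otimes> s) (s \<otimes> t)"
    if "(a', s') \<in> frac a s" "(b', t') \<in> frac b t" for a' s' b' t'
  proof -
    note A = mem_fracD[OF that(1) assms(1,3)] and B = mem_fracD[OF that(2) assms(2,4)]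
    show ?thesis by (rule frac_cong_ops(2)[OF assms A(1) B(1) A(2) B(2) A(3) B(3)])
  qed
  then have "(\<Union>(a', s')\<in>frac a s. \<Union>(b', t')\<in>frac b t. frac (a' \<otimes> t' \<oplus> b' \<otimes> s') (s' \<otimes> t'))
      = frac (a \<otimes> t \<oplus> b \<otimes> s) (s \<otimes> t)"
    by (intro UN_UN_constant[OF self_mem_frac[OF assms(1,3)] self_mem_frac[OF assms(2,4)]])
  then show ?thesis unfolding localization_def by simp
qed

lemma frac_add_same:
  assumes "a \<in> carrier R" "b \<in> carrier R" "s \<in> W"
  shows "frac a s \<oplus>\<^bsub>RP\<^esub> frac b s = frac (a \<oplus> b) s"
  unfolding frac_add[OF assms(1,2,3,3)]
proof (rule frac_eqI)
  show "(a \<otimes> s \<oplus> b \<otimes> s) \<otimes> s = (a \<oplus> b) \<otimes> (s \<otimes> s)"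
    using assms(1,2) WD[OF assms(3)] by algebra
  show "s \<otimes> s \<in> W" using W_mult assms(3) by blast
  show "a \<otimes> s \<oplus> b \<otimes> s \<in> carrier R" "a \<oplus> b \<in> carrier R" using assms(1,2) WD[OF assms(3)] by auto
qed (rule assms)

lemma common_denominator:
  assumes "x \<in> carrier RP" "y \<in> carrier RP"
  obtains a b s where "a \<in> carrier R" "b \<in> carrier R" "s \<in> W" "x = frac a s" "y = frac b s"
proof -
  obtain a s where x: "a \<in> carrier R" "s \<in> W" "x = frac a s" using assms(1) by (rule frac_cases)
  obtain b t where y: "b \<in> carrier R" "t \<in> W" "y = frac b t" using assms(2) by (rule frac_cases)
  have st: "s \<otimes> t \<in> W" using x(2) y(2) by (rule W_mult)
  have "x = frac (a \<otimes> t) (s \<otimes> t)" unfolding x(3)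
    using x(1) WD[OF x(2)] WD[OF y(2)] by (intro frac_eqI st x(1,2)) (auto simp: m_ac)
  moreover have "y = frac (b \<otimes> s) (s \<otimes> t)" unfolding y(3)
    using y(1) WD[OF x(2)] WD[OF y(2)] by (intro frac_eqI st y(1,2)) (auto simp: m_ac)
  ultimately show thesis using that x y st by (metis WD m_closed)
qed

lemma cring_localization: "cring RP"
proof (rule cringI)
  show "abelian_group RP"
  proof (rule abelian_groupI)
    fix x y assume xy: "x \<in> carrier RP" "y \<in> carrier RP"
    obtain a b s where s: "a \<in> carrier R" "b \<in> carrier R" "s \<in> W" "x = frac a s" "y = frac b s"
      using common_denominator[OF xy] .
    then show "x \<oplus>\<^bsub>RP\<^esub> y \<in> carrier RP" by (simp add: frac_add_same)
    show "x \<oplus>\<^bsub>RP\<^esub> y = y \<oplus>\<^bsub>RP\<^esub> x" using s by (simp add: frac_add_same a_comm)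
    fix z assume "z \<in> carrier RP"
    then obtain c t where t: "c \<in> carrier R" "t \<in> W" "z = frac c t" by (rule frac_cases)
    show "x \<oplus>\<^bsub>RP\<^esub> y \<oplus>\<^bsub>RP\<^esub> z = x \<oplus>\<^bsub>RP\<^esub> (y \<oplus>\<^bsub>RP\<^esub> z)"
    proof -
      have 1: "x \<oplus>\<^bsub>RP\<^esub> y \<oplus>\<^bsub>RP\<^esub> z = frac ((a \<oplus> b) \<otimes> t \<oplus> c \<otimes> s) (s \<otimes> t)"
        using s t by (simp add: frac_add_same frac_add)
      have 2: "x \<oplus>\<^bsub>RP\<^esub> (y \<oplus>\<^bsub>RP\<^esub> z) = frac (a \<otimes> (s \<otimes> t) \<oplus> (b \<otimes> t \<oplus> c \<otimes> s) \<otimes> s) (s \<otimes> (s \<otimes> t))"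
        using s t by (simp add: frac_add)
      show ?thesis unfolding 1 2
      proof (rule frac_eqI)
        show "((a \<oplus> b) \<otimes> t \<oplus> c \<otimes> s) \<otimes> (s \<otimes> (s \<otimes> t))
           = (a \<otimes> (s \<otimes> t) \<oplus> (b \<otimes> t \<oplus> c \<otimes> s) \<otimes> s) \<otimes> (s \<otimes> t)"
          using s(1,2) t(1) WD[OF s(3)] WD[OF t(2)] by algebra
        show "s \<otimes> t \<in> W" "s \<otimes> (s \<otimes> t) \<in> W" using W_mult s(3) t(2) by blast+
        show "(a \<oplus> b) \<otimes> t \<oplus> c \<otimes> s \<in> carrier R"
          "a \<otimes> (s \<otimes> t) \<oplus> (b \<otimes> t \<oplus> c \<otimes> s) \<otimes> s \<in> carrier R"
          using s(1,2) t(1) WD[OF s(3)] WD[OF t(2)] by auto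
      qed
    qed
  next
    show "\<zero>\<^bsub>RP\<^esub> \<in> carrier RP" unfolding zero_RP by simp
    fix x assume "x \<in> carrier RP"
    then obtain a s where s: "a \<in> carrier R" "s \<in> W" "x = frac a s" by (rule frac_cases)
    show "\<zero>\<^bsub>RP\<^esub> \<oplus>\<^bsub>RP\<^esub> x = x"
      using s WD[OF s(2)] unfolding zero_RP by (simp add: frac_add)
    have "frac (\<ominus> a) s \<oplus>\<^bsub>RP\<^esub> x = frac \<zero> s" using s by (simp add: frac_add_same l_neg)
    also have "\<dots> = \<zero>\<^bsub>RP\<^esub>" unfolding zero_RP using s(2) WD[OF s(2)]
      by (intro frac_eqI) auto
    finally show "\<exists>y\<in>carrier RP. y \<oplus>\<^bsub>RP\<^esub> x = \<zero>\<^bsub>RP\<^esub>"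
      using s frac_in_carrier a_inv_closed by meson
  qed
  show "comm_monoid RP"
  proof (rule comm_monoidI)
    show "\<one>\<^bsub>RP\<^esub> \<in> carrier RP" unfolding one_RP by simp
    fix x y assume xy: "x \<in> carrier RP" "y \<in> carrier RP"
    obtain a b s where s: "a \<in> carrier R" "b \<in> carrier R" "s \<in> W" "x = frac a s" "y = frac b s"
      using common_denominator[OF xy] .
    then show "x \<otimes>\<^bsub>RP\<^esub> y \<in> carrier RP" by (simp add: frac_mult)
    show "x \<otimes>\<^bsub>RP\<^esub> y = y \<otimes>\<^bsub>RP\<^esub> x" using s by (simp add: frac_mult m_comm)
    fix z assume "z \<in> carrier RP"
    then obtain c t where t: "c \<in> carrier R" "t \<in> W" "z = frac c t" by (rule frac_cases)
    show "x \<otimes>\<^bsub>RP\<^esub> y \<otimes>\<^bsub>RP\<^esub> z = x \<otimes>\<^bsub>RP\<^esub> (y \<otimes>\<^bsub>RP\<^esub> z)"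
      using s t by (simp add: frac_mult m_assoc)
  next
    fix x assume "x \<in> carrier RP"
    then obtain a s where s: "a \<in> carrier R" "s \<in> W" "x = frac a s" by (rule frac_cases)
    then show "\<one>\<^bsub>RP\<^esub> \<otimes>\<^bsub>RP\<^esub> x = x" unfolding one_RP by (simp add: frac_mult)
  qed
  fix x y z assume xyz: "x \<in> carrier RP" "y \<in> carrier RP" "z \<in> carrier RP"
  obtain a b s where s: "a \<in> carrier R" "b \<in> carrier R" "s \<in> W" "x = frac a s" "y = frac b s"
    using common_denominator[OF xyz(1,2)] .
  obtain c t where t: "c \<in> carrier R" "t \<in> W" "z = frac c t" using xyz(3) by (rule frac_cases)
  show "(x \<oplus>\<^bsub>RP\<^esub> y) \<otimes>\<^bsub>RP\<^esub> z = x \<otimes>\<^bsub>RP\<^esub> z \<oplus>\<^bsub>RP\<^esub> y \<otimes>\<^bsub>RP\<^esub> z"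
    using s t by (simp add: frac_mult frac_add_same l_distr)
qed

text \<open>The extended ideal \<open>J R\<^sub>P\<close>.\<close>

definition extension where "extension J = {frac a s | a s. a \<in> J \<and> s \<in> W}"

lemma frac_mem_extension_iff:
  assumes "ideal J R" "a \<in> carrier R" "s \<in> W"
  shows "frac a s \<in> extension J \<longleftrightarrow> (\<exists>u\<in>W. u \<otimes> a \<in> J)"
proof
  interpret J: ideal J R by fact
  assume "frac a s \<in> extension J"
  then obtain b t where b: "b \<in> J" "t \<in> W" "frac a s = frac b t" unfolding extension_def by blast
  then obtain u where u: "u \<in> W" "u \<otimes> (a \<otimes> t) = u \<otimes> (b \<otimes> s)"
    using frac_eq_iff assms J.Icarr by meson
  have "(u \<otimes> t) \<otimes> a = u \<otimes> (a \<otimes> t)" using u b assms(2) by (simp add: m_ac)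
  also have "\<dots> \<in> J" unfolding u(2) using b u assms(3) by (simp add: J.I_l_closed J.I_r_closed)
  finally show "\<exists>u\<in>W. u \<otimes> a \<in> J" using u(1) b(2) W_mult by blast
next
  assume "\<exists>u\<in>W. u \<otimes> a \<in> J"
  then obtain u where u: "u \<in> W" "u \<otimes> a \<in> J" by blast
  have "frac a s = frac (u \<otimes> a) (u \<otimes> s)"
    using assms(2,3) u(1) by (intro frac_eqI W_mult) (auto simp: m_ac)
  then show "frac a s \<in> extension J" unfolding extension_def using u assms(3) W_mult by blast
qed

lemma ideal_extension:
  assumes "ideal J R" shows "ideal (extension J) RP"
proof -
  interpret J: ideal J R by fact
  interpret RP: cring RP by (rule cring_localization)
  have mult: "r \<otimes>\<^bsub>RP\<^esub> x \<in> extension J" if r: "r \<in> carrier RP" and x: "x \<in> extension J" for r x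
  proof -
    obtain b t where b: "b \<in> carrier R" "t \<in> W" "r = frac b t" using r by (rule frac_cases)
    obtain a s where a: "a \<in> J" "s \<in> W" "x = frac a s" using x unfolding extension_def by blast
    have "r \<otimes>\<^bsub>RP\<^esub> x = frac (b \<otimes> a) (t \<otimes> s)" using a b J.Icarr by (simp add: frac_mult)
    moreover have "b \<otimes> a \<in> J" using J.I_l_closed[OF a(1) b(1)] .
    ultimately show ?thesis unfolding extension_def using W_mult[OF b(2) a(2)] by blast
  qed
  have sub: "extension J \<subseteq> carrier RP" unfolding extension_def using J.Icarr frac_in_carrier by blast
  show ?thesis
  proof (rule RP.idealI')
    show "extension J \<subseteq> carrier RP" by fact
    show "\<zero>\<^bsub>RP\<^esub> \<in> extension J" unfolding zero_RP extension_def using one_W J.zero_closed by blast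
    fix x y assume "x \<in> extension J" "y \<in> extension J"
    then obtain a s b t where *: "a \<in> J" "s \<in> W" "x = frac a s" "b \<in> J" "t \<in> W" "y = frac b t"
      unfolding extension_def by blast
    have "x \<oplus>\<^bsub>RP\<^esub> y = frac (a \<otimes> t \<oplus> b \<otimes> s) (s \<otimes> t)"
      using * J.Icarr by (simp add: frac_add)
    moreover have "a \<otimes> t \<oplus> b \<otimes> s \<in> J" using * by (simp add: J.I_r_closed)
    ultimately show "x \<oplus>\<^bsub>RP\<^esub> y \<in> extension J" unfolding extension_def using * W_mult by blast
  next
    fix r x assume *: "r \<in> carrier RP" "x \<in> extension J"
    then show "r \<otimes>\<^bsub>RP\<^esub> x \<in> extension J" by (rule mult)
    then show "x \<otimes>\<^bsub>RP\<^esub> r \<in> extension J" using RP.m_comm[OF *(1) subsetD[OF sub *(2)]] by simp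
  qed
qed

lemma frac_mem_prime_extension_iff:
  assumes "primeideal Q R" "Q \<subseteq> P" "a \<in> carrier R" "s \<in> W"
  shows "frac a s \<in> extension Q \<longleftrightarrow> a \<in> Q"
proof -
  interpret Q: primeideal Q R by fact
  have "a \<in> Q" if u: "u \<in> W" "u \<otimes> a \<in> Q" for u
    using Q.I_prime[OF WD[OF u(1)] assms(3) u(2)] u(1) assms(2) by (auto simp: mem_W_iff)
  moreover have "\<one> \<otimes> a \<in> Q" if "a \<in> Q" using that assms(3) by simp
  ultimately show ?thesis
    unfolding frac_mem_extension_iff[OF Q.is_ideal assms(3,4)] using one_W by blast
qed

lemma prime_extension:
  assumes "primeideal Q R" "Q \<subseteq> P"
  shows "primeideal (extension Q) RP"
proof (rule primeidealI[OF ideal_extension cring_localization])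
  interpret Q: primeideal Q R by fact
  show "ideal Q R" by (rule Q.is_ideal)
  have "\<one> \<notin> Q" using assms(2) one_W by (auto simp: mem_W_iff)
  then have "frac \<one> \<one> \<notin> extension Q" using frac_mem_prime_extension_iff[OF assms, of \<one> \<one>] one_W by blast
  then show "carrier RP \<noteq> extension Q" using frac_in_carrier[OF one_closed one_W] by blast
  fix x y assume xy: "x \<in> carrier RP" "y \<in> carrier RP" "x \<otimes>\<^bsub>RP\<^esub> y \<in> extension Q"
  obtain a b s where s: "a \<in> carrier R" "b \<in> carrier R" "s \<in> W" "x = frac a s" "y = frac b s"
    using common_denominator[OF xy(1,2)] .
  then have "a \<otimes> b \<in> Q" using xy(3) frac_mem_prime_extension_iff[OF assms] by (simp add: frac_mult)
  then have "a \<in> Q \<or> b \<in> Q" using Q.I_prime s by blast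
  then show "x \<in> extension Q \<or> y \<in> extension Q"
    using s frac_mem_prime_extension_iff[OF assms] by blast
qed

text \<open>Depth and the local structure of the localization are expressed through nonunits; this identifies them with
  the extension of \<open>P\<close>.\<close>

lemma nonunits_localization: "carrier RP - Units RP = extension P"
proof -
  interpret RP: cring RP by (rule cring_localization)
  have P: "primeideal P R" by (rule primeideal_axioms)
  have mem: "frac a s \<in> extension P \<longleftrightarrow> a \<in> P" if "a \<in> carrier R" "s \<in> W" for a s
    using frac_mem_prime_extension_iff[OF P order_refl that] .
  interpret E: primeideal "extension P" RP using prime_extension[OF P] by simp
  have "x \<notin> extension P" if x: "x \<in> Units RP" for x
  proof
    assume "x \<in> extension P"
    moreover obtain y where "y \<in> carrier RP" "y \<otimes>\<^bsub>RP\<^esub> x = \<one>\<^bsub>RP\<^esub>" using RP.Units_l_inv_ex[OF x] by blast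
    ultimately have "\<one>\<^bsub>RP\<^esub> \<in> extension P" using E.I_l_closed by metis
    then show False using E.I_notcarr E.one_imp_carrier by simp
  qed
  moreover have "x \<in> Units RP" if x: "x \<in> carrier RP" "x \<notin> extension P" for x
  proof -
    obtain a s where s: "a \<in> carrier R" "s \<in> W" "x = frac a s" using x(1) by (rule frac_cases)
    have a: "a \<in> W" using x(2) mem[OF s(1,2)] s by (simp add: mem_W_iff)
    have "frac s a \<otimes>\<^bsub>RP\<^esub> x = \<one>\<^bsub>RP\<^esub>"
      unfolding s(3) one_RP frac_mult[OF WD[OF s(2)] s(1) a s(2)]
      using s a W_mult by (intro frac_eqI) (auto simp: m_comm)
    then show ?thesis using x(1) frac_in_carrier[OF WD[OF s(2)] a] RP.m_comm[OF x(1)]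
      unfolding Units_def by auto
  qed
  moreover have "extension P \<subseteq> carrier RP" using E.a_subset .
  ultimately show ?thesis by blast
qed

end

section \<open>Standard graded rings\<close>

lemma (in abelian_monoid) finsum_mem_closed:
  assumes "H \<subseteq> carrier G" "\<zero> \<in> H" "\<And>x y. x \<in> H \<Longrightarrow> y \<in> H \<Longrightarrow> x \<oplus> y \<in> H"
    and "\<And>i. i \<in> A \<Longrightarrow> f i \<in> H"
  shows "(\<Oplus>i\<in>A. f i) \<in> H"
proof (cases "finite A")
  case True
  then show ?thesis using assms(4)
  proof (induction A rule: finite_induct)
    case (insert a A)
    have "(\<Oplus>i\<in>insert a A. f i) = f a \<oplus> (\<Oplus>i\<in>A. f i)"
      using insert assms(1) by (intro finsum_insert) auto
    then show ?case using insert assms(3) by auto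
  qed (use assms in auto)
next
  case False
  then show ?thesis using assms(2) by (simp add: finsum_infinite)
qed

lemma (in abelian_monoid) finsum_support:
  assumes "finite A" "\<And>i. i \<notin> A \<Longrightarrow> f i = \<zero>" "\<And>i. f i \<in> carrier G"
  shows "(\<Oplus>i\<in>{i. f i \<noteq> \<zero>}. f i) = (\<Oplus>i\<in>A. f i)"
  by (rule add.finprod_mono_neutral_cong_left[simplified]) (use assms in auto)

locale standard_graded = noetherian_cring R for R (structure) +
  fixes G :: "nat \<Rightarrow> 'a set"
  assumes standard: "standard_graded_ring R G"
begin

lemma graded_facts:
  shows additive_G: "additive_subgroup (G i) R"
    and mult_G: "x \<in> G i \<Longrightarrow> y \<in> G j \<Longrightarrow> x \<otimes> y \<in> G (i + j)"
    and subfield_G0: "subfield (G 0) R"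
    and generated: "generate_ring R (G 0 \<union> G 1) = carrier R"
    and unique_decomposition: "x \<in> carrier R \<Longrightarrow> \<exists>!c. (\<forall>i. c i \<in> G i) \<and> finite {i. c i \<noteq> \<zero>} \<and>
        x = (\<Oplus>i\<in>{i. c i \<noteq> \<zero>}. c i)"
  using standard unfolding standard_graded_ring_def graded_ring_def internal_direct_sum_def by auto

lemma G_carrier [simp]: "x \<in> G i \<Longrightarrow> x \<in> carrier R"
  using additive_subgroup.a_subset[OF additive_G] by blast

lemma G_zero [simp]: "\<zero> \<in> G i" by (rule additive_subgroup.zero_closed[OF additive_G])

lemma G_add [simp]: "x \<in> G i \<Longrightarrow> y \<in> G i \<Longrightarrow> x \<oplus> y \<in> G i"
  by (rule additive_subgroup.a_closed[OF additive_G])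

lemma G_minus [simp]: "x \<in> G i \<Longrightarrow> \<ominus> x \<in> G i"
  using additive_subgroup.a_inv_closed[OF additive_G] .

lemma G_one [simp]: "\<one> \<in> G 0"
  using subfield_G0 by (meson subfieldE(1) subringE(3) subcring.axioms(1) subdomain.axioms(1) subfield.axioms(1))

lemma G0_scale [simp]: "c \<in> G 0 \<Longrightarrow> x \<in> G i \<Longrightarrow> c \<otimes> x \<in> G i"
  using mult_G[of c 0 x i] by simp

lemma G0_inverse:
  assumes "c \<in> G 0" "c \<noteq> \<zero>"
  obtains d where "d \<in> G 0" "d \<otimes> c = \<one>" "d \<noteq> \<zero>"
proof -
  have "inv c \<in> G 0 - {\<zero>}" "inv c \<otimes> c = \<one>"
    using subfield_m_inv[OF subfield_G0, of c] assms by auto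
  then show thesis using that by blast
qed

lemma one_nz: "\<one> \<noteq> \<zero>"
  using subfieldE(6)[OF subfield_G0] by simp

definition comp where "comp x = (THE c. (\<forall>i. c i \<in> G i) \<and> finite {i. c i \<noteq> \<zero>} \<and>
        x = (\<Oplus>i\<in>{i. c i \<noteq> \<zero>}. c i))"

lemma comp_facts:
  assumes "x \<in> carrier R"
  shows comp_in [simp]: "comp x i \<in> G i"
    and finite_comp: "finite {i. comp x i \<noteq> \<zero>}"
    and sum_comp: "x = (\<Oplus>i\<in>{i. comp x i \<noteq> \<zero>}. comp x i)"
  using theI'[OF unique_decomposition[OF assms]] unfolding comp_def by blast+

lemma comp_carrier [simp]: "x \<in> carrier R \<Longrightarrow> comp x i \<in> carrier R"
  using comp_in G_carrier by blast

lemma sum_comp':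
  assumes "x \<in> carrier R" "finite A" "{i. comp x i \<noteq> \<zero>} \<subseteq> A"
  shows "x = (\<Oplus>i\<in>A. comp x i)"
proof -
  have "(\<Oplus>i\<in>{i. comp x i \<noteq> \<zero>}. comp x i) = (\<Oplus>i\<in>A. comp x i)"
    using assms by (intro finsum_support) auto
  then show ?thesis using sum_comp[OF assms(1)] by simp
qed

lemma comp_eqI:
  assumes "finite A" "\<And>i. c i \<in> G i" "\<And>i. i \<notin> A \<Longrightarrow> c i = \<zero>" "x = (\<Oplus>i\<in>A. c i)"
  shows "comp x = c"
proof -
  have c: "\<And>i. c i \<in> carrier R" using assms(2) G_carrier by blast
  then have "x \<in> carrier R" unfolding assms(4) by (intro finsum_closed) auto
  moreover have "x = (\<Oplus>i\<in>{i. c i \<noteq> \<zero>}. c i)"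
    unfolding assms(4) by (rule finsum_support[OF assms(1,3) c, symmetric])
  moreover have "finite {i. c i \<noteq> \<zero>}"
    by (rule finite_subset[OF _ assms(1)]) (use assms(3) in blast)
  ultimately show ?thesis
    unfolding comp_def using assms(2) unique_decomposition[of x] by (intro the1_equality) auto
qed

lemma comp_add:
  assumes "x \<in> carrier R" "y \<in> carrier R"
  shows "comp (x \<oplus> y) i = comp x i \<oplus> comp y i"
proof -
  let ?A = "{i. comp x i \<noteq> \<zero>} \<union> {i. comp y i \<noteq> \<zero>}"
  have f: "finite ?A" using assms finite_comp by simp
  have "x \<oplus> y = (\<Oplus>i\<in>?A. comp x i) \<oplus> (\<Oplus>i\<in>?A. comp y i)"
    using sum_comp'[OF assms(1) f] sum_comp'[OF assms(2) f] by simp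
  also have "\<dots> = (\<Oplus>i\<in>?A. comp x i \<oplus> comp y i)"
    using assms by (intro finsum_addf[symmetric]) auto
  finally have "comp (x \<oplus> y) = (\<lambda>i. comp x i \<oplus> comp y i)"
    using assms by (intro comp_eqI[OF f]) auto
  then show ?thesis by simp
qed

lemma comp_homogeneous: "g \<in> G n \<Longrightarrow> comp g i = (if i = n then g else \<zero>)"
  using comp_eqI[of "{n}" "\<lambda>i. if i = n then g else \<zero>" g] by simp

lemma comp_homogeneous_same [simp]: "g \<in> G n \<Longrightarrow> comp g n = g"
  by (simp add: comp_homogeneous)

lemma comp_zero [simp]: "comp \<zero> i = \<zero>"
  using comp_homogeneous[of \<zero> 0] by simp

lemma comp_minus:
  assumes "x \<in> carrier R" shows "comp (\<ominus> x) i = \<ominus> (comp x i)"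
proof -
  have "comp (\<ominus> x) i \<oplus> comp x i = \<zero>"
    using comp_add[of "\<ominus> x" x i] assms by (simp add: l_neg)
  then show ?thesis using assms by (metis a_inv_closed comp_carrier minus_equality)
qed

lemma comp_diff:
  assumes "x \<in> carrier R" "y \<in> carrier R"
  shows "comp (x \<ominus> y) i = comp x i \<ominus> comp y i"
  using assms by (simp add: minus_eq comp_add comp_minus)

lemma comp_finsum:
  assumes "finite A" "\<And>j. j \<in> A \<Longrightarrow> f j \<in> carrier R"
  shows "comp (\<Oplus>j\<in>A. f j) i = (\<Oplus>j\<in>A. comp (f j) i)"
  using assms
proof (induction A rule: finite_induct)
  case (insert a A)
  have "comp (\<Oplus>j\<in>insert a A. f j) i = comp (f a \<oplus> (\<Oplus>j\<in>A. f j)) i"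
    using insert by (subst finsum_insert) auto
  also have "\<dots> = comp (f a) i \<oplus> comp (\<Oplus>j\<in>A. f j) i"
    using insert by (intro comp_add finsum_closed) auto
  also have "\<dots> = (\<Oplus>j\<in>insert a A. comp (f j) i)"
    using insert by (subst finsum_insert) auto
  finally show ?case .
qed simp

lemma eq_if_comps_eq:
  assumes "x \<in> carrier R" "y \<in> carrier R" "\<And>i. comp x i = comp y i"
  shows "x = y"
proof -
  have "comp x = comp y" using assms(3) by auto
  then show ?thesis using sum_comp[OF assms(1)] sum_comp[OF assms(2)] by simp
qed

lemma comp_homogeneous_mult:
  assumes "g \<in> G n" "x \<in> carrier R"
  shows "comp (g \<otimes> x) i = (if n \<le> i then g \<otimes> comp x (i - n) else \<zero>)"
proof -
  let ?A = "{i. comp x i \<noteq> \<zero>}"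
  have inj: "inj_on (\<lambda>i. n + i) ?A" by simp
  have "g \<otimes> x = (\<Oplus>i\<in>?A. g \<otimes> comp x i)"
    using sum_comp[OF assms(2)] finsum_rdistr[of ?A g "comp x"] assms finite_comp by auto
  also have "\<dots> = (\<Oplus>i\<in>(\<lambda>i. n + i) ` ?A. if n \<le> i then g \<otimes> comp x (i - n) else \<zero>)"
    using assms by (subst finsum_reindex[OF _ inj]) auto
  finally have "comp (g \<otimes> x) = (\<lambda>i. if n \<le> i then g \<otimes> comp x (i - n) else \<zero>)"
  proof (rule comp_eqI[rotated 3])
    show "finite ((\<lambda>i. n + i) ` ?A)" using assms finite_comp by simp
    fix i
    show "(if n \<le> i then g \<otimes> comp x (i - n) else \<zero>) \<in> G i"
      using mult_G[OF assms(1) comp_in[OF assms(2)], of "i - n"] by (cases "n \<le> i") auto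
    assume "i \<notin> (\<lambda>i. n + i) ` ?A"
    then have "comp x (i - n) = \<zero>" if "n \<le> i"
      using that by (metis (mono_tags, lifting) imageI le_add_diff_inverse mem_Collect_eq)
    then show "(if n \<le> i then g \<otimes> comp x (i - n) else \<zero>) = \<zero>" using assms by simp
  qed
  then show ?thesis by simp
qed

lemma comp_mult:
  assumes "x \<in> carrier R" "y \<in> carrier R"
  shows "comp (x \<otimes> y) n = (\<Oplus>i\<in>{..n}. comp x i \<otimes> comp y (n - i))"
proof -
  let ?A = "{i. comp x i \<noteq> \<zero>} \<union> {..n}"
  have A: "finite ?A" using finite_comp[OF assms(1)] by simp
  have "x \<otimes> y = (\<Oplus>i\<in>?A. comp x i) \<otimes> y" using sum_comp'[OF assms(1) A] by simp
  also have "\<dots> = (\<Oplus>i\<in>?A. comp x i \<otimes> y)"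
    using assms A by (intro finsum_ldistr) auto
  finally have "comp (x \<otimes> y) n = (\<Oplus>i\<in>?A. comp (comp x i \<otimes> y) n)"
    using comp_finsum[OF A, of "\<lambda>i. comp x i \<otimes> y" n] assms by simp
  also have "\<dots> = (\<Oplus>i\<in>{..n}. comp x i \<otimes> comp y (n - i))"
    using assms A comp_homogeneous_mult[OF comp_in[OF assms(1)] assms(2)]
    by (intro add.finprod_mono_neutral_cong_right[simplified]) auto
  finally show ?thesis .
qed

lemma comp_mult_0:
  assumes "x \<in> carrier R" "y \<in> carrier R"
  shows "comp (x \<otimes> y) 0 = comp x 0 \<otimes> comp y 0"
  using assms by (simp add: comp_mult finsum_0)

lemma comp_mult_1:
  assumes "x \<in> carrier R" "y \<in> carrier R"
  shows "comp (x \<otimes> y) 1 = comp x 0 \<otimes> comp y 1 \<oplus> comp x 1 \<otimes> comp y 0"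
  using assms comp_mult[OF assms, of 1] by (simp add: finsum_Suc finsum_0 a_comm)

text \<open>In lowest degree only the constant term of the other factor contributes.\<close>

lemma comp_mult_lowest:
  assumes "x \<in> carrier R" "y \<in> carrier R" "\<And>j. j < n \<Longrightarrow> comp y j = \<zero>"
  shows "comp (x \<otimes> y) n = comp x 0 \<otimes> comp y n"
proof -
  have "comp (x \<otimes> y) n = (\<Oplus>i\<in>{0}. comp x i \<otimes> comp y (n - i))"
    unfolding comp_mult[OF assms(1,2)]
    using assms by (intro add.finprod_mono_neutral_cong_right[simplified]) auto
  then show ?thesis using assms by simp
qed

subsection \<open>The irrelevant ideal\<close>

abbreviation "\<mm> \<equiv> irrelevant_ideal R G"

lemma irrelevant_eq: "\<mm> = {x \<in> carrier R. comp x 0 = \<zero>}"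
proof (intro equalityI subsetI)
  fix y assume "y \<in> \<mm>"
  then obtain A x where A: "finite A" "0 \<notin> A" "\<forall>i\<in>A. x i \<in> G i" "y = (\<Oplus>i\<in>A. x i)"
    unfolding irrelevant_ideal_def by blast
  have "comp y 0 = (\<Oplus>i\<in>A. comp (x i) 0)"
    unfolding A(4) using A by (intro comp_finsum) auto
  also have "\<dots> = (\<Oplus>i\<in>A. \<zero>)"
    using A by (intro finsum_cong') (auto simp: comp_homogeneous)
  also have "\<dots> = \<zero>" by simp
  finally show "y \<in> {x \<in> carrier R. comp x 0 = \<zero>}"
    using A by (auto intro!: finsum_closed)
next
  fix y assume "y \<in> {x \<in> carrier R. comp x 0 = \<zero>}"
  then have y: "y \<in> carrier R" "comp y 0 = \<zero>" by auto
  have "finite {i. comp y i \<noteq> \<zero>}" "0 \<notin> {i. comp y i \<noteq> \<zero>}" "\<forall>i\<in>{i. comp y i \<noteq> \<zero>}. comp y i \<in> G i"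
    using y finite_comp by auto
  then show "y \<in> \<mm>" unfolding irrelevant_ideal_def using sum_comp[OF y(1)] by blast
qed

lemma irrelevantI: "x \<in> carrier R \<Longrightarrow> comp x 0 = \<zero> \<Longrightarrow> x \<in> \<mm>"
  and irrelevantD: "x \<in> \<mm> \<Longrightarrow> comp x 0 = \<zero>"
  by (simp_all add: irrelevant_eq)

lemma nonirrelevant_constant_inverse:
  assumes "t \<in> carrier R" "t \<notin> \<mm>"
  obtains d where "d \<in> G 0" "d \<otimes> comp t 0 = \<one>"
  using G0_inverse[OF comp_in[OF assms(1)]] irrelevantI[OF assms(1)] assms(2) by blast

lemma irrelevant_carrier: "x \<in> \<mm> \<Longrightarrow> x \<in> carrier R"
  by (simp add: irrelevant_eq)

lemma G1_irrelevant: "G 1 \<subseteq> \<mm>"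
  by (auto simp: irrelevant_eq comp_homogeneous)

lemma ideal_irrelevant: "ideal \<mm> R"
  by (rule idealI') (auto simp: irrelevant_eq comp_add comp_mult_0)

lemma constant_plus_irrelevant:
  assumes "x \<in> carrier R"
  obtains y where "y \<in> \<mm>" "x = comp x 0 \<oplus> y"
proof
  show "x \<ominus> comp x 0 \<in> \<mm>"
    using assms comp_diff[of x "comp x 0" 0] by (auto simp: irrelevant_eq r_neg minus_eq)
  show "x = comp x 0 \<oplus> (x \<ominus> comp x 0)" using assms comp_carrier[OF assms, of 0] by algebra
qed

lemma maximal_irrelevant: "maximalideal \<mm> R"
proof (rule maximalidealI[OF ideal_irrelevant])
  have "\<one> \<notin> \<mm>" using one_nz by (simp add: irrelevant_eq)
  then show "carrier R \<noteq> \<mm>" by blast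
  fix J assume J: "ideal J R" "\<mm> \<subseteq> J" "J \<subseteq> carrier R"
  interpret J: ideal J R by fact
  show "J = \<mm> \<or> J = carrier R"
  proof (cases "J \<subseteq> \<mm>")
    case False
    then obtain x where x: "x \<in> J" "x \<notin> \<mm>" by blast
    then have xR: "x \<in> carrier R" "comp x 0 \<noteq> \<zero>" using J(3) by (auto simp: irrelevant_eq)
    obtain y where y: "y \<in> \<mm>" "x = comp x 0 \<oplus> y" using constant_plus_irrelevant[OF xR(1)] .
    have "(comp x 0 \<oplus> y) \<ominus> y = comp x 0"
      using comp_carrier[OF xR(1), of 0] irrelevant_carrier[OF y(1)] by algebra
    then have "comp x 0 = x \<ominus> y" using y(2) by simp
    also have "\<dots> \<in> J"
      unfolding minus_eq using x(1) subsetD[OF J(2) y(1)] by (intro J.a_closed J.a_inv_closed)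
    finally have c: "comp x 0 \<in> J" .
    obtain d where "d \<in> G 0" "d \<otimes> comp x 0 = \<one>" using G0_inverse xR comp_in by blast
    then have "\<one> \<in> J" using J.I_l_closed[OF c, of d] by simp
    then show ?thesis using J.one_imp_carrier by simp
  qed (use J in auto)
qed

lemma prime_irrelevant: "primeideal \<mm> R"
  by (rule maximalideal_prime[OF maximal_irrelevant])

text \<open>An element with nonzero constant term does not kill the lowest component of \<open>r\<close>. Consequently \<open>R\<close> embeds
  into its localization at \<open>\<mm>\<close>.\<close>

lemma nonirrelevant_mult_zero:
  assumes "t \<in> carrier R" "t \<notin> \<mm>" "r \<in> carrier R" "t \<otimes> r = \<zero>"
  shows "r = \<zero>"
proof (rule ccontr)
  assume "r \<noteq> \<zero>"
  then have "\<exists>n. comp r n \<noteq> \<zero>" using eq_if_comps_eq[OF assms(3) zero_closed] by auto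
  define n where "n = (LEAST n. comp r n \<noteq> \<zero>)"
  have n: "comp r n \<noteq> \<zero>" unfolding n_def using \<open>\<exists>n. comp r n \<noteq> \<zero>\<close> by (rule LeastI_ex)
  have "comp r j = \<zero>" if "j < n" for j using that not_less_Least unfolding n_def by blast
  then have "comp t 0 \<otimes> comp r n = \<zero>" using comp_mult_lowest[OF assms(1,3)] assms(4) by simp
  moreover obtain d where "d \<in> G 0" "d \<otimes> comp t 0 = \<one>"
    using G0_inverse[OF comp_in[OF assms(1)]] assms(1,2) by (auto simp: irrelevant_eq)
  ultimately have "comp r n = \<zero>"
    using assms comp_carrier G_carrier by (metis l_one m_assoc r_null)
  then show False using n by simp
qed

text \<open>Modulo an ideal containing \<open>R\<^sub>1\<close>, every element of the subring generated by \<open>R\<^sub>0\<close> and \<open>R\<^sub>1\<close> agrees with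
  its constant term.\<close>

lemma irrelevant_subset_ideal:
  assumes "ideal I R" "G 1 \<subseteq> I"
  shows "\<mm> \<subseteq> I"
proof
  interpret I: ideal I R by fact
  fix x assume x: "x \<in> \<mm>"
  have "x' \<ominus> comp x' 0 \<in> I" if "x' \<in> generate_ring R (G 0 \<union> G 1)" for x'
    using that
  proof (induction rule: generate_ring.induct)
    case one
    then show ?case by (simp add: minus_eq r_neg)
  next
    case (incl h)
    then show ?case using assms(2) by (auto simp: minus_eq r_neg comp_homogeneous)
  next
    case (a_inv h)
    then have h: "h \<in> carrier R" by (simp add: generated[symmetric])
    have "\<ominus> h \<ominus> comp (\<ominus> h) 0 = \<ominus> (h \<ominus> comp h 0)"
      using h comp_carrier[OF h, of 0] by (simp add: comp_minus minus_eq minus_add)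
    then show ?case using a_inv.IH by simp
  next
    case (eng_add h k)
    then have h: "h \<in> carrier R" "k \<in> carrier R" by (simp_all add: generated[symmetric])
    have "(h \<oplus> k) \<ominus> comp (h \<oplus> k) 0 = (h \<ominus> comp h 0) \<oplus> (k \<ominus> comp k 0)"
      unfolding comp_add[OF h] using h comp_carrier[OF h(1), of 0] comp_carrier[OF h(2), of 0] by algebra
    then show ?case using eng_add.IH by simp
  next
    case (eng_mult h k)
    then have h: "h \<in> carrier R" "k \<in> carrier R" by (simp_all add: generated[symmetric])
    have "(h \<otimes> k) \<ominus> comp (h \<otimes> k) 0 = (h \<ominus> comp h 0) \<otimes> k \<oplus> comp h 0 \<otimes> (k \<ominus> comp k 0)"
      unfolding comp_mult_0[OF h] using h comp_carrier[OF h(1), of 0] comp_carrier[OF h(2), of 0] by algebra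
    then show ?case
      using I.I_r_closed[OF eng_mult.IH(1) h(2)] I.I_l_closed[OF eng_mult.IH(2), of "comp h 0"] h by simp
  qed
  then have "x \<ominus> comp x 0 \<in> I" using irrelevant_carrier[OF x] unfolding generated by blast
  moreover have "x \<ominus> comp x 0 = x" using x by (auto simp: irrelevant_eq minus_eq)
  ultimately show "x \<in> I" by simp
qed

end

section \<open>Nonzerodivisors\<close>

context cring begin

definition nonzerodivisor where
  "nonzerodivisor z \<longleftrightarrow> z \<in> carrier R \<and> (\<forall>r\<in>carrier R. z \<otimes> r = \<zero> \<longrightarrow> r = \<zero>)"

definition ann where "ann r = {a \<in> carrier R. a \<otimes> r = \<zero>}"

lemma annI: "a \<in> carrier R \<Longrightarrow> a \<otimes> r = \<zero> \<Longrightarrow> a \<in> ann r"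
  and annD: "a \<in> ann r \<Longrightarrow> a \<in> carrier R" "a \<in> ann r \<Longrightarrow> a \<otimes> r = \<zero>"
  by (simp_all add: ann_def)

lemma nonzerodivisor_cancel:
  assumes "nonzerodivisor z" "x \<in> carrier R" "y \<in> carrier R" "z \<otimes> x = z \<otimes> y"
  shows "x = y"
proof -
  have z: "z \<in> carrier R" using assms(1) by (simp add: nonzerodivisor_def)
  have "z \<otimes> (x \<ominus> y) = \<zero>" using assms z by algebra
  then have "x \<ominus> y = \<zero>" using assms by (simp add: nonzerodivisor_def)
  then show ?thesis using assms by simp
qed

lemma nonzerodivisor_pow:
  assumes "nonzerodivisor z" shows "nonzerodivisor (z [^] (n::nat))"
proof -
  have z: "z \<in> carrier R" using assms by (simp add: nonzerodivisor_def)
  have "r = \<zero>" if "r \<in> carrier R" "z [^] n \<otimes> r = \<zero>" for r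
    using that
  proof (induction n arbitrary: r)
    case (Suc n)
    have "z [^] n \<otimes> (z \<otimes> r) = \<zero>" using Suc.prems z by (simp add: m_assoc)
    then have "z \<otimes> r = \<zero>" using Suc.IH[of "z \<otimes> r"] Suc.prems(1) z by simp
    then show ?case using assms Suc.prems(1) by (simp add: nonzerodivisor_def)
  qed simp
  then show ?thesis using z by (simp add: nonzerodivisor_def)
qed

lemma ideal_ann:
  assumes "r \<in> carrier R" shows "ideal (ann r) R"
proof (rule idealI')
  fix s x assume s: "s \<in> carrier R" "x \<in> ann r"
  then have x: "x \<in> carrier R" "x \<otimes> r = \<zero>" by (auto simp: ann_def)
  have "(s \<otimes> x) \<otimes> r = s \<otimes> (x \<otimes> r)" "(x \<otimes> s) \<otimes> r = s \<otimes> (x \<otimes> r)"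
    using s(1) x(1) assms by algebra+
  then show "s \<otimes> x \<in> ann r" "x \<otimes> s \<in> ann r" using s(1) x by (auto simp: ann_def)
qed (use assms in \<open>auto simp: ann_def l_distr\<close>)

end

text \<open>These are the maximal associated primes. A maximal annihilator of a nonzero element is prime, and every zero
  divisor lies in one. For finiteness let \<open>Y\<close> be the set of elements with maximal annihilator, and choose a
  finite \<open>F \<subseteq> Y\<close> such that the ideal generated by \<open>F\<close> is as large as possible; it then contains \<open>Y\<close>. If some
  \<open>x \<in> Y\<close> had an annihilator different from all \<open>ann f\<close>, \<open>f \<in> F\<close>, a product of elements of the sets
  \<open>ann f - ann x\<close> would kill \<open>F\<close>, hence \<open>x\<close>, although it lies outside the prime \<open>ann x\<close>.\<close>

lemma (in noetherian_cring) zero_divisors_in_finitely_many_annihilators: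
  obtains F where "finite F" "F \<subseteq> carrier R - {\<zero>}" "\<And>f. f \<in> F \<Longrightarrow> primeideal (ann f) R"
    "\<And>z. z \<in> carrier R \<Longrightarrow> \<not> nonzerodivisor z \<Longrightarrow> \<exists>f\<in>F. z \<in> ann f"
proof -
  define N where "N = carrier R - {\<zero>}"
  define Y where "Y = {r \<in> N. \<forall>s\<in>N. ann r \<subseteq> ann s \<longrightarrow> ann s = ann r}"
  have YN: "x \<in> carrier R" "x \<noteq> \<zero>" if "x \<in> Y" for x using that by (auto simp: Y_def N_def)
  have prime: "primeideal (ann r) R" if r: "r \<in> Y" for r
  proof (rule primeidealI[OF ideal_ann[OF YN(1)[OF r]] is_cring])
    have "\<one> \<notin> ann r" using YN[OF r] by (simp add: ann_def)
    then show "carrier R \<noteq> ann r" by blast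
    fix a b assume ab: "a \<in> carrier R" "b \<in> carrier R" "a \<otimes> b \<in> ann r"
    show "a \<in> ann r \<or> b \<in> ann r"
    proof (cases "b \<otimes> r = \<zero>")
      case False
      have rR: "r \<in> carrier R" by (rule YN(1)[OF r])
      have "ann r \<subseteq> ann (b \<otimes> r)"
      proof
        fix x assume "x \<in> ann r"
        then have x: "x \<in> carrier R" "x \<otimes> r = \<zero>" by (auto simp: ann_def)
        have "x \<otimes> (b \<otimes> r) = b \<otimes> (x \<otimes> r)" using x(1) ab(2) rR by algebra
        then show "x \<in> ann (b \<otimes> r)" using x ab(2) by (simp add: ann_def)
      qed
      moreover have "b \<otimes> r \<in> N" using False ab(2) rR by (simp add: N_def)
      ultimately have "ann (b \<otimes> r) = ann r" using r by (auto simp: Y_def)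
      moreover have "a \<in> ann (b \<otimes> r)" using ab rR by (simp add: ann_def m_assoc)
      ultimately show ?thesis by blast
    qed (use ab in \<open>simp add: ann_def\<close>)
  qed
  have above: "\<exists>x\<in>Y. ann r \<subseteq> ann x" if r: "r \<in> N" for r
  proof -
    let ?F = "{ann s | s. s \<in> N \<and> ann r \<subseteq> ann s}"
    have "?F \<noteq> {}" using r by blast
    moreover have "\<And>J. J \<in> ?F \<Longrightarrow> ideal J R" using ideal_ann by (auto simp: N_def)
    ultimately obtain J where J: "J \<in> ?F" and max: "\<And>K. K \<in> ?F \<Longrightarrow> J \<subseteq> K \<Longrightarrow> K = J"
      using maximal_member_of_ideal_family[of ?F] by blast
    obtain s where s: "s \<in> N" "ann r \<subseteq> ann s" "J = ann s" using J by blast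
    have "ann t = ann s" if "t \<in> N" "ann s \<subseteq> ann t" for t
      using max[of "ann t"] that s by blast
    then have "s \<in> Y" using s(1) by (simp add: Y_def)
    then show ?thesis using s by blast
  qed
  define K where "K = {Idl F | F. finite F \<and> F \<subseteq> Y}"
  have "Idl {} \<in> K" unfolding K_def by blast
  moreover have "ideal J R" if "J \<in> K" for J
    using that YN(1) genideal_ideal unfolding K_def by blast
  ultimately obtain J where J: "J \<in> K" and max: "\<And>L. L \<in> K \<Longrightarrow> J \<subseteq> L \<Longrightarrow> L = J"
    using maximal_member_of_ideal_family[of K] by blast
  obtain F where F: "finite F" "F \<subseteq> Y" "J = Idl F" using J unfolding K_def by blast
  have FR: "F \<subseteq> carrier R" using F(2) YN(1) by blast
  have gen: "x \<in> Idl F" if x: "x \<in> Y" for x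
  proof -
    have sub: "insert x F \<subseteq> carrier R" using x YN(1) FR by blast
    have "F \<subseteq> Idl (insert x F)" using genideal_self[OF sub] by blast
    then have "Idl F \<subseteq> Idl (insert x F)" by (rule genideal_minimal[OF genideal_ideal[OF sub]])
    moreover have "Idl (insert x F) \<in> K" unfolding K_def using F(1,2) x by blast
    ultimately have "Idl (insert x F) = Idl F" using max F(3) by blast
    then show ?thesis using genideal_self[OF sub] by blast
  qed
  have below: "\<exists>f\<in>F. ann f = ann x" if x: "x \<in> Y" for x
  proof (rule ccontr)
    interpret Px: primeideal "ann x" R by (rule prime[OF x])
    assume "\<not> (\<exists>f\<in>F. ann f = ann x)"
    then have ne: "ann x \<noteq> ann f" if "f \<in> F" for f using that by metis
    have "x \<in> N" "\<And>f s. f \<in> Y \<Longrightarrow> s \<in> N \<Longrightarrow> ann f \<subseteq> ann s \<Longrightarrow> ann s = ann f"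
      using x by (simp_all add: Y_def)
    then have not_sub: "\<exists>a\<in>ann f. a \<notin> ann x" if "f \<in> F" for f
      using that F(2) ne by blast
    have "\<exists>a\<in>carrier R. a \<notin> ann x \<and> (\<forall>f\<in>F'. a \<otimes> f = \<zero>)" if "F' \<subseteq> F" for F'
      using finite_subset[OF that F(1)] that
    proof (induction F' rule: finite_induct)
      case empty
      show ?case using Px.I_notcarr Px.a_subset by blast
    next
      case (insert f F')
      obtain a where a: "a \<in> carrier R" "a \<notin> ann x" "\<forall>f\<in>F'. a \<otimes> f = \<zero>" using insert by blast
      obtain b where "b \<in> ann f" "b \<notin> ann x" using not_sub[of f] insert.prems by blast
      then have b: "b \<in> carrier R" "b \<otimes> f = \<zero>" "b \<notin> ann x" by (auto dest: annD)
      have f: "g \<in> carrier R" if "g \<in> insert f F'" for g using that insert.prems FR by blast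
      have "a \<otimes> b \<notin> ann x" using Px.I_prime[OF a(1) b(1)] a(2) b(3) by blast
      moreover have "(a \<otimes> b) \<otimes> g = \<zero>" if "g \<in> insert f F'" for g
      proof (cases "g = f")
        case True
        then show ?thesis using a(1) b f[OF that] by (simp add: m_assoc)
      next
        case False
        then have "a \<otimes> g = \<zero>" using that a(3) by blast
        moreover have "(a \<otimes> b) \<otimes> g = b \<otimes> (a \<otimes> g)" using a(1) b(1) f[OF that] by algebra
        ultimately show ?thesis using b(1) by simp
      qed
      ultimately show ?case using a(1) b(1) by blast
    qed
    then obtain a where a: "a \<in> carrier R" "a \<notin> ann x" "\<forall>f\<in>F. a \<otimes> f = \<zero>" by blast
    have "f \<in> ann a" if f: "f \<in> F" for f
      using a(3) f m_comm[OF a(1) subsetD[OF FR f]] by (intro annI subsetD[OF FR f]) simp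
    then have "F \<subseteq> ann a" by blast
    then have "Idl F \<subseteq> ann a" by (rule genideal_minimal[OF ideal_ann[OF a(1)]])
    then have "x \<otimes> a = \<zero>" using gen[OF x] annD by blast
    then have "a \<in> ann x" using m_comm[OF YN(1)[OF x] a(1)] by (intro annI a(1)) simp
    then show False using a(2) by blast
  qed
  show thesis
  proof (rule that[OF F(1)])
    show "F \<subseteq> carrier R - {\<zero>}" using F(2) by (auto simp: Y_def N_def)
    show "primeideal (ann f) R" if "f \<in> F" for f using that F(2) prime by blast
    fix z assume z: "z \<in> carrier R" "\<not> nonzerodivisor z"
    then obtain r where r: "r \<in> N" "z \<in> ann r" by (auto simp: nonzerodivisor_def N_def ann_def)
    then show "\<exists>f\<in>F. z \<in> ann f" using above below by (metis subsetD)
  qed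
qed

context standard_graded
begin

text \<open>A vector space over an infinite field is not a finite union of proper subspaces. If \<open>a\<close> lies in \<open>P\<close> but in
  no other member of the cover and \<open>b\<close> lies outside \<open>P\<close>, then all \<open>b + c a\<close> avoid \<open>P\<close>; two of them
  share another member, which then contains \<open>a\<close>.\<close>

lemma G1_subset_member_of_cover:
  assumes "finite F" "\<And>P. P \<in> F \<Longrightarrow> ideal P R" "G 1 \<subseteq> \<Union>F" "infinite (G 0)"
  shows "\<exists>P\<in>F. G 1 \<subseteq> P"
  using assms(1-3)
proof (induction F rule: finite_induct)
  case empty
  then show ?case using G_zero[of 1] by blast
next
  case (insert P F)
  show ?case
  proof (cases "G 1 \<subseteq> \<Union>F \<or> G 1 \<subseteq> P")
    case True
    then show ?thesis using insert.IH insert.prems(1) by blast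
  next
    case False
    then obtain a b where a: "a \<in> G 1" "a \<notin> \<Union>F" "a \<in> P" and b: "b \<in> G 1" "b \<notin> P"
      using insert.prems(2) by blast
    interpret P: ideal P R using insert.prems(1) by blast
    have aR: "a \<in> carrier R" and bR: "b \<in> carrier R" using a(1) b(1) G_carrier by auto
    have "\<exists>Q\<in>F. b \<oplus> c \<otimes> a \<in> Q" if c: "c \<in> G 0" for c
    proof -
      have ca: "c \<otimes> a \<in> P" using P.I_l_closed[OF a(3)] c by simp
      have "b = (b \<oplus> c \<otimes> a) \<oplus> \<ominus> (c \<otimes> a)" using aR bR G_carrier[OF c] by algebra
      then have "b \<oplus> c \<otimes> a \<notin> P" using b(2) ca P.a_closed P.a_inv_closed by metis
      moreover have "b \<oplus> c \<otimes> a \<in> G 1" using a(1) b(1) c by simp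
      ultimately show ?thesis using insert.prems(2) by blast
    qed
    then obtain q where q: "\<And>c. c \<in> G 0 \<Longrightarrow> q c \<in> F \<and> b \<oplus> c \<otimes> a \<in> q c" by metis
    have "finite (q ` G 0)" using q insert.hyps(1) by (meson finite_subset image_subsetI)
    then obtain Q where Q: "infinite {c \<in> G 0. q c = Q}"
      using pigeonhole_infinite[OF assms(4)] by (smt (verit) Collect_cong)
    then obtain c where c: "c \<in> G 0" "q c = Q"
      by (metis (mono_tags, lifting) empty_Collect_eq finite.emptyI)
    have "infinite ({c \<in> G 0. q c = Q} - {c})" using Q by simp
    then have "{c \<in> G 0. q c = Q} - {c} \<noteq> {}" by (rule infinite_imp_nonempty)
    then obtain d where d: "d \<in> G 0" "q d = Q" "d \<noteq> c" by blast
    have QF: "Q \<in> F" using q[OF c(1)] c(2) by blast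
    interpret Q: ideal Q R using insert.prems(1) QF by blast
    have cR: "c \<in> carrier R" and dR: "d \<in> carrier R" using c d G_carrier by auto
    have "c \<ominus> d \<in> G 0" unfolding minus_eq using c(1) d(1) by simp
    moreover have "c \<ominus> d \<noteq> \<zero>" using d(3) cR dR by (metis r_right_minus_eq)
    ultimately obtain e where e: "e \<in> G 0" "e \<otimes> (c \<ominus> d) = \<one>" using G0_inverse by blast
    have "(b \<oplus> c \<otimes> a) \<oplus> \<ominus> (b \<oplus> d \<otimes> a) \<in> Q"
    proof (rule Q.a_closed[OF _ Q.a_inv_closed])
      show "b \<oplus> c \<otimes> a \<in> Q" using q[OF c(1)] c(2) by blast
      show "b \<oplus> d \<otimes> a \<in> Q" using q[OF d(1)] d(2) by blast
    qed
    then have "e \<otimes> ((b \<oplus> c \<otimes> a) \<oplus> \<ominus> (b \<oplus> d \<otimes> a)) \<in> Q"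
      using Q.I_l_closed e(1) G_carrier by blast
    moreover have "e \<otimes> ((b \<oplus> c \<otimes> a) \<oplus> \<ominus> (b \<oplus> d \<otimes> a)) = (e \<otimes> (c \<ominus> d)) \<otimes> a"
      using aR bR cR dR G_carrier[OF e(1)] by algebra
    ultimately have "a \<in> Q" using e(2) aR by simp
    then show ?thesis using a(2) QF by blast
  qed
qed

text \<open>If all linear forms were zero divisors, a single annihilator would contain \<open>R\<^sub>1\<close>, hence all of \<open>\<mm>\<close>, and in
  particular \<open>a\<close>.\<close>

lemma exists_linear_nonzerodivisor:
  assumes "infinite (G 0)" "a \<in> \<mm>" "nonzerodivisor a"
  obtains z where "z \<in> G 1" "nonzerodivisor z"
proof (rule ccontr)
  assume no: "\<not> thesis"
  have zd: "\<forall>z\<in>G 1. \<not> nonzerodivisor z" using no that by blast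
  obtain F where F: "finite F" "F \<subseteq> carrier R - {\<zero>}" "\<And>f. f \<in> F \<Longrightarrow> primeideal (ann f) R"
    "\<And>z. z \<in> carrier R \<Longrightarrow> \<not> nonzerodivisor z \<Longrightarrow> \<exists>f\<in>F. z \<in> ann f"
    using zero_divisors_in_finitely_many_annihilators by blast
  have "G 1 \<subseteq> \<Union>(ann ` F)" using F(4) zd G_carrier by blast
  moreover have "ideal P R" if "P \<in> ann ` F" for P
    using that F(2) ideal_ann by blast
  ultimately obtain f where f: "f \<in> F" "G 1 \<subseteq> ann f"
    using G1_subset_member_of_cover[of "ann ` F"] F(1) assms(1) by auto
  have "\<mm> \<subseteq> ann f"
    using irrelevant_subset_ideal f(2) ideal_ann F(2) f(1) by blast
  then have "a \<otimes> f = \<zero>" using assms(2) by (auto simp: ann_def)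
  then show False using assms(3) F(2) f(1) by (auto simp: nonzerodivisor_def)
qed

end

section \<open>Dimension and depth\<close>

lemma krull_dim_ge_chain:
  assumes "\<forall>i\<le>n. primeideal (P i) R" "\<forall>i<n. P i \<subset> P (Suc i)"
  shows "enat n \<le> krull_dim R"
  unfolding krull_dim_def by (rule Sup_upper) (use assms in blast)

lemma krull_dim_ge_1_iff:
  "1 \<le> krull_dim R \<longleftrightarrow> (\<exists>P Q. primeideal P R \<and> primeideal Q R \<and> P \<subset> Q)"
proof
  assume dim: "1 \<le> krull_dim R"
  show "\<exists>P Q. primeideal P R \<and> primeideal Q R \<and> P \<subset> Q"
  proof (rule ccontr)
    assume no: "\<not> (\<exists>P Q. primeideal P R \<and> primeideal Q R \<and> P \<subset> Q)"
    have "x \<le> 0" if x: "x \<in> {enat n | n. \<exists>P :: nat \<Rightarrow> 'a set.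
     (\<forall>i\<le>n. primeideal (P i) R) \<and> (\<forall>i<n. P i \<subset> P (Suc i))}" for x
    proof -
      obtain n P where n: "x = enat n" "\<forall>i\<le>n. primeideal (P i) R" "\<forall>i<n. P i \<subset> P (Suc i)"
        using x by blast
      have "n = 0"
      proof (rule ccontr)
        assume "n \<noteq> 0"
        then have "primeideal (P 0) R" "primeideal (P (Suc 0)) R" "P 0 \<subset> P (Suc 0)"
          using n(2,3) by auto
        then show False using no by blast
      qed
      then show ?thesis using n(1) by (simp add: zero_enat_def)
    qed
    then have "krull_dim R \<le> 0" unfolding krull_dim_def by (rule Sup_least)
    then show False using dim by (metis order_trans not_one_le_zero)
  qed
next
  assume "\<exists>P Q. primeideal P R \<and> primeideal Q R \<and> P \<subset> Q"
  then obtain P Q where PQ: "primeideal P R" "primeideal Q R" "P \<subset> Q" by blast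
  have "enat 1 \<le> krull_dim R"
    by (rule krull_dim_ge_chain[of 1 "\<lambda>i. if i = 0 then P else Q"]) (use PQ in auto)
  then show "1 \<le> krull_dim R" by (simp add: one_enat_def)
qed

lemma krull_dim_ge_2:
  assumes "primeideal P R" "primeideal Q R" "primeideal T R" "P \<subset> Q" "Q \<subset> T"
  shows "krull_dim R \<noteq> 1"
proof -
  have "enat 2 \<le> krull_dim R"
    by (rule krull_dim_ge_chain[of 2 "\<lambda>i. if i = 0 then P else if i = 1 then Q else T"])
      (use assms in \<open>auto simp: less_Suc_eq numeral_2_eq_2\<close>)
  then show ?thesis by (auto simp: one_enat_def)
qed

lemma (in cring) module_self: "module R (self_module R)"
proof (rule moduleI[OF is_cring])
  show "abelian_group (self_module R)"
  proof (rule abelian_groupI)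
    fix x assume "x \<in> carrier (self_module R)"
    then have "\<ominus> x \<in> carrier R" "\<ominus> x \<oplus> x = \<zero>" by (simp_all add: self_module_def l_neg)
    then show "\<exists>y\<in>carrier (self_module R). y \<oplus>\<^bsub>self_module R\<^esub> x = \<zero>\<^bsub>self_module R\<^esub>"
      by (auto simp: self_module_def)
  qed (simp_all add: self_module_def a_ac)
qed (simp_all add: self_module_def l_distr r_distr m_assoc)

lemma generated_submodule_least:
  "submodule H R M \<Longrightarrow> U \<subseteq> H \<Longrightarrow> generated_submodule R M U \<subseteq> H"
  unfolding generated_submodule_def by blast

lemma generated_submodule_incl: "U \<subseteq> generated_submodule R M U"
  unfolding generated_submodule_def by blast

lemma (in module) submodule_zero: "submodule {\<zero>\<^bsub>M\<^esub>} R M"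
  by (rule submoduleI) auto

lemma seq_smult_Nil:
  assumes "module R M" shows "seq_smult R M [] = {\<zero>\<^bsub>M\<^esub>}"
proof -
  interpret module R M by fact
  have "generated_submodule R M {} \<subseteq> {\<zero>\<^bsub>M\<^esub>}"
    by (rule generated_submodule_least[OF submodule_zero]) simp
  moreover have "\<zero>\<^bsub>M\<^esub> \<in> generated_submodule R M {}"
    unfolding generated_submodule_def submodule_def using subgroup.one_closed by fastforce
  ultimately show ?thesis by (auto simp: seq_smult_def)
qed

context standard_graded
begin

text \<open>A chain \<open>P \<subset> P'\<close> of primes of \<open>R\<close> need not consist of ideals inside \<open>\<mm>\<close>. But \<open>P\<close> misses some linear form
  \<open>x\<close>, which is therefore not nilpotent; as elements outside \<open>\<mm>\<close> are nonzerodivisors, no \<open>s x\<^sup>n\<close> with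
  \<open>s \<notin> \<mm>\<close> vanishes, and so some prime inside \<open>\<mm>\<close> misses \<open>x\<close>.\<close>

lemma exists_prime_below_irrelevant:
  assumes "krull_dim R = 1"
  obtains Q where "primeideal Q R" "Q \<subset> \<mm>"
proof -
  obtain P P' where P: "primeideal P R" "primeideal P' R" "P \<subset> P'"
    using assms krull_dim_ge_1_iff[of R] by (metis order_refl)
  interpret P: primeideal P R by fact
  interpret P': primeideal P' R by fact
  interpret m: maximalideal \<mm> R by (rule maximal_irrelevant)
  have "\<not> \<mm> \<subseteq> P"
  proof
    assume "\<mm> \<subseteq> P"
    then have "\<mm> \<subset> P'" "ideal P' R" using P(3) P'.is_ideal by auto
    then show False using m.I_maximal[of P'] P'.I_notcarr P'.a_subset by auto
  qed
  then obtain x where x: "x \<in> G 1" "x \<notin> P" using irrelevant_subset_ideal[OF P.is_ideal] by blast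
  have xR: "x \<in> carrier R" using x(1) by (rule G_carrier)
  obtain Q where Q: "primeideal Q R" "{\<zero>} \<subseteq> Q" "Q \<subseteq> \<mm>" "x \<notin> Q"
  proof (rule exists_prime_below_avoiding[OF prime_irrelevant xR zeroideal])
    fix s and n :: nat assume s: "s \<in> carrier R" "s \<notin> \<mm>"
    show "s \<otimes> x [^] n \<notin> {\<zero>}"
    proof
      assume "s \<otimes> x [^] n \<in> {\<zero>}"
      then have "x [^] n \<in> P" using nonirrelevant_mult_zero[OF s, of "x [^] n"] xR by simp
      then have "x \<in> P"
      proof (induction n)
        case 0
        then show ?case using P.one_imp_carrier P.I_notcarr by simp
      next
        case (Suc n)
        then show ?case using P.I_prime[of "x [^] n" x] xR by auto
      qed
      then show False using x(2) by blast
    qed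
  qed
  moreover have "x \<in> \<mm>" using G1_irrelevant x(1) by blast
  ultimately show thesis using that by blast
qed

text \<open>The localization at \<open>\<mm>\<close> has positive dimension, hence positive depth. The first element of a regular sequence
  is a fraction whose numerator is a nonzerodivisor already on \<open>R\<close>.\<close>

lemma exists_irrelevant_nonzerodivisor:
  assumes "krull_dim R = 1" "cohen_macaulay_ring R"
  obtains a where "a \<in> \<mm>" "nonzerodivisor a"
proof -
  interpret L: localization_at_prime \<mm> R
    by (rule localization_at_prime.intro[OF prime_irrelevant])
  let ?S = "localization R \<mm>"
  interpret S: cring ?S by (rule L.cring_localization)
  interpret SM: module ?S "self_module ?S" by (rule S.module_self)
  obtain Q where Q: "primeideal Q R" "Q \<subset> \<mm>" using exists_prime_below_irrelevant[OF assms(1)] .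
  then obtain x where x: "x \<in> \<mm>" "x \<notin> Q" by blast
  have xR: "x \<in> carrier R" using x(1) by (rule irrelevant_carrier)
  have "L.extension Q \<subset> L.extension \<mm>"
  proof
    show "L.extension Q \<subseteq> L.extension \<mm>" using Q(2) unfolding L.extension_def by blast
    show "L.extension Q \<noteq> L.extension \<mm>"
      using L.frac_mem_prime_extension_iff[OF Q(1) _ xR L.one_W]
        L.frac_mem_prime_extension_iff[OF prime_irrelevant _ xR L.one_W] x Q(2) by blast
  qed
  moreover have "primeideal (L.extension Q) ?S" "primeideal (L.extension \<mm>) ?S"
    using L.prime_extension Q prime_irrelevant by auto
  ultimately have "1 \<le> krull_dim ?S" using krull_dim_ge_1_iff by blast
  moreover have "depth ?S (carrier ?S - Units ?S) (self_module ?S) = krull_dim ?S"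
    using assms(2) maximal_irrelevant unfolding cohen_macaulay_ring_def Let_def by blast
  ultimately have "1 \<le> depth ?S (L.extension \<mm>) (self_module ?S)"
    using L.nonunits_localization by simp
  moreover have "depth ?S (L.extension \<mm>) (self_module ?S) \<le> 0"
    if "\<And>xs. set xs \<subseteq> L.extension \<mm> \<Longrightarrow> regular_sequence ?S (self_module ?S) xs \<Longrightarrow> xs = []"
    unfolding depth_def by (rule Sup_least) (use that in \<open>auto simp: zero_enat_def\<close>)
  moreover have "\<not> (1::enat) \<le> 0" by simp
  ultimately obtain xs where xs: "set xs \<subseteq> L.extension \<mm>"
    "regular_sequence ?S (self_module ?S) xs" "xs \<noteq> []"
    using order_trans by blast
  have "xs ! 0 \<in> L.extension \<mm>" using xs(1,3) by auto
  then obtain a s where a: "a \<in> \<mm>" "s \<in> L.W" "xs ! 0 = L.frac a s" unfolding L.extension_def by blast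
  have aR: "a \<in> carrier R" using a(1) by (rule irrelevant_carrier)
  have "nonzerodivisor a"
    unfolding nonzerodivisor_def
  proof (intro conjI ballI impI aR)
    fix r assume r: "r \<in> carrier R" "a \<otimes> r = \<zero>"
    have "L.frac a s \<otimes>\<^bsub>?S\<^esub> L.frac r \<one> = L.frac \<zero> s"
      using aR r a(2) by (simp add: L.frac_mult)
    also have "\<dots> = \<zero>\<^bsub>?S\<^esub>" unfolding L.zero_RP using a(2) by (intro L.frac_eqI) auto
    finally have "xs ! 0 \<odot>\<^bsub>self_module ?S\<^esub> L.frac r \<one> \<in> seq_smult ?S (self_module ?S) (take 0 xs)"
      using a(3) by (simp add: seq_smult_Nil[OF S.module_self]) (simp add: self_module_def)
    moreover have "L.frac r \<one> \<in> carrier (self_module ?S)" using r by (simp add: self_module_def)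
    ultimately have "L.frac r \<one> \<in> seq_smult ?S (self_module ?S) (take 0 xs)"
      using xs(2,3) unfolding regular_sequence_def by blast
    then have "L.frac r \<one> = L.frac \<zero> \<one>"
      by (simp add: seq_smult_Nil[OF S.module_self]) (simp add: self_module_def L.zero_RP)
    then obtain u where u: "u \<in> L.W" "u \<otimes> (r \<otimes> \<one>) = u \<otimes> (\<zero> \<otimes> \<one>)"
      using L.frac_eq_iff[of r \<zero> \<one> \<one>] r by auto
    then show "r = \<zero>" using nonirrelevant_mult_zero[of u r] r(1) by (simp add: L.mem_W_iff)
  qed
  then show thesis using that a(1) by blast
qed

end

section \<open>A local ring of infinite injective dimension\<close>

lemma module_homD:
  assumes "h \<in> module_hom R M N"
  shows "x \<in> carrier M \<Longrightarrow> h x \<in> carrier N"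
    and "x \<in> carrier M \<Longrightarrow> y \<in> carrier M \<Longrightarrow> h (x \<oplus>\<^bsub>M\<^esub> y) = h x \<oplus>\<^bsub>N\<^esub> h y"
    and "a \<in> carrier R \<Longrightarrow> x \<in> carrier M \<Longrightarrow> h (a \<odot>\<^bsub>M\<^esub> x) = a \<odot>\<^bsub>N\<^esub> h x"
  using assms unfolding module_hom_def by auto

lemma self_module_simps [simp]:
  "carrier (self_module R) = carrier R" "x \<oplus>\<^bsub>self_module R\<^esub> y = x \<oplus>\<^bsub>R\<^esub> y"
  "a \<odot>\<^bsub>self_module R\<^esub> x = a \<otimes>\<^bsub>R\<^esub> x" "\<zero>\<^bsub>self_module R\<^esub> = \<zero>\<^bsub>R\<^esub>"
  by (simp_all add: self_module_def)

abbreviation ideal_module where "ideal_module R I \<equiv> self_module R\<lparr>carrier := I\<rparr>"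

context cring begin

lemma submodule_ideal:
  assumes "ideal I R" shows "submodule I R (self_module R)"
proof -
  interpret I: ideal I R by fact
  have neg: "\<ominus> x \<oplus> x = \<zero>" if "x \<in> carrier R" for x using that by (rule l_neg)
  interpret module R "self_module R" by (rule module_self)
  have inv: "\<ominus>\<^bsub>self_module R\<^esub> x = \<ominus> x" if "x \<in> carrier R" for x
    using M.minus_equality[of "\<ominus> x" x] that neg[OF that] by simp
  show ?thesis
    by (rule submoduleI) (use I.a_subset I.I_l_closed in \<open>auto simp: inv\<close>)
qed

text \<open>Extending a homomorphism from an ideal to all of \<open>R\<close> exhibits it as multiplication by the image of \<open>\<one>\<close>. This
  is the form in which injectivity is used throughout.\<close>

lemma injective_extends_from_ideal:
  assumes E: "injective_module R E" and I: "ideal I R" and g: "g \<in> module_hom R (ideal_module R I) E"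
  obtains u where "u \<in> carrier E" "\<And>x. x \<in> I \<Longrightarrow> g x = x \<odot>\<^bsub>E\<^esub> u"
proof -
  obtain h where h: "h \<in> module_hom R (self_module R) E" "\<forall>x\<in>I. h x = g x"
    using E g module_self submodule_ideal[OF I] unfolding injective_module_def by blast
  have "g x = x \<odot>\<^bsub>E\<^esub> h \<one>" if x: "x \<in> I" for x
  proof -
    have "x \<in> carrier R" using ideal.Icarr[OF I x] .
    then show ?thesis using module_homD(3)[OF h(1), of x \<one>] h(2) x by simp
  qed
  moreover have "h \<one> \<in> carrier E" using module_homD(1)[OF h(1)] by simp
  ultimately show thesis using that by blast
qed

text \<open>On the principal ideal of a nonzerodivisor \<open>z\<close> the map \<open>a z \<mapsto> a u\<close> is well defined; an extension of it to
  \<open>R\<close> sends \<open>\<one>\<close> to the desired element.\<close>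

lemma injective_divisible:
  assumes E: "injective_module R E" and z: "nonzerodivisor z" and u: "u \<in> carrier E"
  obtains w where "w \<in> carrier E" "z \<odot>\<^bsub>E\<^esub> w = u"
proof -
  interpret E: module R E using E by (simp add: injective_module_def)
  have zR: "z \<in> carrier R" using z by (simp add: nonzerodivisor_def)
  \<comment> \<open>the quotient of \<open>x\<close> by \<open>z\<close>\<close>
  define q where "q x = (SOME a. a \<in> carrier R \<and> x = a \<otimes> z)" for x
  have q: "q (a \<otimes> z) = a" if a: "a \<in> carrier R" for a
  proof -
    have "q (a \<otimes> z) \<in> carrier R \<and> a \<otimes> z = q (a \<otimes> z) \<otimes> z"
      unfolding q_def by (rule someI[of _ a]) (use a in simp)
    then show ?thesis using nonzerodivisor_cancel[OF z, of "q (a \<otimes> z)" a] a zR m_comm by metis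
  qed
  have PI: "PIdl z = {a \<otimes> z | a. a \<in> carrier R}" by (auto simp: cgenideal_def)
  have "(\<lambda>x. q x \<odot>\<^bsub>E\<^esub> u) \<in> module_hom R (ideal_module R (PIdl z)) E"
    unfolding module_hom_def
  proof (intro CollectI conjI ballI)
    show "(\<lambda>x. q x \<odot>\<^bsub>E\<^esub> u) \<in> carrier (ideal_module R (PIdl z)) \<rightarrow> carrier E"
      using q u by (auto simp: PI)
  next
    fix x y assume "x \<in> carrier (ideal_module R (PIdl z))" "y \<in> carrier (ideal_module R (PIdl z))"
    then obtain a b where ab: "a \<in> carrier R" "b \<in> carrier R" "x = a \<otimes> z" "y = b \<otimes> z"
      by (auto simp: PI)
    have "x \<oplus> y = (a \<oplus> b) \<otimes> z" using ab zR by (simp add: l_distr)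
    then show "q (x \<oplus>\<^bsub>ideal_module R (PIdl z)\<^esub> y) \<odot>\<^bsub>E\<^esub> u = q x \<odot>\<^bsub>E\<^esub> u \<oplus>\<^bsub>E\<^esub> q y \<odot>\<^bsub>E\<^esub> u"
      using q ab u by (simp add: E.smult_l_distr)
  next
    fix a x assume "a \<in> carrier R" "x \<in> carrier (ideal_module R (PIdl z))"
    then obtain b where ab: "a \<in> carrier R" "b \<in> carrier R" "x = b \<otimes> z"
      by (auto simp: PI)
    have "a \<otimes> x = (a \<otimes> b) \<otimes> z" using ab zR by (simp add: m_assoc)
    then show "q (a \<odot>\<^bsub>ideal_module R (PIdl z)\<^esub> x) \<odot>\<^bsub>E\<^esub> u = a \<odot>\<^bsub>E\<^esub> (q x \<odot>\<^bsub>E\<^esub> u)"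
      using q ab u by (simp add: E.smult_assoc1)
  qed
  then obtain w where w: "w \<in> carrier E" "\<And>x. x \<in> PIdl z \<Longrightarrow> q x \<odot>\<^bsub>E\<^esub> u = x \<odot>\<^bsub>E\<^esub> w"
    using injective_extends_from_ideal[OF E cgenideal_ideal[OF zR]] by blast
  have "z \<odot>\<^bsub>E\<^esub> w = q (\<one> \<otimes> z) \<odot>\<^bsub>E\<^esub> u" using w(2)[of z] cgenideal_self[OF zR] zR by simp
  also have "\<dots> = u" using q[of \<one>] u by simp
  finally show thesis using that w(1) by blast
qed

end

text \<open>Here \<open>S\<close> is a local ring with maximal ideal \<open>M\<close> and \<open>z\<close> is a nonzerodivisor in \<open>M\<close>. As \<open>M x1\<close> and \<open>M x2\<close> lie in
  \<open>z S\<close>, the residue classes of \<open>x1\<close> and \<open>x2\<close> are socle elements of \<open>S/zS\<close>. The ideal \<open>J\<close> between \<open>M\<^sup>2\<close> and \<open>M\<close>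
  is a hyperplane modulo \<open>M\<^sup>2\<close> that contains \<open>z\<close> and \<open>x1\<close> but not \<open>x2\<close>; so the two socle elements are linearly
  independent, whereas a Gorenstein ring would leave room for only one.\<close>

locale socle_too_large = cring S for S (structure) +
  fixes M J z x1 x2
  assumes M: "ideal M S" and J: "ideal J S" and JM: "J \<subseteq> M"
    and local: "a \<in> carrier S \<Longrightarrow> a \<notin> M \<Longrightarrow> a \<in> Units S"
    and nzd: "nonzerodivisor z" and zJ: "z \<in> J" and x1J: "x1 \<in> J" and x2M: "x2 \<in> M" and x2J: "x2 \<notin> J"
    and MMJ: "a \<in> M \<Longrightarrow> b \<in> M \<Longrightarrow> a \<otimes> b \<in> J"
    and span: "y \<in> M \<Longrightarrow> \<exists>c\<in>carrier S. y \<ominus> c \<otimes> x2 \<in> J"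
    and Mx1: "s \<in> M \<Longrightarrow> \<exists>t\<in>carrier S. s \<otimes> x1 = z \<otimes> t"
    and Mx2: "s \<in> M \<Longrightarrow> \<exists>t\<in>carrier S. s \<otimes> x2 = z \<otimes> t"
    and x1z: "t \<in> carrier S \<Longrightarrow> x1 \<noteq> z \<otimes> t"
begin

lemma in_carrier [simp]: "s \<in> M \<Longrightarrow> s \<in> carrier S" "s \<in> J \<Longrightarrow> s \<in> carrier S"
    "x1 \<in> carrier S" "x2 \<in> carrier S" "z \<in> carrier S" "z \<in> M" "x1 \<in> M"
  using ideal.Icarr[OF M] ideal.Icarr[OF J] JM x1J x2M zJ by auto

text \<open>Reading off the coefficient of \<open>x2\<close> modulo \<open>J\<close> is a linear map from \<open>M\<close> to the residue field. It induces a
  homomorphism \<open>x2 \<mapsto> u\<close> into any module in which \<open>u\<close> is killed by \<open>M\<close>.\<close>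

lemma functional:
  assumes "module S N" "u \<in> carrier N" "\<And>s. s \<in> M \<Longrightarrow> s \<odot>\<^bsub>N\<^esub> u = \<zero>\<^bsub>N\<^esub>"
  obtains \<eta> where "\<eta> \<in> module_hom S (ideal_module S M) N" "\<eta> z = \<zero>\<^bsub>N\<^esub>" "\<eta> x1 = \<zero>\<^bsub>N\<^esub>" "\<eta> x2 = u"
    "\<And>s. s \<in> M \<Longrightarrow> \<exists>c\<in>carrier S. \<eta> s = c \<odot>\<^bsub>N\<^esub> u"
proof -
  interpret N: module S N by fact
  interpret M: ideal M S by (rule M)
  interpret J: ideal J S by (rule J)
  have inM: "c \<in> M" if c: "c \<in> carrier S" "c \<otimes> x2 \<in> J" for c
  proof (rule ccontr)
    assume "c \<notin> M"
    then have "c \<in> Units S" using local c(1) by blast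
    then have "inv c \<otimes> (c \<otimes> x2) = x2" using c(1) by (simp add: m_assoc[symmetric])
    moreover have "inv c \<otimes> (c \<otimes> x2) \<in> J" using J.I_l_closed[OF c(2), of "inv c"] \<open>c \<in> Units S\<close> by simp
    ultimately show False using x2J by simp
  qed
  have same: "c \<odot>\<^bsub>N\<^esub> u = c' \<odot>\<^bsub>N\<^esub> u"
    if c: "c \<in> carrier S" "c' \<in> carrier S" and y: "y \<in> carrier S" "y \<ominus> c \<otimes> x2 \<in> J" "y \<ominus> c' \<otimes> x2 \<in> J"
    for c c' y
  proof -
    have "(c \<ominus> c') \<otimes> x2 = (y \<ominus> c' \<otimes> x2) \<oplus> \<ominus> (y \<ominus> c \<otimes> x2)"
      using c y(1) in_carrier(4) by algebra
    also have "\<dots> \<in> J" using J.a_closed[OF y(3) J.a_inv_closed[OF y(2)]] .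
    finally have "c \<ominus> c' \<in> M" using inM c by blast
    then have "(c \<ominus> c') \<odot>\<^bsub>N\<^esub> u = \<zero>\<^bsub>N\<^esub>" by (rule assms(3))
    moreover have "c = (c \<ominus> c') \<oplus> c'" using c by algebra
    ultimately show ?thesis using N.smult_l_distr[of "c \<ominus> c'" c' u] c assms(2) by simp
  qed
  obtain \<alpha> where \<alpha>: "\<And>y. y \<in> M \<Longrightarrow> \<alpha> y \<in> carrier S \<and> y \<ominus> \<alpha> y \<otimes> x2 \<in> J"
    using span by metis
  have eq: "\<alpha> y \<odot>\<^bsub>N\<^esub> u = c \<odot>\<^bsub>N\<^esub> u" if "y \<in> M" "c \<in> carrier S" "y \<ominus> c \<otimes> x2 \<in> J" for y c
    using same[of "\<alpha> y" c y] \<alpha>[OF that(1)] that by simp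
  let ?\<eta> = "\<lambda>y. \<alpha> y \<odot>\<^bsub>N\<^esub> u"
  have "?\<eta> \<in> module_hom S (ideal_module S M) N"
    unfolding module_hom_def
  proof (intro CollectI conjI ballI)
    show "?\<eta> \<in> carrier (ideal_module S M) \<rightarrow> carrier N" using \<alpha> assms(2) by auto
  next
    fix x y assume "x \<in> carrier (ideal_module S M)" "y \<in> carrier (ideal_module S M)"
    then have xy: "x \<in> M" "y \<in> M" by simp_all
    note a = \<alpha>[OF xy(1)] \<alpha>[OF xy(2)]
    have "(x \<oplus> y) \<ominus> (\<alpha> x \<oplus> \<alpha> y) \<otimes> x2 = (x \<ominus> \<alpha> x \<otimes> x2) \<oplus> (y \<ominus> \<alpha> y \<otimes> x2)"
      using in_carrier(1)[OF xy(1)] in_carrier(1)[OF xy(2)] in_carrier(4) conjunct1[OF a(1)] conjunct1[OF a(2)]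
      by algebra
    also have "\<dots> \<in> J" using a by blast
    finally have "\<alpha> (x \<oplus> y) \<odot>\<^bsub>N\<^esub> u = (\<alpha> x \<oplus> \<alpha> y) \<odot>\<^bsub>N\<^esub> u" using a xy by (intro eq) auto
    then show "\<alpha> (x \<oplus>\<^bsub>ideal_module S M\<^esub> y) \<odot>\<^bsub>N\<^esub> u = \<alpha> x \<odot>\<^bsub>N\<^esub> u \<oplus>\<^bsub>N\<^esub> \<alpha> y \<odot>\<^bsub>N\<^esub> u"
      using a assms(2) by (simp add: N.smult_l_distr)
  next
    fix s y assume "s \<in> carrier S" "y \<in> carrier (ideal_module S M)"
    then have sy: "s \<in> carrier S" "y \<in> M" by simp_all
    note a = \<alpha>[OF sy(2)]
    have "s \<otimes> y \<ominus> (s \<otimes> \<alpha> y) \<otimes> x2 = s \<otimes> (y \<ominus> \<alpha> y \<otimes> x2)"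
      using sy(1) in_carrier(1)[OF sy(2)] in_carrier(4) conjunct1[OF a] by algebra
    also have "\<dots> \<in> J" using J.I_l_closed a sy(1) by blast
    finally have "\<alpha> (s \<otimes> y) \<odot>\<^bsub>N\<^esub> u = (s \<otimes> \<alpha> y) \<odot>\<^bsub>N\<^esub> u"
      using a sy M.I_l_closed by (intro eq) auto
    then show "\<alpha> (s \<odot>\<^bsub>ideal_module S M\<^esub> y) \<odot>\<^bsub>N\<^esub> u = s \<odot>\<^bsub>N\<^esub> (\<alpha> y \<odot>\<^bsub>N\<^esub> u)"
      using a sy assms(2) by (simp add: N.smult_assoc1)
  qed
  moreover have "?\<eta> z = \<zero>\<^bsub>N\<^esub>" using eq[of z \<zero>] zJ assms(2) by (simp add: minus_eq)
  moreover have "?\<eta> x1 = \<zero>\<^bsub>N\<^esub>" using eq[of x1 \<zero>] x1J assms(2) by (simp add: minus_eq)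
  moreover have "?\<eta> x2 = u" using eq[of x2 \<one>] x2M assms(2) by (simp add: minus_eq r_neg)
  moreover have "\<exists>c\<in>carrier S. ?\<eta> s = c \<odot>\<^bsub>N\<^esub> u" if "s \<in> M" for s using \<alpha>[OF that] by blast
  ultimately show thesis using that by blast
qed

text \<open>For a submodule \<open>K\<close> of \<open>N\<close> this says \<open>Ext\<^sup>1(S/M, K) = 0\<close>.\<close>

definition homs_are_scalar where
  "homs_are_scalar N K \<longleftrightarrow> (\<forall>\<psi>\<in>module_hom S (ideal_module S M) N. \<psi> ` M \<subseteq> K \<longrightarrow>
     (\<exists>w\<in>K. \<forall>s\<in>M. \<psi> s = s \<odot>\<^bsub>N\<^esub> w))"

text \<open>\<open>K1\<close> and \<open>K2\<close> are consecutive cosyzygies, and the first is divisible by \<open>z\<close> because it is an image of an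
  injective module. A map \<open>\<psi>\<close> from \<open>M\<close> to \<open>K1\<close> is multiplication by some \<open>u \<in> I1\<close> such that \<open>d1 u\<close> is killed by
  \<open>M\<close>. By assumption the functional \<open>x2 \<mapsto> d1 u\<close> is multiplication by \<open>d1 w\<close> for some \<open>w\<close>, and therefore \<open>z w\<close>
  and \<open>u - x2 w\<close> lie in \<open>K1\<close>. Write \<open>z w = z p\<close> with \<open>p \<in> K1\<close>. As \<open>M x2 \<subseteq> z S\<close>, the elements \<open>x2 w\<close> and \<open>x2 p\<close>
  have the same multiples by elements of \<open>M\<close>, so \<open>\<psi>\<close> is multiplication by \<open>x2 p + (u - x2 w) \<in> K1\<close>.\<close>

lemma homs_are_scalar_step:
  assumes inj: "injective_module S I0" "injective_module S I1" and I2: "module S I2"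
    and d0: "d0 \<in> module_hom S I0 I1" and d1: "d1 \<in> module_hom S I1 I2"
    and K1: "d0 ` carrier I0 = K1" and ker: "K1 = module_kernel I1 I2 d1"
    and K2: "d1 ` carrier I1 = K2"
    and scalar: "homs_are_scalar I2 K2"
  shows "homs_are_scalar I1 K1"
  unfolding homs_are_scalar_def
proof (intro ballI impI)
  interpret I0: module S I0 using inj by (simp add: injective_module_def)
  interpret I1: module S I1 using inj by (simp add: injective_module_def)
  interpret I2: module S I2 by fact
  fix \<psi> assume \<psi>: "\<psi> \<in> module_hom S (ideal_module S M) I1" "\<psi> ` M \<subseteq> K1"
  obtain u where u: "u \<in> carrier I1" "\<And>s. s \<in> M \<Longrightarrow> \<psi> s = s \<odot>\<^bsub>I1\<^esub> u"
    using injective_extends_from_ideal[OF inj(2) M \<psi>(1)] by blast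
  note hom0 = module_homD[OF d0] and hom1 = module_homD[OF d1]
  have K1_iff: "y \<in> K1 \<longleftrightarrow> y \<in> carrier I1 \<and> d1 y = \<zero>\<^bsub>I2\<^esub>" for y
    unfolding ker module_kernel_def by blast
  have Mu: "s \<odot>\<^bsub>I2\<^esub> d1 u = \<zero>\<^bsub>I2\<^esub>" if s: "s \<in> M" for s
  proof -
    have "s \<odot>\<^bsub>I2\<^esub> d1 u = d1 (s \<odot>\<^bsub>I1\<^esub> u)" using hom1(3)[of s u] s u(1) by simp
    moreover have "s \<odot>\<^bsub>I1\<^esub> u \<in> K1" using u(2)[OF s] \<psi>(2) s by force
    ultimately show ?thesis using K1_iff by simp
  qed
  have d1u: "d1 u \<in> carrier I2" using hom1(1) u(1) by simp
  obtain \<eta> where \<eta>: "\<eta> \<in> module_hom S (ideal_module S M) I2" "\<eta> z = \<zero>\<^bsub>I2\<^esub>" "\<eta> x2 = d1 u"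
    "\<And>s. s \<in> M \<Longrightarrow> \<exists>c\<in>carrier S. \<eta> s = c \<odot>\<^bsub>I2\<^esub> d1 u"
    using functional[OF I2 d1u Mu] by metis
  have "\<eta> ` M \<subseteq> K2"
  proof
    fix y assume "y \<in> \<eta> ` M"
    then obtain c where c: "c \<in> carrier S" "y = c \<odot>\<^bsub>I2\<^esub> d1 u" using \<eta>(4) by blast
    then have "y = d1 (c \<odot>\<^bsub>I1\<^esub> u)" using hom1(3) u(1) by simp
    then show "y \<in> K2" using c(1) u(1) K2 by blast
  qed
  then obtain w' where w': "w' \<in> K2" "\<And>s. s \<in> M \<Longrightarrow> \<eta> s = s \<odot>\<^bsub>I2\<^esub> w'"
    using scalar \<eta>(1) unfolding homs_are_scalar_def by metis
  then obtain w where w: "w \<in> carrier I1" "w' = d1 w" using K2 by blast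
  have zw: "z \<odot>\<^bsub>I1\<^esub> w \<in> K1"
    using K1_iff hom1(3)[of z w] w w'(2)[of z] \<eta>(2) by simp
  obtain v where v: "v \<in> carrier I0" "z \<odot>\<^bsub>I1\<^esub> w = d0 v" using zw K1 by blast
  obtain v' where v': "v' \<in> carrier I0" "z \<odot>\<^bsub>I0\<^esub> v' = v" using injective_divisible[OF inj(1) nzd v(1)] .
  define p where "p = d0 v'"
  have p: "p \<in> K1" "p \<in> carrier I1" "z \<odot>\<^bsub>I1\<^esub> p = z \<odot>\<^bsub>I1\<^esub> w"
    unfolding p_def using v' v K1 hom0 by auto
  have mw: "(\<ominus> x2) \<odot>\<^bsub>I1\<^esub> w \<in> carrier I1" using w(1) by simp
  define b where "b = u \<oplus>\<^bsub>I1\<^esub> (\<ominus> x2) \<odot>\<^bsub>I1\<^esub> w"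
  have bc: "b \<in> carrier I1" unfolding b_def using u(1) mw by simp
  have "d1 b = d1 u \<oplus>\<^bsub>I2\<^esub> (\<ominus> x2) \<odot>\<^bsub>I2\<^esub> d1 w"
    unfolding b_def using hom1(2)[OF u(1) mw] hom1(3)[of "\<ominus> x2" w] w(1) by simp
  also have "\<dots> = d1 u \<oplus>\<^bsub>I2\<^esub> (\<ominus>\<^bsub>I2\<^esub> d1 u)"
    using w'(2)[OF x2M] \<eta>(3) w hom1(1) by (simp add: I2.smult_l_minus)
  also have "\<dots> = \<zero>\<^bsub>I2\<^esub>" using d1u by (simp add: I2.M.r_neg)
  finally have b: "b \<in> K1" using K1_iff bc by simp
  define q where "q = x2 \<odot>\<^bsub>I1\<^esub> p \<oplus>\<^bsub>I1\<^esub> b"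
  have "q \<in> K1"
  proof -
    have x2p: "x2 \<odot>\<^bsub>I1\<^esub> p \<in> carrier I1" using p(2) by simp
    have "d1 q = x2 \<odot>\<^bsub>I2\<^esub> d1 p \<oplus>\<^bsub>I2\<^esub> d1 b"
      unfolding q_def using hom1(2)[OF x2p bc] hom1(3)[of x2 p] p(2) by simp
    also have "\<dots> = \<zero>\<^bsub>I2\<^esub>" using p(1) b K1_iff by simp
    finally show ?thesis using K1_iff x2p bc q_def by simp
  qed
  moreover have "\<psi> s = s \<odot>\<^bsub>I1\<^esub> q" if s: "s \<in> M" for s
  proof -
    have sS: "s \<in> carrier S" using s by simp
    obtain t where t: "t \<in> carrier S" "s \<otimes> x2 = z \<otimes> t" using Mx2[OF s] by blast
    have zt: "(z \<otimes> t) \<odot>\<^bsub>I1\<^esub> p = (z \<otimes> t) \<odot>\<^bsub>I1\<^esub> w"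
      using t(1) p(2,3) w(1) by (simp add: m_comm[of z t] I1.smult_assoc1)
    have "s \<odot>\<^bsub>I1\<^esub> q = (s \<otimes> x2) \<odot>\<^bsub>I1\<^esub> p \<oplus>\<^bsub>I1\<^esub> (s \<odot>\<^bsub>I1\<^esub> u \<oplus>\<^bsub>I1\<^esub> (s \<otimes> (\<ominus> x2)) \<odot>\<^bsub>I1\<^esub> w)"
      unfolding q_def b_def using sS p(2) u(1) w(1)
      by (simp add: I1.smult_r_distr I1.smult_assoc1)
    also have "\<dots> = (z \<otimes> t) \<odot>\<^bsub>I1\<^esub> w \<oplus>\<^bsub>I1\<^esub> (s \<odot>\<^bsub>I1\<^esub> u \<oplus>\<^bsub>I1\<^esub> (\<ominus>\<^bsub>I1\<^esub> ((z \<otimes> t) \<odot>\<^bsub>I1\<^esub> w)))"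
      using sS t zt w(1) by (simp add: r_minus I1.smult_l_minus)
    also have "\<dots> = s \<odot>\<^bsub>I1\<^esub> u"
      using sS t(1) w(1) u(1) I1.M.r_neg1 by (simp add: I1.M.a_lcomm I1.M.r_neg)
    finally show ?thesis using u(2)[OF s] by simp
  qed
  ultimately show "\<exists>w\<in>K1. \<forall>s\<in>M. \<psi> s = s \<odot>\<^bsub>I1\<^esub> w" by blast
qed

text \<open>View \<open>S\<close> as a submodule of \<open>I0\<close>. The map \<open>s \<mapsto> s x1 / z\<close> from \<open>M\<close> to \<open>S\<close> is multiplication by some \<open>u \<in> I0\<close>. If
  the functional \<open>x2 \<mapsto> d0 u\<close> were multiplication by \<open>d0 w\<close>, then \<open>a = z w\<close>, \<open>x1 w\<close> and \<open>x2 w - u\<close> would lie in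
  \<open>S\<close>, and multiplying the last two by \<open>z\<close> gives \<open>x1 a \<in> z S\<close> and \<open>x2 a - x1 \<in> z S\<close>. If \<open>a \<in> M\<close>, the second
  relation and \<open>M x2 \<subseteq> z S\<close> put \<open>x1\<close> into \<open>z S\<close>; if \<open>a\<close> is a unit, the first one does.\<close>

lemma homs_not_scalar_first:
  assumes inj: "injective_module S I0" and I1: "module S I1"
    and e: "e \<in> module_hom S (self_module S) I0" "inj_on e (carrier S)"
    and d0: "d0 \<in> module_hom S I0 I1"
    and ker: "e ` carrier S = module_kernel I0 I1 d0"
    and K1: "d0 ` carrier I0 = K1"
  shows "\<not> homs_are_scalar I1 K1"
proof
  assume scalar: "homs_are_scalar I1 K1"
  interpret I0: module S I0 using inj by (simp add: injective_module_def)
  interpret I1: module S I1 by fact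
  interpret M: ideal M S by (rule M)
  note hom0 = module_homD[OF d0] and home = module_homD[OF e(1), simplified]
  obtain \<tau> where \<tau>: "\<And>s. s \<in> M \<Longrightarrow> \<tau> s \<in> carrier S \<and> s \<otimes> x1 = z \<otimes> \<tau> s" using Mx1 by metis
  have \<tau>_eq: "\<tau> s = t" if "s \<in> M" "t \<in> carrier S" "s \<otimes> x1 = z \<otimes> t" for s t
    using nonzerodivisor_cancel[OF nzd, of "\<tau> s" t] \<tau>[OF that(1)] that by metis
  have "(\<lambda>s. e (\<tau> s)) \<in> module_hom S (ideal_module S M) I0"
    unfolding module_hom_def
  proof (intro CollectI conjI ballI)
    show "(\<lambda>s. e (\<tau> s)) \<in> carrier (ideal_module S M) \<rightarrow> carrier I0" using \<tau> home(1) by auto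
  next
    fix x y assume "x \<in> carrier (ideal_module S M)" "y \<in> carrier (ideal_module S M)"
    then have xy: "x \<in> M" "y \<in> M" by simp_all
    note t = \<tau>[OF xy(1)] \<tau>[OF xy(2)]
    have "\<tau> (x \<oplus> y) = \<tau> x \<oplus> \<tau> y"
      using xy t by (intro \<tau>_eq) (simp_all add: l_distr r_distr)
    then show "e (\<tau> (x \<oplus>\<^bsub>ideal_module S M\<^esub> y)) = e (\<tau> x) \<oplus>\<^bsub>I0\<^esub> e (\<tau> y)"
      using home(2) t by simp
  next
    fix s y assume "s \<in> carrier S" "y \<in> carrier (ideal_module S M)"
    then have sy: "s \<in> carrier S" "y \<in> M" by simp_all
    note t = \<tau>[OF sy(2)]
    have "\<tau> (s \<otimes> y) = s \<otimes> \<tau> y"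
    proof (rule \<tau>_eq)
      have "(s \<otimes> y) \<otimes> x1 = s \<otimes> (z \<otimes> \<tau> y)" using sy t by (simp add: m_assoc)
      then show "(s \<otimes> y) \<otimes> x1 = z \<otimes> (s \<otimes> \<tau> y)" using sy t by (simp add: m_lcomm)
    qed (use sy t M.I_l_closed in auto)
    then show "e (\<tau> (s \<odot>\<^bsub>ideal_module S M\<^esub> y)) = s \<odot>\<^bsub>I0\<^esub> e (\<tau> y)"
      using home(3) t sy by simp
  qed
  then obtain u where u: "u \<in> carrier I0" "\<And>s. s \<in> M \<Longrightarrow> e (\<tau> s) = s \<odot>\<^bsub>I0\<^esub> u"
    using injective_extends_from_ideal[OF inj M] by blast
  have ker_iff: "(\<exists>a\<in>carrier S. y = e a) \<longleftrightarrow> y \<in> carrier I0 \<and> d0 y = \<zero>\<^bsub>I1\<^esub>" for y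
  proof -
    have "(\<exists>a\<in>carrier S. y = e a) \<longleftrightarrow> y \<in> e ` carrier S" by blast
    then show ?thesis unfolding ker module_kernel_def by blast
  qed
  have d0e: "d0 (e a) = \<zero>\<^bsub>I1\<^esub>" if "a \<in> carrier S" for a using ker_iff[of "e a"] that by blast
  have zu: "z \<odot>\<^bsub>I0\<^esub> u = e x1" using u(2)[of z] \<tau>_eq[of z x1] by simp
  have Mu: "s \<odot>\<^bsub>I1\<^esub> d0 u = \<zero>\<^bsub>I1\<^esub>" if s: "s \<in> M" for s
    using hom0(3)[of s u] u(1) u(2)[OF s] d0e[of "\<tau> s"] \<tau>[OF s] s by simp
  have d0u: "d0 u \<in> carrier I1" using hom0(1) u(1) by simp
  obtain \<eta> where \<eta>: "\<eta> \<in> module_hom S (ideal_module S M) I1" "\<eta> z = \<zero>\<^bsub>I1\<^esub>" "\<eta> x1 = \<zero>\<^bsub>I1\<^esub>" "\<eta> x2 = d0 u"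
    "\<And>s. s \<in> M \<Longrightarrow> \<exists>c\<in>carrier S. \<eta> s = c \<odot>\<^bsub>I1\<^esub> d0 u"
    using functional[OF I1 d0u Mu] by metis
  have "\<eta> ` M \<subseteq> K1"
  proof
    fix y assume "y \<in> \<eta> ` M"
    then obtain c where c: "c \<in> carrier S" "y = c \<odot>\<^bsub>I1\<^esub> d0 u" using \<eta>(5) by blast
    then have "y = d0 (c \<odot>\<^bsub>I0\<^esub> u)" using hom0(3) u(1) by simp
    then show "y \<in> K1" using c(1) u(1) K1 by blast
  qed
  then obtain w' where w': "w' \<in> K1" "\<And>s. s \<in> M \<Longrightarrow> \<eta> s = s \<odot>\<^bsub>I1\<^esub> w'"
    using scalar \<eta>(1) unfolding homs_are_scalar_def by metis
  then obtain w where w: "w \<in> carrier I0" "w' = d0 w" using K1 by blast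
  obtain a where a: "a \<in> carrier S" "z \<odot>\<^bsub>I0\<^esub> w = e a"
    using ker_iff[of "z \<odot>\<^bsub>I0\<^esub> w"] hom0(3)[of z w] w w'(2)[of z] \<eta>(2) by auto
  obtain b1 where b1: "b1 \<in> carrier S" "x1 \<odot>\<^bsub>I0\<^esub> w = e b1"
    using ker_iff[of "x1 \<odot>\<^bsub>I0\<^esub> w"] hom0(3)[of x1 w] w w'(2)[of x1] \<eta>(3) by auto
  have mu: "(\<ominus> \<one>) \<odot>\<^bsub>I0\<^esub> u \<in> carrier I0" and x2w: "x2 \<odot>\<^bsub>I0\<^esub> w \<in> carrier I0" using u(1) w(1) by simp_all
  have "d0 (x2 \<odot>\<^bsub>I0\<^esub> w \<oplus>\<^bsub>I0\<^esub> (\<ominus> \<one>) \<odot>\<^bsub>I0\<^esub> u) = d0 u \<oplus>\<^bsub>I1\<^esub> (\<ominus> \<one>) \<odot>\<^bsub>I1\<^esub> d0 u"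
    using hom0(2)[OF x2w mu] hom0(3)[of x2 w] hom0(3)[of "\<ominus> \<one>" u] w u(1) w'(2)[OF x2M] \<eta>(4) by simp
  also have "\<dots> = \<zero>\<^bsub>I1\<^esub>" using d0u by (simp add: I1.smult_l_minus I1.M.r_neg)
  finally obtain b2 where b2: "b2 \<in> carrier S" "x2 \<odot>\<^bsub>I0\<^esub> w \<oplus>\<^bsub>I0\<^esub> (\<ominus> \<one>) \<odot>\<^bsub>I0\<^esub> u = e b2"
    using ker_iff[of "x2 \<odot>\<^bsub>I0\<^esub> w \<oplus>\<^bsub>I0\<^esub> (\<ominus> \<one>) \<odot>\<^bsub>I0\<^esub> u"] I0.M.a_closed[OF x2w mu] by blast
  have "e (z \<otimes> b1) = z \<odot>\<^bsub>I0\<^esub> (x1 \<odot>\<^bsub>I0\<^esub> w)" using home(3) b1 by simp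
  also have "\<dots> = x1 \<odot>\<^bsub>I0\<^esub> (z \<odot>\<^bsub>I0\<^esub> w)" using w(1) by (simp add: I0.smult_assoc1[symmetric] m_comm)
  also have "\<dots> = e (x1 \<otimes> a)" using home(3) a by simp
  finally have eq1: "z \<otimes> b1 = x1 \<otimes> a" using e(2) a(1) b1(1) by (simp add: inj_on_def)
  have "e (z \<otimes> b2) = z \<odot>\<^bsub>I0\<^esub> (x2 \<odot>\<^bsub>I0\<^esub> w) \<oplus>\<^bsub>I0\<^esub> z \<odot>\<^bsub>I0\<^esub> ((\<ominus> \<one>) \<odot>\<^bsub>I0\<^esub> u)"
    using home(3)[of z b2] b2 x2w mu by (simp add: I0.smult_r_distr[symmetric])
  also have "z \<odot>\<^bsub>I0\<^esub> (x2 \<odot>\<^bsub>I0\<^esub> w) = x2 \<odot>\<^bsub>I0\<^esub> (z \<odot>\<^bsub>I0\<^esub> w)"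
    using w(1) by (simp add: I0.smult_assoc1[symmetric] m_comm)
  also have "\<dots> = e (x2 \<otimes> a)" using home(3) a by simp
  also have "z \<odot>\<^bsub>I0\<^esub> ((\<ominus> \<one>) \<odot>\<^bsub>I0\<^esub> u) = (\<ominus> \<one>) \<odot>\<^bsub>I0\<^esub> (z \<odot>\<^bsub>I0\<^esub> u)"
    using I0.smult_assoc1[of z "\<ominus> \<one>" u] I0.smult_assoc1[of "\<ominus> \<one>" z u] m_comm[of z "\<ominus> \<one>"] u(1) by simp
  also have "\<dots> = e ((\<ominus> \<one>) \<otimes> x1)" unfolding zu using home(3)[of "\<ominus> \<one>" x1] by simp
  also have "e (x2 \<otimes> a) \<oplus>\<^bsub>I0\<^esub> \<dots> = e (x2 \<otimes> a \<oplus> (\<ominus> \<one>) \<otimes> x1)"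
    using home(2)[of "x2 \<otimes> a" "(\<ominus> \<one>) \<otimes> x1"] a(1) by simp
  finally have eq2: "z \<otimes> b2 = x2 \<otimes> a \<oplus> (\<ominus> \<one>) \<otimes> x1"
    using e(2) a(1) b2(1) by (simp add: inj_on_def)
  show False
  proof (cases "a \<in> M")
    case True
    obtain t where t: "t \<in> carrier S" "a \<otimes> x2 = z \<otimes> t" using Mx2[OF True] by blast
    have "x1 = a \<otimes> x2 \<ominus> z \<otimes> b2" unfolding eq2 using a(1) in_carrier(3,4) by algebra
    then have "x1 = z \<otimes> (t \<ominus> b2)" unfolding t(2) using t(1) b2(1) in_carrier(3,5) by algebra
    then show False using x1z[of "t \<ominus> b2"] t(1) b2(1) by simp
  next
    case False
    then have U: "a \<in> Units S" using local a(1) by blast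
    have "x1 = (x1 \<otimes> a) \<otimes> inv a" using U a(1) by (simp add: m_assoc)
    also have "\<dots> = z \<otimes> (b1 \<otimes> inv a)" unfolding eq1[symmetric] using U b1(1) by (simp add: m_assoc)
    finally show False using x1z[of "b1 \<otimes> inv a"] U b1(1) by simp
  qed
qed

text \<open>Beyond the end of a finite resolution the cosyzygies vanish; from there the property descends to the first
  cosyzygy, where it fails.\<close>

theorem not_finite_self_injective_dim: "\<not> finite_self_injective_dim S"
proof
  assume "finite_self_injective_dim S"
  then obtain n and I :: "nat \<Rightarrow> ('a, 'a list) module" and e d where
    inj: "\<And>i. injective_module S (I i)" and triv: "\<And>i. i > n \<Longrightarrow> carrier (I i) = {\<zero>\<^bsub>I i\<^esub>}"
    and e: "e \<in> module_hom S (self_module S) (I 0)" "inj_on e (carrier S)"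
    and d: "\<And>i. d i \<in> module_hom S (I i) (I (Suc i))"
    and ker0: "e ` carrier S = module_kernel (I 0) (I 1) (d 0)"
    and ker: "\<And>i. d i ` carrier (I i) = module_kernel (I (Suc i)) (I (Suc (Suc i))) (d (Suc i))"
    unfolding finite_self_injective_dim_def by metis
  have modI: "module S (I i)" for i using inj[of i] by (simp add: injective_module_def)
  define K where "K i = module_kernel (I i) (I (Suc i)) (d i)" for i
  have KS: "d i ` carrier (I i) = K (Suc i)" for i unfolding K_def by (rule ker)
  have "homs_are_scalar (I 1) (K 1)"
  proof (rule inc_induct[of 1 "Suc n"])
    show "homs_are_scalar (I (Suc n)) (K (Suc n))"
      unfolding homs_are_scalar_def
    proof (intro ballI impI)
      interpret In: module S "I (Suc n)" by (rule modI)
      fix \<psi> assume \<psi>: "\<psi> \<in> module_hom S (ideal_module S M) (I (Suc n))" "\<psi> ` M \<subseteq> K (Suc n)"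
      have \<psi>0: "\<psi> s = \<zero>\<^bsub>I (Suc n)\<^esub>" if "s \<in> M" for s
        using module_homD(1)[OF \<psi>(1), of s] that triv[of "Suc n"] by simp
      have "\<psi> z \<in> K (Suc n)" using \<psi>(2) in_carrier(6) by blast
      then have "\<zero>\<^bsub>I (Suc n)\<^esub> \<in> K (Suc n)" using \<psi>0[OF in_carrier(6)] by simp
      moreover have "\<psi> s = s \<odot>\<^bsub>I (Suc n)\<^esub> \<zero>\<^bsub>I (Suc n)\<^esub>" if "s \<in> M" for s using \<psi>0[OF that] that by simp
      ultimately show "\<exists>w\<in>K (Suc n). \<forall>s\<in>M. \<psi> s = s \<odot>\<^bsub>I (Suc n)\<^esub> w" by blast
    qed
    fix i assume i: "1 \<le> i" and IH: "homs_are_scalar (I (Suc i)) (K (Suc i))"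
    then obtain j where j: "i = Suc j" by (cases i) auto
    show "homs_are_scalar (I i) (K i)"
      unfolding j
      by (rule homs_are_scalar_step[OF inj inj modI d d KS _ KS IH[unfolded j]]) (simp add: K_def)
  qed simp
  then show False
    using homs_not_scalar_first[OF inj modI e d ker0[simplified] KS] by simp
qed

end

section \<open>Gorenstein rings without minimal multiplicity\<close>

context standard_graded
begin

definition independent3 where
  "independent3 z f g \<longleftrightarrow> (\<forall>a\<in>G 0. \<forall>b\<in>G 0. \<forall>c\<in>G 0.
     a \<otimes> z \<oplus> b \<otimes> f \<oplus> c \<otimes> g = \<zero> \<longrightarrow> a = \<zero> \<and> b = \<zero> \<and> c = \<zero>)"

lemma independent3D:
  assumes "independent3 z f g" "a \<in> G 0" "b \<in> G 0" "c \<in> G 0" "a \<otimes> z \<oplus> b \<otimes> f \<oplus> c \<otimes> g = \<zero>"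
  shows "a = \<zero>" "b = \<zero>" "c = \<zero>"
  using assms unfolding independent3_def by blast+

lemma G0_mult [simp]: "a \<in> G 0 \<Longrightarrow> b \<in> G 0 \<Longrightarrow> a \<otimes> b \<in> G 0"
  using mult_G[of a 0 b 0] by simp

lemma G0_mult_eq_zero:
  assumes "a \<in> G 0" "x \<in> carrier R" "a \<otimes> x = \<zero>" shows "a = \<zero> \<or> x = \<zero>"
proof (cases "a = \<zero>")
  case False
  then obtain d where d: "d \<in> G 0" "d \<otimes> a = \<one>" using G0_inverse[OF assms(1)] by blast
  have "x = (d \<otimes> a) \<otimes> x" using d assms by simp
  also have "\<dots> = d \<otimes> (a \<otimes> x)" using d(1) assms(1,2) by (simp add: m_assoc)
  finally show ?thesis using assms(3) d(1) by simp
qed simp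

lemma independent3I:
  assumes "z \<in> G 1" "f \<in> G 1" "g \<in> G 1" "z \<noteq> \<zero>"
    and f: "\<And>a. a \<in> G 0 \<Longrightarrow> f \<noteq> a \<otimes> z"
    and g: "\<And>a b. a \<in> G 0 \<Longrightarrow> b \<in> G 0 \<Longrightarrow> g \<noteq> a \<otimes> z \<oplus> b \<otimes> f"
  shows "independent3 z f g"
  unfolding independent3_def
proof (intro ballI impI)
  fix a b c assume abc: "a \<in> G 0" "b \<in> G 0" "c \<in> G 0" and eq: "a \<otimes> z \<oplus> b \<otimes> f \<oplus> c \<otimes> g = \<zero>"
  have R: "a \<in> carrier R" "b \<in> carrier R" "c \<in> carrier R" "z \<in> carrier R" "f \<in> carrier R" "g \<in> carrier R"
    using abc assms(1-3) G_carrier by blast+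
  have c0: "c = \<zero>"
  proof (rule ccontr)
    assume "c \<noteq> \<zero>"
    then obtain d where d: "d \<in> G 0" "d \<otimes> c = \<one>" using G0_inverse[OF abc(3)] by blast
    have dR: "d \<in> carrier R" using d(1) by (rule G_carrier)
    have "(d \<otimes> c) \<otimes> g = d \<otimes> (a \<otimes> z \<oplus> b \<otimes> f \<oplus> c \<otimes> g) \<oplus> ((\<ominus> (d \<otimes> a)) \<otimes> z \<oplus> (\<ominus> (d \<otimes> b)) \<otimes> f)"
      using R dR by algebra
    then have "g = (\<ominus> (d \<otimes> a)) \<otimes> z \<oplus> (\<ominus> (d \<otimes> b)) \<otimes> f" using eq d(2) R dR by simp
    then show False using g[of "\<ominus> (d \<otimes> a)" "\<ominus> (d \<otimes> b)"] d(1) abc by simp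
  qed
  have b0: "b = \<zero>"
  proof (rule ccontr)
    assume "b \<noteq> \<zero>"
    then obtain d where d: "d \<in> G 0" "d \<otimes> b = \<one>" using G0_inverse[OF abc(2)] by blast
    have dR: "d \<in> carrier R" using d(1) by (rule G_carrier)
    have "(d \<otimes> b) \<otimes> f = d \<otimes> (a \<otimes> z \<oplus> b \<otimes> f) \<oplus> (\<ominus> (d \<otimes> a)) \<otimes> z"
      using R dR by algebra
    then have "f = (\<ominus> (d \<otimes> a)) \<otimes> z" using eq c0 d(2) R dR by simp
    then show False using f[of "\<ominus> (d \<otimes> a)"] d(1) abc by simp
  qed
  have "a = \<zero>" using eq b0 c0 R G0_mult_eq_zero[OF abc(1) R(4)] assms(4) by simp
  then show "a = \<zero> \<and> b = \<zero> \<and> c = \<zero>" using b0 c0 by simp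
qed

lemma comp1_mult_irrelevant:
  assumes "s \<in> carrier R" "r \<in> \<mm>"
  shows "comp (s \<otimes> r) 1 = comp s 0 \<otimes> comp r 1"
proof -
  have r: "r \<in> carrier R" "comp r 0 = \<zero>" using assms(2) by (simp_all add: irrelevant_eq)
  show ?thesis using comp_mult_1[OF assms(1) r(1)] r assms(1) by simp
qed

text \<open>By hypothesis every linear form is a socle element modulo \<open>z\<close>. Let \<open>J0\<close> consist of the elements of \<open>\<mm>\<close> whose
  linear part lies in the span of \<open>z\<close> and \<open>x1\<close>. An ideal \<open>J\<close> with \<open>J0 \<subseteq> J \<subseteq> \<mm>\<close> that is maximal without \<open>x2\<close> is
  the required hyperplane: for \<open>y \<in> \<mm> - J\<close> maximality gives \<open>x2 \<in> J + R y\<close>, and since \<open>\<mm> y \<subseteq> J\<close> the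
  coefficient of \<open>y\<close> may be taken in \<open>k\<close>. All data are then transported to the localization at \<open>\<mm>\<close>.\<close>

lemma not_gorenstein_if_minimal_multiplicity:
  assumes z: "z \<in> G 1" "nonzerodivisor z" and x: "x1 \<in> G 1" "x2 \<in> G 1"
    and ind: "independent3 z x1 x2"
    and mult: "\<And>x y. x \<in> G 1 \<Longrightarrow> y \<in> G 1 \<Longrightarrow> x \<otimes> y \<in> PIdl z"
  shows "\<not> gorenstein_ring R"
proof -
  interpret m: ideal \<mm> R by (rule ideal_irrelevant)
  note zR = G_carrier[OF z(1)] and x1R = G_carrier[OF x(1)] and x2R = G_carrier[OF x(2)]
  have zm: "z \<in> \<mm>" "x1 \<in> \<mm>" "x2 \<in> \<mm>" using z x G1_irrelevant by blast+
  interpret Z: ideal "PIdl z" R by (rule cgenideal_ideal[OF zR])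
  have multm: "\<exists>t\<in>carrier R. a \<otimes> y = z \<otimes> t" if a: "a \<in> \<mm>" and y: "y \<in> G 1" for a y
  proof -
    have yR: "y \<in> carrier R" using y by (rule G_carrier)
    let ?I = "{a \<in> carrier R. a \<otimes> y \<in> PIdl z}"
    have "ideal ?I R"
    proof (rule idealI')
      fix r a assume *: "r \<in> carrier R" "a \<in> ?I"
      have "(r \<otimes> a) \<otimes> y = r \<otimes> (a \<otimes> y)" "(a \<otimes> r) \<otimes> y = r \<otimes> (a \<otimes> y)"
        using * yR by (simp_all add: m_ac)
      moreover have "r \<otimes> (a \<otimes> y) \<in> PIdl z" using * Z.I_l_closed by blast
      ultimately show "r \<otimes> a \<in> ?I" "a \<otimes> r \<in> ?I" using * by simp_all
    qed (use yR Z.zero_closed in \<open>auto simp: l_distr\<close>)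
    moreover have "G 1 \<subseteq> ?I" using mult[OF _ y] G_carrier by blast
    ultimately have "a \<in> ?I" using irrelevant_subset_ideal a by blast
    then obtain t where "t \<in> carrier R" "a \<otimes> y = t \<otimes> z" unfolding cgenideal_def by blast
    then show ?thesis using zR m_comm by metis
  qed
  define J0 where "J0 = {r \<in> \<mm>. \<exists>a\<in>G 0. \<exists>b\<in>G 0. comp r 1 = a \<otimes> z \<oplus> b \<otimes> x1}"
  have J0: "ideal J0 R"
  proof (rule idealI')
    have "comp \<zero> 1 = \<zero> \<otimes> z \<oplus> \<zero> \<otimes> x1" using zR x1R by simp
    then show "\<zero> \<in> J0" unfolding J0_def using m.zero_closed G_zero by blast
    show "J0 \<subseteq> carrier R" unfolding J0_def using irrelevant_carrier by blast
  next
    fix r s assume "r \<in> J0" "s \<in> J0"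
    then obtain a b c d where *: "r \<in> \<mm>" "s \<in> \<mm>" "a \<in> G 0" "b \<in> G 0" "c \<in> G 0" "d \<in> G 0"
      "comp r 1 = a \<otimes> z \<oplus> b \<otimes> x1" "comp s 1 = c \<otimes> z \<oplus> d \<otimes> x1" unfolding J0_def by blast
    have "comp (r \<oplus> s) 1 = (a \<oplus> c) \<otimes> z \<oplus> (b \<oplus> d) \<otimes> x1"
      unfolding comp_add[OF irrelevant_carrier[OF *(1)] irrelevant_carrier[OF *(2)]] *(7,8)
      using *(3-6)[THEN G_carrier] zR x1R by algebra
    then show "r \<oplus> s \<in> J0" unfolding J0_def using * m.a_closed G_add by blast
  next
    fix s r assume s: "s \<in> carrier R" and "r \<in> J0"
    then obtain a b where *: "r \<in> \<mm>" "a \<in> G 0" "b \<in> G 0" "comp r 1 = a \<otimes> z \<oplus> b \<otimes> x1"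
      unfolding J0_def by blast
    have "comp (s \<otimes> r) 1 = (comp s 0 \<otimes> a) \<otimes> z \<oplus> (comp s 0 \<otimes> b) \<otimes> x1"
      unfolding comp1_mult_irrelevant[OF s *(1)] *(4)
      using *(2,3)[THEN G_carrier] comp_carrier[OF s, of 0] zR x1R by algebra
    then have "s \<otimes> r \<in> J0"
      unfolding J0_def using *(1-3) comp_in[OF s, of 0] m.I_l_closed[OF *(1) s] G0_mult by blast
    then show "s \<otimes> r \<in> J0" "r \<otimes> s \<in> J0" using m_comm[OF s irrelevant_carrier[OF *(1)]] by simp_all
  qed
  have zJ0: "z \<in> J0"
  proof -
    have "comp z 1 = \<one> \<otimes> z \<oplus> \<zero> \<otimes> x1" using z(1) zR x1R by simp
    then show ?thesis unfolding J0_def using zm G_one G_zero by blast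
  qed
  have x1J0: "x1 \<in> J0"
  proof -
    have "comp x1 1 = \<zero> \<otimes> z \<oplus> \<one> \<otimes> x1" using x zR x1R by simp
    then show ?thesis unfolding J0_def using zm G_one G_zero by blast
  qed
  have mmJ0: "a \<otimes> b \<in> J0" if ab: "a \<in> \<mm>" "b \<in> \<mm>" for a b
  proof -
    have "comp a 0 = \<zero>" using ab(1) by (rule irrelevantD)
    then have "comp (a \<otimes> b) 1 = \<zero> \<otimes> z \<oplus> \<zero> \<otimes> x1"
      using comp1_mult_irrelevant[OF irrelevant_carrier[OF ab(1)] ab(2)] irrelevant_carrier[OF ab(2)] zR x1R by simp
    then show ?thesis unfolding J0_def using m.I_l_closed[OF ab(2) irrelevant_carrier[OF ab(1)]] G_zero by blast
  qed
  have x2J0: "x2 \<notin> J0"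
  proof
    assume "x2 \<in> J0"
    then obtain a b where ab: "a \<in> G 0" "b \<in> G 0" "x2 = a \<otimes> z \<oplus> b \<otimes> x1" unfolding J0_def using x by auto
    have "a \<otimes> z \<oplus> b \<otimes> x1 \<oplus> (\<ominus> \<one>) \<otimes> x2 = \<zero>"
      unfolding ab(3) using ab(1,2)[THEN G_carrier] zR x1R by algebra
    then have "\<ominus> \<one> = \<zero>" using independent3D(3)[OF ind ab(1,2), of "\<ominus> \<one>"] by simp
    then show False using one_nz by (metis minus_minus minus_zero one_closed)
  qed
  define F where "F = {J. ideal J R \<and> J0 \<subseteq> J \<and> J \<subseteq> \<mm> \<and> x2 \<notin> J}"
  have "J0 \<subseteq> \<mm>" unfolding J0_def by blast
  then have "F \<noteq> {}" unfolding F_def using J0 x2J0 by blast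
  then obtain J where JF: "J \<in> F" and max: "\<And>K. K \<in> F \<Longrightarrow> J \<subseteq> K \<Longrightarrow> K = J"
    using maximal_member_of_ideal_family[of F] unfolding F_def by blast
  have J: "ideal J R" "J0 \<subseteq> J" "J \<subseteq> \<mm>" "x2 \<notin> J" using JF unfolding F_def by auto
  interpret J: ideal J R by (rule J(1))
  have unit_out: "y \<in> J" if t: "t \<in> carrier R" "t \<notin> \<mm>" and y: "y \<in> \<mm>" "t \<otimes> y \<in> J" for t y
  proof -
    note yR = irrelevant_carrier[OF y(1)]
    obtain t' where t': "t' \<in> \<mm>" "t = comp t 0 \<oplus> t'" using constant_plus_irrelevant[OF t(1)] .
    obtain d where d: "d \<in> G 0" "d \<otimes> comp t 0 = \<one>"
      using nonirrelevant_constant_inverse[OF t] .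
    note R = irrelevant_carrier[OF t'(1)] G_carrier[OF d(1)] comp_carrier[OF t(1), of 0]
    have "(d \<otimes> comp t 0) \<otimes> y = d \<otimes> ((comp t 0 \<oplus> t') \<otimes> y) \<oplus> \<ominus> (d \<otimes> (t' \<otimes> y))"
      using R yR by algebra
    then have "y = d \<otimes> (t \<otimes> y) \<oplus> \<ominus> (d \<otimes> (t' \<otimes> y))" using d(2) t'(2) yR by simp
    moreover have "t' \<otimes> y \<in> J" using mmJ0[OF t'(1) y(1)] J(2) by blast
    ultimately show ?thesis using J.I_l_closed[OF y(2) R(2)] J.I_l_closed[OF _ R(2)] J.a_closed J.a_inv_closed by metis
  qed
  have span: "\<exists>c\<in>carrier R. y \<ominus> c \<otimes> x2 \<in> J" if y: "y \<in> \<mm>" for y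
  proof (cases "y \<in> J")
    case True
    then have "y \<ominus> \<zero> \<otimes> x2 \<in> J" using x2R irrelevant_carrier[OF y] by (simp add: minus_eq)
    then show ?thesis by blast
  next
    case False
    note yR = irrelevant_carrier[OF y]
    let ?K = "{p \<oplus> r \<otimes> y | p r. p \<in> J \<and> r \<in> carrier R}"
    have K: "ideal ?K R" "J \<subseteq> ?K" "y \<in> ?K" by (rule ideal_adjoin[OF J(1) yR])+
    have "?K \<subseteq> \<mm>" using m.I_l_closed[OF y] J(3) m.a_closed by blast
    then have "x2 \<in> ?K" using max[of ?K] K J(2) False unfolding F_def by blast
    then obtain p r where pr: "p \<in> J" "r \<in> carrier R" "x2 = p \<oplus> r \<otimes> y" by blast
    have pR: "p \<in> carrier R" using J.Icarr[OF pr(1)] .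
    have "r \<notin> \<mm>"
    proof
      assume "r \<in> \<mm>"
      then have "x2 \<in> J" unfolding pr(3) using mmJ0[OF _ y] J(2) pr(1) J.a_closed by blast
      then show False using J(4) by blast
    qed
    then obtain d where d: "d \<in> G 0" "d \<otimes> comp r 0 = \<one>"
      using nonirrelevant_constant_inverse[OF pr(2)] by blast
    note dR = G_carrier[OF d(1)]
    have "r \<otimes> (y \<ominus> d \<otimes> x2) = (r \<otimes> (\<one> \<ominus> d \<otimes> r)) \<otimes> y \<oplus> (\<ominus> (r \<otimes> d)) \<otimes> p"
      unfolding pr(3) using pr(2) yR pR dR by algebra
    moreover have "\<one> \<ominus> d \<otimes> r \<in> \<mm>"
    proof (rule irrelevantI)
      have "comp (\<one> \<ominus> d \<otimes> r) 0 = \<one> \<ominus> d \<otimes> comp r 0"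
        using comp_diff[of \<one> "d \<otimes> r" 0] comp_mult_0[OF dR pr(2)] d(1) dR pr(2) by simp
      then show "comp (\<one> \<ominus> d \<otimes> r) 0 = \<zero>" using d(2) by simp
    qed (use pr(2) dR in simp)
    then have "r \<otimes> (\<one> \<ominus> d \<otimes> r) \<in> \<mm>" using m.I_l_closed pr(2) by blast
    then have "(r \<otimes> (\<one> \<ominus> d \<otimes> r)) \<otimes> y \<in> J" using mmJ0[OF _ y] J(2) by blast
    moreover have "(\<ominus> (r \<otimes> d)) \<otimes> p \<in> J" using J.I_l_closed[OF pr(1)] pr(2) dR by simp
    ultimately have "r \<otimes> (y \<ominus> d \<otimes> x2) \<in> J" using J.a_closed by simp
    moreover have "y \<ominus> d \<otimes> x2 \<in> \<mm>" unfolding minus_eq using y m.I_l_closed[OF zm(3) dR] by blast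
    ultimately show ?thesis using unit_out[OF pr(2) \<open>r \<notin> \<mm>\<close>] dR by blast
  qed
  interpret L: localization_at_prime \<mm> R
    by (rule localization_at_prime.intro[OF prime_irrelevant])
  let ?S = "localization R \<mm>"
  interpret S: cring ?S by (rule L.cring_localization)
  have ext_cases: "\<exists>a s. a \<in> K \<and> s \<in> L.W \<and> y = L.frac a s" if "y \<in> L.extension K" for y K
    using that unfolding L.extension_def by blast
  have extI: "L.frac a s \<in> L.extension K" if "a \<in> K" "s \<in> L.W" for a s K
    using that unfolding L.extension_def by blast
  have frac_mult1: "L.frac a s \<otimes>\<^bsub>?S\<^esub> L.frac b \<one> = L.frac (a \<otimes> b) s"
    if "a \<in> carrier R" "s \<in> L.W" "b \<in> carrier R" for a s b
    using L.frac_mult[of a b s \<one>] that by simp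
  have M1: "\<exists>t\<in>carrier ?S. y \<otimes>\<^bsub>?S\<^esub> L.frac w \<one> = L.frac z \<one> \<otimes>\<^bsub>?S\<^esub> t"
    if y: "y \<in> L.extension \<mm>" and w: "w \<in> G 1" for y w
  proof -
    obtain a s where a: "a \<in> \<mm>" "s \<in> L.W" "y = L.frac a s" using ext_cases[OF y] by blast
    obtain t where t: "t \<in> carrier R" "a \<otimes> w = z \<otimes> t" using multm[OF a(1) w] by blast
    have "y \<otimes>\<^bsub>?S\<^esub> L.frac w \<one> = L.frac (z \<otimes> t) s"
      unfolding a(3) t(2)[symmetric] by (rule frac_mult1[OF irrelevant_carrier[OF a(1)] a(2) G_carrier[OF w]])
    also have "\<dots> = L.frac z \<one> \<otimes>\<^bsub>?S\<^esub> L.frac t s"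
      using L.frac_mult[of z t \<one> s] zR t(1) a(2) by simp
    finally show ?thesis using L.frac_in_carrier[OF t(1) a(2)] by blast
  qed
  have Jm: "L.extension J \<subseteq> L.extension \<mm>" using J(3) unfolding L.extension_def by blast
  have "socle_too_large ?S (L.extension \<mm>) (L.extension J) (L.frac z \<one>) (L.frac x1 \<one>) (L.frac x2 \<one>)"
  proof (intro socle_too_large.intro S.is_cring socle_too_large_axioms.intro)
    show "ideal (L.extension \<mm>) ?S" "ideal (L.extension J) ?S"
      using L.ideal_extension ideal_irrelevant J(1) by auto
    show "L.extension J \<subseteq> L.extension \<mm>" by (rule Jm)
    show "a \<in> Units ?S" if "a \<in> carrier ?S" "a \<notin> L.extension \<mm>" for a
      using that L.nonunits_localization by blast
    show "S.nonzerodivisor (L.frac z \<one>)"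
      unfolding S.nonzerodivisor_def
    proof (intro conjI ballI impI)
      show "L.frac z \<one> \<in> carrier ?S" using zR by simp
      fix y assume y: "y \<in> carrier ?S" "L.frac z \<one> \<otimes>\<^bsub>?S\<^esub> y = \<zero>\<^bsub>?S\<^esub>"
      obtain a s where a: "a \<in> carrier R" "s \<in> L.W" "y = L.frac a s" using L.frac_cases[OF y(1)] .
      have "L.frac (z \<otimes> a) s = L.frac \<zero> \<one>"
        using y(2) L.frac_mult[of z a \<one> s] zR a by (simp add: L.zero_RP)
      then obtain u where u: "u \<in> L.W" "u \<otimes> (z \<otimes> a \<otimes> \<one>) = u \<otimes> (\<zero> \<otimes> s)"
        using L.frac_eq_iff[of "z \<otimes> a" \<zero> s \<one>] zR a by auto
      then have "u \<otimes> (z \<otimes> a) = \<zero>" using zR a by simp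
      then have "z \<otimes> a = \<zero>" using nonirrelevant_mult_zero[of u "z \<otimes> a"] u(1) zR a(1) by (simp add: L.mem_W_iff)
      then have "a = \<zero>" using z(2) a(1) by (simp add: nonzerodivisor_def)
      then show "y = \<zero>\<^bsub>?S\<^esub>" unfolding a(3) L.zero_RP using a(2) by (intro L.frac_eqI) auto
    qed
    show "L.frac z \<one> \<in> L.extension J" "L.frac x1 \<one> \<in> L.extension J" "L.frac x2 \<one> \<in> L.extension \<mm>"
      using zJ0 x1J0 J(2) zm(3) L.one_W by (auto intro!: extI)
    show "L.frac x2 \<one> \<notin> L.extension J"
    proof
      assume "L.frac x2 \<one> \<in> L.extension J"
      then obtain u where "u \<in> L.W" "u \<otimes> x2 \<in> J"
        using L.frac_mem_extension_iff[OF J(1) x2R L.one_W] by blast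
      then show False using unit_out[of u x2] zm(3) J(4) by (simp add: L.mem_W_iff)
    qed
    show "a \<otimes>\<^bsub>?S\<^esub> b \<in> L.extension J" if ab: "a \<in> L.extension \<mm>" "b \<in> L.extension \<mm>" for a b
    proof -
      obtain a' s where a: "a' \<in> \<mm>" "s \<in> L.W" "a = L.frac a' s" using ext_cases[OF ab(1)] by blast
      obtain b' t where b: "b' \<in> \<mm>" "t \<in> L.W" "b = L.frac b' t" using ext_cases[OF ab(2)] by blast
      have "a \<otimes>\<^bsub>?S\<^esub> b = L.frac (a' \<otimes> b') (s \<otimes> t)"
        unfolding a(3) b(3) using L.frac_mult irrelevant_carrier a b by blast
      moreover have "a' \<otimes> b' \<in> J" using mmJ0[OF a(1) b(1)] J(2) by blast
      ultimately show ?thesis using extI L.W_mult[OF a(2) b(2)] by simp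
    qed
    show "\<exists>c\<in>carrier ?S. y \<ominus>\<^bsub>?S\<^esub> c \<otimes>\<^bsub>?S\<^esub> L.frac x2 \<one> \<in> L.extension J" if y: "y \<in> L.extension \<mm>" for y
    proof -
      obtain a s where a: "a \<in> \<mm>" "s \<in> L.W" "y = L.frac a s" using ext_cases[OF y] by blast
      note aR = irrelevant_carrier[OF a(1)]
      obtain c where c: "c \<in> carrier R" "a \<ominus> c \<otimes> x2 \<in> J" using span[OF a(1)] by blast
      let ?A = "L.frac (a \<ominus> c \<otimes> x2) s" and ?B = "L.frac (c \<otimes> x2) s"
      have "?A \<oplus>\<^bsub>?S\<^esub> ?B = L.frac ((a \<ominus> c \<otimes> x2) \<oplus> c \<otimes> x2) s"
        using aR c(1) x2R a(2) by (intro L.frac_add_same) auto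
      also have "(a \<ominus> c \<otimes> x2) \<oplus> c \<otimes> x2 = a" using aR c(1) x2R by algebra
      finally have "y = ?A \<oplus>\<^bsub>?S\<^esub> ?B" using a(3) by simp
      moreover have AB: "?A \<in> carrier ?S" "?B \<in> carrier ?S" using aR c(1) x2R a(2) by auto
      have "(?A \<oplus>\<^bsub>?S\<^esub> ?B) \<ominus>\<^bsub>?S\<^esub> ?B = ?A" using AB by algebra
      ultimately have "y \<ominus>\<^bsub>?S\<^esub> ?B \<in> L.extension J" using extI[OF c(2) a(2)] by simp
      moreover have "?B = L.frac c s \<otimes>\<^bsub>?S\<^esub> L.frac x2 \<one>" using frac_mult1[OF c(1) a(2) x2R] by simp
      ultimately show ?thesis using L.frac_in_carrier[OF c(1) a(2)] by metis
    qed
    show "\<exists>t\<in>carrier ?S. y \<otimes>\<^bsub>?S\<^esub> L.frac x1 \<one> = L.frac z \<one> \<otimes>\<^bsub>?S\<^esub> t"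
      "\<exists>t\<in>carrier ?S. y \<otimes>\<^bsub>?S\<^esub> L.frac x2 \<one> = L.frac z \<one> \<otimes>\<^bsub>?S\<^esub> t" if "y \<in> L.extension \<mm>" for y
      using M1[OF that] x by auto
    show "L.frac x1 \<one> \<noteq> L.frac z \<one> \<otimes>\<^bsub>?S\<^esub> t" if t: "t \<in> carrier ?S" for t
    proof
      assume eq: "L.frac x1 \<one> = L.frac z \<one> \<otimes>\<^bsub>?S\<^esub> t"
      obtain b s where b: "b \<in> carrier R" "s \<in> L.W" "t = L.frac b s" using L.frac_cases[OF t] .
      have "L.frac x1 \<one> = L.frac (z \<otimes> b) s" using eq L.frac_mult[of z b \<one> s] zR b by simp
      then obtain u where u: "u \<in> L.W" "u \<otimes> (x1 \<otimes> s) = u \<otimes> (z \<otimes> b \<otimes> \<one>)"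
        using L.frac_eq_iff[of x1 "z \<otimes> b" \<one> s] x1R zR b by auto
      have us: "u \<in> carrier R" "u \<notin> \<mm>" "s \<in> carrier R" "s \<notin> \<mm>" using u(1) b(2) by (auto simp: L.mem_W_iff)
      have "(u \<otimes> s) \<otimes> x1 = u \<otimes> (x1 \<otimes> s)" using us(1,3) x1R by algebra
      also have "\<dots> = (u \<otimes> b) \<otimes> z" unfolding u(2) using us(1) b(1) zR by algebra
      finally have "comp ((u \<otimes> s) \<otimes> x1) 1 = comp ((u \<otimes> b) \<otimes> z) 1" by simp
      then have eq: "(comp u 0 \<otimes> comp s 0) \<otimes> x1 = (comp u 0 \<otimes> comp b 0) \<otimes> z"
        using comp1_mult_irrelevant[of "u \<otimes> s" x1] comp1_mult_irrelevant[of "u \<otimes> b" z] us b(1) zm z(1) x(1)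
        by (simp add: comp_mult_0)
      let ?a = "comp u 0 \<otimes> comp b 0" and ?b = "comp u 0 \<otimes> comp s 0"
      have ab: "?a \<in> G 0" "?b \<in> G 0" using us b by simp_all
      have "?a \<otimes> z \<oplus> (\<ominus> ?b) \<otimes> x1 \<oplus> \<zero> \<otimes> x2 = \<zero>"
        using ab[THEN G_carrier] zR x1R x2R eq by (simp add: l_minus r_neg)
      then have "\<ominus> ?b = \<zero>" using independent3D(2)[OF ind ab(1), of "\<ominus> ?b" \<zero>] ab by simp
      then have "?b = \<zero>" using G_carrier[OF ab(2)] by (metis minus_minus minus_zero)
      then have "comp u 0 = \<zero> \<or> comp s 0 = \<zero>" using G0_mult_eq_zero us by simp
      then show False using us irrelevantI by blast
    qed
  qed
  then have "\<not> finite_self_injective_dim ?S" by (rule socle_too_large.not_finite_self_injective_dim)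
  then show ?thesis using maximal_irrelevant unfolding gorenstein_ring_def by blast
qed

end

section \<open>Ideals as graded modules\<close>

text \<open>The modules in the definition of countable type have elements of type \<^typ>\<open>(nat \<Rightarrow> 'a) set\<close>. A ring element is
  coded by the singleton of the corresponding constant function.\<close>

definition emb :: "'a \<Rightarrow> (nat \<Rightarrow> 'a) set" where "emb r = {\<lambda>_. r}"
definition unemb :: "(nat \<Rightarrow> 'a) set \<Rightarrow> 'a" where "unemb U = (THE f. f \<in> U) 0"

lemma unemb_emb [simp]: "unemb (emb r) = r"
  by (simp add: emb_def unemb_def)

lemma emb_inj: "emb r = emb s \<longleftrightarrow> r = s"
  by (metis unemb_emb)

definition emb_module :: "('a, 'b) ring_scheme \<Rightarrow> 'a set \<Rightarrow> ('a, (nat \<Rightarrow> 'a) set) module" where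
  "emb_module R I = \<lparr>carrier = emb ` I, monoid.mult = (\<lambda>U Y. {}), monoid.one = {},
     ring.zero = emb \<zero>\<^bsub>R\<^esub>, ring.add = (\<lambda>U Y. emb (unemb U \<oplus>\<^bsub>R\<^esub> unemb Y)),
     module.smult = (\<lambda>a U. emb (a \<otimes>\<^bsub>R\<^esub> unemb U))\<rparr>"

definition emb_grading :: "(nat \<Rightarrow> 'a set) \<Rightarrow> 'a \<Rightarrow> 'a set \<Rightarrow> int \<Rightarrow> (nat \<Rightarrow> 'a) set set" where
  "emb_grading G zer I i = (if i < 0 then {emb zer} else emb ` (I \<inter> G (nat i)))"

lemma emb_module_simps [simp]:
  "carrier (emb_module R I) = emb ` I" "\<zero>\<^bsub>emb_module R I\<^esub> = emb \<zero>\<^bsub>R\<^esub>"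
  "U \<oplus>\<^bsub>emb_module R I\<^esub> Y = emb (unemb U \<oplus>\<^bsub>R\<^esub> unemb Y)"
  "a \<odot>\<^bsub>emb_module R I\<^esub> U = emb (a \<otimes>\<^bsub>R\<^esub> unemb U)"
  by (simp_all add: emb_module_def)

context cring begin

lemma module_emb:
  assumes "ideal I R" shows "module R (emb_module R I)"
proof -
  interpret I: ideal I R by fact
  note c = I.Icarr
  show ?thesis
  proof (rule moduleI[OF is_cring])
    show "abelian_group (emb_module R I)"
    proof (rule abelian_groupI)
      fix U assume "U \<in> carrier (emb_module R I)"
      then obtain r where r: "r \<in> I" "U = emb r" by auto
      then have "emb (\<ominus> r) \<oplus>\<^bsub>emb_module R I\<^esub> U = \<zero>\<^bsub>emb_module R I\<^esub>" "emb (\<ominus> r) \<in> carrier (emb_module R I)"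
        using c[OF r(1)] by (auto simp: l_neg)
      then show "\<exists>Y\<in>carrier (emb_module R I). Y \<oplus>\<^bsub>emb_module R I\<^esub> U = \<zero>\<^bsub>emb_module R I\<^esub>" by blast
    next
      fix U Y Z assume "U \<in> carrier (emb_module R I)" "Y \<in> carrier (emb_module R I)" "Z \<in> carrier (emb_module R I)"
      then obtain r s t where "r \<in> I" "U = emb r" "s \<in> I" "Y = emb s" "t \<in> I" "Z = emb t" by auto
      then show "U \<oplus>\<^bsub>emb_module R I\<^esub> Y \<oplus>\<^bsub>emb_module R I\<^esub> Z = U \<oplus>\<^bsub>emb_module R I\<^esub> (Y \<oplus>\<^bsub>emb_module R I\<^esub> Z)"
        using c by (simp add: a_assoc)
    next
      fix U Y assume "U \<in> carrier (emb_module R I)" "Y \<in> carrier (emb_module R I)"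
      then obtain r s where "r \<in> I" "U = emb r" "s \<in> I" "Y = emb s" by auto
      then show "U \<oplus>\<^bsub>emb_module R I\<^esub> Y \<in> carrier (emb_module R I)"
        "U \<oplus>\<^bsub>emb_module R I\<^esub> Y = Y \<oplus>\<^bsub>emb_module R I\<^esub> U"
        using c by (auto simp: a_comm)
    qed (use c in auto)
  next
    fix a U assume a: "a \<in> carrier R" and "U \<in> carrier (emb_module R I)"
    then obtain r where r: "r \<in> I" "U = emb r" by auto
    then show "a \<odot>\<^bsub>emb_module R I\<^esub> U \<in> carrier (emb_module R I)" using I.I_l_closed[OF r(1) a] by simp
  next
    fix a b U assume a: "a \<in> carrier R" "b \<in> carrier R" and "U \<in> carrier (emb_module R I)"
    then obtain r where "r \<in> I" and rU: "U = emb r" by auto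
    then have r: "r \<in> carrier R" "U = emb r" using c by auto
    then show "(a \<oplus> b) \<odot>\<^bsub>emb_module R I\<^esub> U = a \<odot>\<^bsub>emb_module R I\<^esub> U \<oplus>\<^bsub>emb_module R I\<^esub> b \<odot>\<^bsub>emb_module R I\<^esub> U"
      "(a \<otimes> b) \<odot>\<^bsub>emb_module R I\<^esub> U = a \<odot>\<^bsub>emb_module R I\<^esub> (b \<odot>\<^bsub>emb_module R I\<^esub> U)"
      using a by (simp_all add: l_distr m_assoc)
  next
    fix a U Y assume a: "a \<in> carrier R" and "U \<in> carrier (emb_module R I)" "Y \<in> carrier (emb_module R I)"
    then obtain r s where "r \<in> I" "s \<in> I" and rs: "U = emb r" "Y = emb s" by auto
    then have r: "r \<in> carrier R" "U = emb r" "s \<in> carrier R" "Y = emb s" using c by auto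
    then show "a \<odot>\<^bsub>emb_module R I\<^esub> (U \<oplus>\<^bsub>emb_module R I\<^esub> Y) = a \<odot>\<^bsub>emb_module R I\<^esub> U \<oplus>\<^bsub>emb_module R I\<^esub> a \<odot>\<^bsub>emb_module R I\<^esub> Y"
      using a by (simp add: r_distr)
  next
    fix U assume "U \<in> carrier (emb_module R I)"
    then obtain r where "r \<in> I" and rU: "U = emb r" by auto
    then have r: "r \<in> carrier R" "U = emb r" using c by auto
    then show "\<one> \<odot>\<^bsub>emb_module R I\<^esub> U = U" by simp
  qed
qed

lemma finsum_emb:
  assumes "ideal I R" "finite A" "\<And>i. i \<in> A \<Longrightarrow> f i \<in> I"
  shows "(\<Oplus>\<^bsub>emb_module R I\<^esub>i\<in>A. emb (f i)) = emb (\<Oplus>i\<in>A. f i)"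
proof -
  interpret E: module R "emb_module R I" by (rule module_emb[OF assms(1)])
  show ?thesis
    using assms(2,3)
  proof (induction A rule: finite_induct)
    case empty
    show ?case by (simp only: E.M.finsum_empty finsum_empty emb_module_simps)
  next
    case (insert a A)
    have "(\<Oplus>\<^bsub>emb_module R I\<^esub>i\<in>insert a A. emb (f i)) = emb (f a) \<oplus>\<^bsub>emb_module R I\<^esub> (\<Oplus>\<^bsub>emb_module R I\<^esub>i\<in>A. emb (f i))"
      using insert by (intro E.M.finsum_insert) auto
    also have "\<dots> = emb (f a \<oplus> (\<Oplus>i\<in>A. f i))" using insert by simp
    also have "f a \<oplus> (\<Oplus>i\<in>A. f i) = (\<Oplus>i\<in>insert a A. f i)"
      using insert ideal.Icarr[OF assms(1)] by (intro finsum_insert[symmetric]) auto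
    finally show ?case .
  qed
qed

lemma submodule_emb_iff:
  assumes "ideal I R" "K \<subseteq> I" "ideal K R" shows "submodule (emb ` K) R (emb_module R I)"
proof -
  interpret E: module R "emb_module R I" by (rule module_emb[OF assms(1)])
  interpret K: ideal K R by (rule assms(3))
  have neg: "\<ominus>\<^bsub>emb_module R I\<^esub> (emb r) = emb (\<ominus> r)" if r: "r \<in> I" for r
  proof (rule E.M.minus_equality)
    have "r \<in> carrier R" using ideal.Icarr[OF assms(1) r] .
    then show "emb (\<ominus> r) \<oplus>\<^bsub>emb_module R I\<^esub> emb r = \<zero>\<^bsub>emb_module R I\<^esub>" by (simp add: l_neg)
    show "emb r \<in> carrier (emb_module R I)" "emb (\<ominus> r) \<in> carrier (emb_module R I)"
      using r additive_subgroup.a_inv_closed[OF ideal.axioms(1)[OF assms(1)] r] by auto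
  qed
  show ?thesis
  proof (rule E.submoduleI)
    fix U assume "U \<in> emb ` K"
    then obtain r where r: "r \<in> K" "U = emb r" by auto
    then show "\<ominus>\<^bsub>emb_module R I\<^esub> U \<in> emb ` K" using neg[of r] assms(2) by auto
  next
    fix a U assume a: "a \<in> carrier R" and "U \<in> emb ` K"
    then obtain r where r: "r \<in> K" "U = emb r" by auto
    then show "a \<odot>\<^bsub>emb_module R I\<^esub> U \<in> emb ` K" using K.I_l_closed[OF r(1) a] by simp
  qed (use assms(2) in auto)
qed

end

context standard_graded
begin

lemma graded_emb:
  assumes I: "ideal I R" and hom: "\<And>x i. x \<in> I \<Longrightarrow> comp x i \<in> I"
  shows "graded_module R G (emb_module R I, emb_grading G \<zero> I)"
proof -
  interpret I: ideal I R by (rule I)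
  interpret E: module R "emb_module R I" by (rule module_emb[OF I])
  let ?E = "emb_module R I" and ?D = "emb_grading G \<zero> I"
  have D_elem: "\<exists>r\<in>I. U = emb r \<and> (if i < 0 then r = \<zero> else r \<in> G (nat i))" if "U \<in> ?D i" for U i
    using that by (auto simp: emb_grading_def split: if_splits)
  have D_mem: "emb r \<in> ?D i" if "r \<in> I" "if i < 0 then r = \<zero> else r \<in> G (nat i)" for r i
    using that by (auto simp: emb_grading_def)
  have sub: "additive_subgroup (?D i) ?E" for i
  proof (rule additive_subgroupI, rule E.M.add.subgroupI)
    show "?D i \<subseteq> carrier ?E" by (auto simp: emb_grading_def)
    have "emb \<zero> \<in> ?D i" by (rule D_mem) auto
    then show "?D i \<noteq> {}" by blast
    fix U assume "U \<in> ?D i"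
    then obtain r where r: "r \<in> I" "U = emb r" "if i < 0 then r = \<zero> else r \<in> G (nat i)" using D_elem by blast
    have "\<ominus>\<^bsub>?E\<^esub> U = emb (\<ominus> r)"
      using r I.Icarr[OF r(1)] by (intro E.M.minus_equality) (auto simp: l_neg)
    moreover have "emb (\<ominus> r) \<in> ?D i" using r by (intro D_mem) auto
    ultimately show "\<ominus>\<^bsub>?E\<^esub> U \<in> ?D i" by simp
    fix Y assume "Y \<in> ?D i"
    then obtain s where s: "s \<in> I" "Y = emb s" "if i < 0 then s = \<zero> else s \<in> G (nat i)" using D_elem by blast
    have "U \<oplus>\<^bsub>?E\<^esub> Y = emb (r \<oplus> s)" using r s by simp
    moreover have "emb (r \<oplus> s) \<in> ?D i" using r s by (intro D_mem) auto
    ultimately show "U \<oplus>\<^bsub>?E\<^esub> Y \<in> ?D i" by simp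
  qed
  have decomp: "\<exists>!c. (\<forall>i. c i \<in> ?D i) \<and> finite {i. c i \<noteq> \<zero>\<^bsub>?E\<^esub>} \<and> U = (\<Oplus>\<^bsub>?E\<^esub> i\<in>{i. c i \<noteq> \<zero>\<^bsub>?E\<^esub>}. c i)"
    if "U \<in> carrier ?E" for U
  proof -
    obtain x where x: "x \<in> I" "U = emb x" using \<open>U \<in> carrier ?E\<close> by auto
    have xR: "x \<in> carrier R" using I.Icarr[OF x(1)] .
    have inj: "inj_on int A" for A by simp
    have val: "(\<Oplus>\<^bsub>?E\<^esub> i\<in>int ` A. emb (g (nat i))) = emb (\<Oplus>j\<in>A. g j)"
      if A: "finite A" and g: "\<And>j. g j \<in> I" for A and g :: "nat \<Rightarrow> 'a"
    proof -
      have "(\<Oplus>\<^bsub>?E\<^esub> i\<in>int ` A. emb (g (nat i))) = (\<Oplus>\<^bsub>?E\<^esub> j\<in>A. emb (g (nat (int j))))"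
        using g by (intro E.M.finsum_reindex[OF _ inj]) auto
      then show ?thesis using finsum_emb[OF I A, of g] g by simp
    qed
    define c where "c i = (if i < 0 then emb \<zero> else emb (comp x (nat i)))" for i :: int
    have supp: "{i. c i \<noteq> \<zero>\<^bsub>?E\<^esub>} = int ` {j. comp x j \<noteq> \<zero>}"
    proof (intro equalityI subsetI)
      fix i assume "i \<in> {i. c i \<noteq> \<zero>\<^bsub>?E\<^esub>}"
      then have "\<not> i < 0" "comp x (nat i) \<noteq> \<zero>" by (auto simp: c_def emb_inj split: if_splits)
      then show "i \<in> int ` {j. comp x j \<noteq> \<zero>}" by (intro image_eqI[of _ _ "nat i"]) auto
    qed (auto simp: c_def emb_inj)
    show ?thesis
    proof (rule ex1I[of _ c], intro conjI allI)
      show "c i \<in> ?D i" for i using D_mem[of "comp x (nat i)" i] D_mem[of \<zero> i] hom[OF x(1)] xR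
        by (auto simp: c_def)
      show "finite {i. c i \<noteq> \<zero>\<^bsub>?E\<^esub>}" unfolding supp using finite_comp[OF xR] by simp
      have "(\<Oplus>\<^bsub>?E\<^esub> i\<in>{i. c i \<noteq> \<zero>\<^bsub>?E\<^esub>}. c i) = (\<Oplus>\<^bsub>?E\<^esub> i\<in>int ` {j. comp x j \<noteq> \<zero>}. emb (comp x (nat i)))"
        unfolding supp using hom[OF x(1)] by (intro E.M.finsum_cong') (auto simp: c_def)
      also have "\<dots> = emb (\<Oplus>j\<in>{j. comp x j \<noteq> \<zero>}. comp x j)"
        by (rule val[OF finite_comp[OF xR] hom[OF x(1)]])
      finally show "U = (\<Oplus>\<^bsub>?E\<^esub> i\<in>{i. c i \<noteq> \<zero>\<^bsub>?E\<^esub>}. c i)" using sum_comp[OF xR] x(2) by simp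
    next
      fix c' assume c': "(\<forall>i. c' i \<in> ?D i) \<and> finite {i. c' i \<noteq> \<zero>\<^bsub>?E\<^esub>} \<and>
        U = (\<Oplus>\<^bsub>?E\<^esub> i\<in>{i. c' i \<noteq> \<zero>\<^bsub>?E\<^esub>}. c' i)"
      then have "\<forall>i. \<exists>r. r \<in> I \<and> c' i = emb r \<and> (if i < 0 then r = \<zero> else r \<in> G (nat i))"
        using D_elem by blast
      then obtain g where g0: "\<forall>i. g i \<in> I \<and> c' i = emb (g i) \<and> (if i < 0 then g i = \<zero> else g i \<in> G (nat i))"
        by (rule choice[THEN exE])
      have g: "g i \<in> I" "c' i = emb (g i)" "i < 0 \<Longrightarrow> g i = \<zero>" "\<not> i < 0 \<Longrightarrow> g i \<in> G (nat i)" for i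
      proof -
        note gi = g0[THEN spec, of i]
        show "g i \<in> I" using gi by (rule conjunct1)
        show "c' i = emb (g i)" using gi by (elim conjE)
        show "g i = \<zero>" if "i < 0" using conjunct2[OF conjunct2[OF gi]] unfolding if_P[OF that] .
        show "g i \<in> G (nat i)" if "\<not> i < 0" using conjunct2[OF conjunct2[OF gi]] unfolding if_not_P[OF that] .
      qed
      let ?B = "{j. g (int j) \<noteq> \<zero>}"
      have supp': "{i. c' i \<noteq> \<zero>\<^bsub>?E\<^esub>} = int ` ?B"
      proof (intro equalityI subsetI)
        fix i assume "i \<in> {i. c' i \<noteq> \<zero>\<^bsub>?E\<^esub>}"
        then have "c' i \<noteq> emb \<zero>" by simp
        then have "g i \<noteq> \<zero>" unfolding g(2) by (rule contrapos_nn) (rule arg_cong)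
        moreover have "\<not> i < 0" using g(3)[of i] calculation by blast
        ultimately show "i \<in> int ` ?B" by (intro image_eqI[of _ _ "nat i"]) auto
      next
        fix i assume "i \<in> int ` ?B"
        then have "g i \<noteq> \<zero>" by auto
        then have "emb (g i) \<noteq> emb \<zero>" by (simp add: emb_inj)
        then show "i \<in> {i. c' i \<noteq> \<zero>\<^bsub>?E\<^esub>}" using g(2)[of i] by simp
      qed
      have fin: "finite ?B" using c' unfolding supp' by (simp add: finite_image_iff)
      have "U = (\<Oplus>\<^bsub>?E\<^esub> i\<in>int ` ?B. emb (g (int (nat i))))"
      proof -
        have "U = (\<Oplus>\<^bsub>?E\<^esub> i\<in>int ` ?B. c' i)" using c' unfolding supp' by blast
        also have "\<dots> = (\<Oplus>\<^bsub>?E\<^esub> i\<in>int ` ?B. emb (g (int (nat i))))"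
          by (rule E.M.finsum_cong') (use g(1,2) in auto)
        finally show ?thesis .
      qed
      also have "\<dots> = emb (\<Oplus>j\<in>?B. g (int j))"
        by (rule val[OF fin]) (use g in blast)
      finally have "x = (\<Oplus>j\<in>?B. g (int j))" using x(2) by (simp add: emb_inj)
      moreover have "g (int j) \<in> G j" for j using g(4)[of "int j"] by simp
      ultimately have cx: "comp x = (\<lambda>j. g (int j))" using fin by (intro comp_eqI[of ?B]) auto
      show "c' = c"
      proof
        fix i show "c' i = c i"
        proof (cases "i < 0")
          case False
          then have "g i = comp x (nat i)" by (simp add: cx)
          then show ?thesis using g(2)[of i] False by (simp add: c_def)
        qed (use g(2,3)[of i] in \<open>simp add: c_def\<close>)
      qed
    qed
  qed
  have smult: "a \<odot>\<^bsub>?E\<^esub> U \<in> ?D (int i + j)" if a: "a \<in> G i" and U: "U \<in> ?D j" for a U i j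
  proof -
    obtain r where r: "r \<in> I" "U = emb r" "if j < 0 then r = \<zero> else r \<in> G (nat j)" using D_elem[OF U] by blast
    have "emb (a \<otimes> r) \<in> ?D (int i + j)"
    proof (rule D_mem)
      show "a \<otimes> r \<in> I" using I.I_l_closed[OF r(1)] a by simp
      show "if int i + j < 0 then a \<otimes> r = \<zero> else a \<otimes> r \<in> G (nat (int i + j))"
      proof (cases "j < 0")
        case False
        then have "nat (int i + j) = i + nat j" by simp
        then show ?thesis using mult_G[OF a, of r "nat j"] r(3) False by simp
      next
        case True
        then have "a \<otimes> r = \<zero>" using r(3) G_carrier[OF a] by simp
        then show ?thesis by simp
      qed
    qed
    then show ?thesis using r(2) by simp
  qed
  show ?thesis
    unfolding graded_module.simps internal_direct_sum_def
  proof (intro conjI allI ballI)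
    show "module R ?E" by (rule E.module_axioms)
  qed (fact sub decomp smult)+
qed

subsection \<open>Ideals generated by two linear forms\<close>

definition ideal2 where "ideal2 z h = {a \<otimes> z \<oplus> b \<otimes> h | a b. a \<in> carrier R \<and> b \<in> carrier R}"

lemma ideal_ideal2:
  assumes "z \<in> carrier R" "h \<in> carrier R" shows "ideal (ideal2 z h) R"
proof -
  have "ideal2 z h = {p \<oplus> r \<otimes> h | p r. p \<in> PIdl z \<and> r \<in> carrier R}"
    unfolding ideal2_def cgenideal_def by blast
  then show ?thesis using ideal_adjoin(1)[OF cgenideal_ideal[OF assms(1)] assms(2)] by simp
qed

lemma ideal2I: "a \<in> carrier R \<Longrightarrow> b \<in> carrier R \<Longrightarrow> a \<otimes> z \<oplus> b \<otimes> h \<in> ideal2 z h"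
  unfolding ideal2_def by blast

lemma ideal2_cases:
  assumes "x \<in> ideal2 z h"
  obtains a b where "a \<in> carrier R" "b \<in> carrier R" "x = a \<otimes> z \<oplus> b \<otimes> h"
  using assms unfolding ideal2_def by blast

lemma generators_ideal2:
  assumes "z \<in> carrier R" "h \<in> carrier R" shows "z \<in> ideal2 z h" "h \<in> ideal2 z h"
proof -
  have "z = \<one> \<otimes> z \<oplus> \<zero> \<otimes> h" "h = \<zero> \<otimes> z \<oplus> \<one> \<otimes> h" using assms by simp_all
  then show "z \<in> ideal2 z h" "h \<in> ideal2 z h" using ideal2I[of \<one> \<zero> z h] ideal2I[of \<zero> \<one> z h] by simp_all
qed

lemma G1_m: "z \<in> G 1 \<Longrightarrow> z \<in> \<mm>"
  using G1_irrelevant by blast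

lemma comp_linear_combination:
  assumes "z \<in> G 1" "h \<in> G 1" "a \<in> carrier R" "b \<in> carrier R"
  shows "comp (a \<otimes> z \<oplus> b \<otimes> h) 0 = \<zero>"
    and "comp (a \<otimes> z \<oplus> b \<otimes> h) (Suc i) = comp a i \<otimes> z \<oplus> comp b i \<otimes> h"
proof -
  have c: "z \<in> carrier R" "h \<in> carrier R" using assms by (auto intro: G_carrier)
  have "comp (a \<otimes> z \<oplus> b \<otimes> h) j = comp (z \<otimes> a) j \<oplus> comp (h \<otimes> b) j" for j
    using comp_add[of "a \<otimes> z" "b \<otimes> h"] c assms by (simp add: m_comm)
  then show "comp (a \<otimes> z \<oplus> b \<otimes> h) 0 = \<zero>"
    "comp (a \<otimes> z \<oplus> b \<otimes> h) (Suc i) = comp a i \<otimes> z \<oplus> comp b i \<otimes> h"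
    using comp_homogeneous_mult[OF assms(1,3)] comp_homogeneous_mult[OF assms(2,4)] c assms(3,4)
    by (simp_all add: m_comm)
qed

lemma comp_ideal2:
  assumes "z \<in> G 1" "h \<in> G 1" "x \<in> ideal2 z h"
  shows "comp x i \<in> ideal2 z h"
proof -
  obtain a b where x: "a \<in> carrier R" "b \<in> carrier R" "x = a \<otimes> z \<oplus> b \<otimes> h"
    using assms(3) by (rule ideal2_cases)
  have c: "z \<in> carrier R" "h \<in> carrier R" using assms by (auto intro: G_carrier)
  show ?thesis
  proof (cases i)
    case 0
    then show ?thesis unfolding x(3) using comp_linear_combination(1)[OF assms(1,2) x(1,2)]
      ideal2I[of \<zero> \<zero> z h] c by simp
  next
    case (Suc j)
    then show ?thesis unfolding x(3) using comp_linear_combination(2)[OF assms(1,2) x(1,2)]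
      ideal2I[of "comp a j" "comp b j" z h] x by simp
  qed
qed

lemma ideal2_irrelevant:
  assumes "z \<in> G 1" "h \<in> G 1" shows "ideal2 z h \<subseteq> \<mm>"
proof
  fix x assume "x \<in> ideal2 z h"
  then obtain a b where x: "a \<in> carrier R" "b \<in> carrier R" "x = a \<otimes> z \<oplus> b \<otimes> h" by (rule ideal2_cases)
  show "x \<in> \<mm>" unfolding x(3)
    using comp_linear_combination(1)[OF assms x(1,2)] x assms[THEN G_carrier] by (intro irrelevantI) simp_all
qed

lemma ideal2_degree_1:
  assumes "z \<in> G 1" "h \<in> G 1" "x \<in> ideal2 z h"
  obtains p q where "p \<in> G 0" "q \<in> G 0" "comp x 1 = p \<otimes> z \<oplus> q \<otimes> h"
proof -
  obtain a b where x: "a \<in> carrier R" "b \<in> carrier R" "x = a \<otimes> z \<oplus> b \<otimes> h"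
    using assms(3) by (rule ideal2_cases)
  show thesis
    using that[of "comp a 0" "comp b 0"] comp_linear_combination(2)[OF assms(1,2) x(1,2), of 0] x by simp
qed

abbreviation "mod2 z h \<equiv> emb_module R (ideal2 z h)"
abbreviation "gmod2 z h \<equiv> (mod2 z h, emb_grading G \<zero> (ideal2 z h))"

lemma graded_gmod2:
  assumes "z \<in> G 1" "h \<in> G 1" shows "graded_module R G (gmod2 z h)"
  using graded_emb[OF ideal_ideal2 comp_ideal2] assms[THEN G_carrier] assms by blast

lemma finitely_generated_mod2:
  assumes "z \<in> G 1" "h \<in> G 1" shows "finitely_generated_module R (mod2 z h)"
proof -
  note c = assms[THEN G_carrier]
  note I = ideal_ideal2[OF c]
  interpret E: module R "mod2 z h" by (rule module_emb[OF I])
  have "carrier (mod2 z h) \<subseteq> H" if H: "submodule H R (mod2 z h)" "{emb z, emb h} \<subseteq> H" for H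
  proof
    fix U assume "U \<in> carrier (mod2 z h)"
    then obtain x where "x \<in> ideal2 z h" and U: "U = emb x" by auto
    then obtain a b where x: "a \<in> carrier R" "b \<in> carrier R" "x = a \<otimes> z \<oplus> b \<otimes> h"
      using ideal2_cases by blast
    have "emb z \<in> H" "emb h \<in> H" using H(2) by auto
    then have "a \<odot>\<^bsub>mod2 z h\<^esub> emb z \<in> H" "b \<odot>\<^bsub>mod2 z h\<^esub> emb h \<in> H"
      using E.submoduleE(4)[OF H(1)] x(1,2) by blast+
    then have "a \<odot>\<^bsub>mod2 z h\<^esub> emb z \<oplus>\<^bsub>mod2 z h\<^esub> b \<odot>\<^bsub>mod2 z h\<^esub> emb h \<in> H"
      by (rule E.submoduleE(5)[OF H(1)])
    then show "U \<in> H" using x(3) U by simp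
  qed
  then have 1: "carrier (mod2 z h) \<subseteq> generated_submodule R (mod2 z h) {emb z, emb h}"
    unfolding generated_submodule_def by (intro Inter_greatest) simp
  have g: "{emb z, emb h} \<subseteq> carrier (mod2 z h)" using generators_ideal2[OF c] by auto
  have "generated_submodule R (mod2 z h) {emb z, emb h} \<subseteq> carrier (mod2 z h)"
    by (rule generated_submodule_least[OF E.carrier_is_submodule g])
  with 1 have "generated_submodule R (mod2 z h) {emb z, emb h} = carrier (mod2 z h)"
    by (rule subset_antisym[rotated])
  then show ?thesis
    unfolding finitely_generated_module_def
    by (intro conjI E.module_axioms exI[of _ "{emb z, emb h}"] g) simp_all
qed

text \<open>The sequence \<open>z\<close> is regular. Suppose that \<open>x, y \<in> \<mm>\<close> begin a regular sequence on the ideal \<open>I = (z, h)\<close>; then \<open>x\<close>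
  is a nonzerodivisor of \<open>R\<close>. If \<open>s y\<^sup>n \<in> x R\<close> for some \<open>s \<notin> \<mm>\<close>, then regularity of \<open>y\<close> modulo \<open>x I\<close> yields
  \<open>s z \<in> x I\<close>, although elements of \<open>x I\<close> have no linear part. Otherwise some prime \<open>P \<subset> \<mm>\<close> contains \<open>x\<close> but
  not \<open>y\<close>, and inside \<open>P\<close> there is a prime missing the nonzerodivisor \<open>x\<close>; this chain is too long for
  dimension one.\<close>

lemma depth_mod2:
  assumes dim: "krull_dim R = 1" and z: "z \<in> G 1" "nonzerodivisor z" and h: "h \<in> G 1"
  shows "depth R \<mm> (mod2 z h) = 1"
proof -
  note c = G_carrier[OF z(1)] G_carrier[OF h]
  let ?I = "ideal2 z h"
  note I = ideal_ideal2[OF c]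
  interpret I: ideal ?I R by (rule I)
  interpret E: module R "mod2 z h" by (rule module_emb[OF I])
  interpret m: primeideal \<mm> R by (rule prime_irrelevant)
  note mIdeal = m.is_ideal
  have z0: "z \<noteq> \<zero>" using z(2) one_nz by (auto simp: nonzerodivisor_def)
  have nil: "seq_smult R (mod2 z h) [] = {emb \<zero>}" using seq_smult_Nil[OF E.module_axioms] by simp
  \<comment> \<open>a proper submodule containing \<open>\<mm> I\<close>; it replaces an appeal to Nakayama's lemma\<close>
  let ?T = "{x \<in> ?I. comp x 1 = \<zero>}"
  have T: "ideal ?T R"
  proof (rule idealI')
    fix r x assume r: "r \<in> carrier R" and x: "x \<in> ?T"
    then have xm: "x \<in> \<mm>" using ideal2_irrelevant[OF z(1) h] by blast
    have "comp (r \<otimes> x) 1 = \<zero>" using comp1_mult_irrelevant[OF r xm] x r by simp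
    then show "r \<otimes> x \<in> ?T" using I.I_l_closed[of x r] x r by simp
    then show "x \<otimes> r \<in> ?T" using m_comm[OF r irrelevant_carrier[OF xm]] by simp
  qed (use I.a_subset I.Icarr in \<open>auto simp: comp_add\<close>)
  have T_sub: "submodule (emb ` ?T) R (mod2 z h)" by (rule submodule_emb_iff[OF I _ T]) blast
  have xM: "seq_smult R (mod2 z h) xs \<subseteq> emb ` ?T" if xs: "set xs \<subseteq> \<mm>" for xs
    unfolding seq_smult_def
  proof (rule generated_submodule_least[OF T_sub], rule subsetI)
    fix U assume "U \<in> {x \<odot>\<^bsub>mod2 z h\<^esub> m |x m. x \<in> set xs \<and> m \<in> carrier (mod2 z h)}"
    then obtain x y where x: "x \<in> \<mm>" "y \<in> ?I" "U = emb (x \<otimes> y)" using xs by auto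
    have "comp x 0 = \<zero>" using irrelevantD x(1) by blast
    then have "comp (x \<otimes> y) 1 = \<zero>"
      using comp1_mult_irrelevant[of x y] ideal2_irrelevant[OF z(1) h] x irrelevant_carrier I.Icarr[OF x(2)] by auto
    then show "U \<in> emb ` ?T" using x I.I_l_closed[OF x(2) irrelevant_carrier[OF x(1)]] by blast
  qed
  have zT: "emb z \<notin> emb ` ?T" using z0 z(1) by (auto simp: emb_inj)
  have zI: "emb z \<in> carrier (mod2 z h)" using generators_ideal2[OF c] by simp
  have "regular_sequence R (mod2 z h) [z]"
    unfolding regular_sequence_def
  proof (intro conjI allI impI ballI)
    show "set [z] \<subseteq> carrier R" using c by simp
    fix i U assume i: "i < length [z]" and U: "U \<in> carrier (mod2 z h)"
      and zX: "[z] ! i \<odot>\<^bsub>mod2 z h\<^esub> U \<in> seq_smult R (mod2 z h) (take i [z])"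
    obtain x where x: "x \<in> ?I" "U = emb x" using U by auto
    have "z \<otimes> x = \<zero>" using zX i x nil by (simp add: emb_inj)
    then have "x = \<zero>" using z(2) I.Icarr[OF x(1)] by (simp add: nonzerodivisor_def)
    then show "U \<in> seq_smult R (mod2 z h) (take i [z])" using i x nil by simp
  next
    show "seq_smult R (mod2 z h) [z] \<noteq> carrier (mod2 z h)"
    proof -
      have "seq_smult R (mod2 z h) [z] \<subseteq> emb ` ?T" using xM[of "[z]"] G1_m[OF z(1)] by simp
      then show ?thesis using zT zI by blast
    qed
  qed
  then have "enat (length [z]) \<le> depth R \<mm> (mod2 z h)"
    unfolding depth_def using G1_m[OF z(1)] by (intro Sup_upper) fastforce
  then have ge: "1 \<le> depth R \<mm> (mod2 z h)" by (simp add: one_enat_def)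
  have "length xs \<le> 1" if xs: "set xs \<subseteq> \<mm>" "regular_sequence R (mod2 z h) xs" for xs
  proof (rule ccontr)
    assume "\<not> length xs \<le> 1"
    then have len: "0 < length xs" "1 < length xs" by auto
    define x y where "x = xs ! 0" and "y = xs ! 1"
    have xm: "x \<in> \<mm>" "y \<in> \<mm>" using xs(1) len by (auto simp: x_def y_def)
    note xR = irrelevant_carrier[OF xm(1)] and yR = irrelevant_carrier[OF xm(2)]
    have take1: "take 1 xs = [x]" using len by (cases xs) (auto simp: x_def)
    have reg0: "w = \<zero>" if w: "w \<in> ?I" "x \<otimes> w = \<zero>" for w
    proof -
      have "xs ! 0 \<odot>\<^bsub>mod2 z h\<^esub> emb w \<in> seq_smult R (mod2 z h) (take 0 xs)" using w nil by (simp add: x_def)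
      then have "emb w \<in> seq_smult R (mod2 z h) (take 0 xs)"
        using xs(2) len(1) w(1) unfolding regular_sequence_def by (metis emb_module_simps(1) imageI)
      then show ?thesis using nil by (simp add: emb_inj)
    qed
    have reg1: "emb w \<in> seq_smult R (mod2 z h) [x]" if w: "w \<in> ?I" "emb (y \<otimes> w) \<in> seq_smult R (mod2 z h) [x]" for w
    proof -
      have "xs ! 1 \<odot>\<^bsub>mod2 z h\<^esub> emb w \<in> seq_smult R (mod2 z h) (take 1 xs)"
        unfolding take1 using w by (simp add: y_def)
      then have "emb w \<in> seq_smult R (mod2 z h) (take 1 xs)"
        using xs(2) len(2) w(1) unfolding regular_sequence_def by (metis emb_module_simps(1) imageI)
      then show ?thesis unfolding take1 .
    qed
    have xnzd: "nonzerodivisor x"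
      unfolding nonzerodivisor_def
    proof (intro conjI ballI impI xR)
      fix r assume r: "r \<in> carrier R" "x \<otimes> r = \<zero>"
      have "x \<otimes> (r \<otimes> z) = \<zero>" using r c xR by (simp add: m_assoc[symmetric])
      then have "r \<otimes> z = \<zero>" using reg0[of "r \<otimes> z"] I.I_l_closed[OF generators_ideal2(1)[OF c] r(1)] by blast
      then have "z \<otimes> r = \<zero>" using m_comm[OF r(1) c(1)] by simp
      then show "r = \<zero>" using z(2) r(1) by (simp add: nonzerodivisor_def)
    qed
    have key: False if *: "s \<in> carrier R" "s \<notin> \<mm>" "r \<in> carrier R" "s \<otimes> y [^] (n::nat) = x \<otimes> r" for s r n
    proof -
      have "emb (y [^] k \<otimes> (s \<otimes> z)) \<in> seq_smult R (mod2 z h) [x]" if "k \<le> n" for k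
        using that
      proof (induction rule: inc_induct)
        case base
        have "y [^] n \<otimes> (s \<otimes> z) = (s \<otimes> y [^] n) \<otimes> z" using *(1) yR c by (simp add: m_ac)
        also have "\<dots> = x \<otimes> (r \<otimes> z)" unfolding *(4) using xR *(3) c by (simp add: m_assoc)
        finally have "emb (y [^] n \<otimes> (s \<otimes> z)) = x \<odot>\<^bsub>mod2 z h\<^esub> emb (r \<otimes> z)" by simp
        moreover have "emb (r \<otimes> z) \<in> carrier (mod2 z h)"
          using I.I_l_closed[OF generators_ideal2(1)[OF c] *(3)] by simp
        ultimately have "emb (y [^] n \<otimes> (s \<otimes> z)) \<in> {v \<odot>\<^bsub>mod2 z h\<^esub> m |v m. v \<in> set [x] \<and> m \<in> carrier (mod2 z h)}"
          by (auto simp del: emb_module_simps)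
        then show ?case unfolding seq_smult_def by (rule subsetD[OF generated_submodule_incl])
      next
        case (step k)
        have yk: "y [^] k \<in> carrier R" "s \<otimes> z \<in> carrier R" using yR *(1) c by simp_all
        have "y \<otimes> (y [^] k \<otimes> (s \<otimes> z)) = y [^] Suc k \<otimes> (s \<otimes> z)"
          using m_assoc[OF yR yk] m_comm[OF yR yk(1)] by simp
        moreover have "y [^] k \<otimes> (s \<otimes> z) \<in> ?I"
          using I.I_l_closed[OF I.I_l_closed[OF generators_ideal2(1)[OF c] *(1)] yk(1)] .
        ultimately show ?case using reg1 step.IH by simp
      qed
      from this[of 0] have "emb (s \<otimes> z) \<in> seq_smult R (mod2 z h) [x]" using *(1) c by simp
      then have "emb (s \<otimes> z) \<in> emb ` ?T" using xM[of "[x]"] xm(1) by auto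
      then have "comp (s \<otimes> z) 1 = \<zero>" by (auto simp: emb_inj)
      then have "comp s 0 \<otimes> z = \<zero>" using comp1_mult_irrelevant[OF *(1) G1_m[OF z(1)]] z(1) by simp
      then have "comp s 0 = \<zero>" using G0_mult_eq_zero[OF comp_in[OF *(1)] c(1)] z0 by blast
      then show False using irrelevantI[OF *(1)] *(2) by blast
    qed
    obtain P where P: "primeideal P R" "PIdl x \<subseteq> P" "P \<subseteq> \<mm>" "y \<notin> P"
    proof (rule exists_prime_below_avoiding[OF prime_irrelevant yR cgenideal_ideal[OF xR]])
      fix s and n :: nat assume s: "s \<in> carrier R" "s \<notin> \<mm>"
      show "s \<otimes> y [^] n \<notin> PIdl x"
      proof
        assume "s \<otimes> y [^] n \<in> PIdl x"
        then obtain r where "r \<in> carrier R" "s \<otimes> y [^] n = r \<otimes> x" unfolding cgenideal_def by blast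
        then show False using key[OF s, of r n] m_comm[of r x] xR by simp
      qed
    qed
    interpret P: primeideal P R by (rule P(1))
    have Pm: "P \<subset> \<mm>" using P(3,4) xm(2) by blast
    obtain Q where Q: "primeideal Q R" "{\<zero>} \<subseteq> Q" "Q \<subseteq> P" "x \<notin> Q"
    proof (rule exists_prime_below_avoiding[OF P(1) xR zeroideal])
      fix s and n :: nat assume s: "s \<in> carrier R" "s \<notin> P"
      have "s \<noteq> \<zero>" using s(2) P.zero_closed by blast
      then have "x [^] n \<otimes> s \<noteq> \<zero>" using nonzerodivisor_pow[OF xnzd, of n] s(1) by (auto simp: nonzerodivisor_def)
      then show "s \<otimes> x [^] n \<notin> {\<zero>}" using m_comm[OF s(1), of "x [^] n"] xR by simp
    qed
    moreover have "x \<in> P" using P(2) cgenideal_self[OF xR] by blast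
    ultimately have "Q \<subset> P" by blast
    then show False using krull_dim_ge_2[OF Q(1) P(1) prime_irrelevant _ Pm] dim by blast
  qed
  then have "depth R \<mm> (mod2 z h) \<le> 1"
    unfolding depth_def one_enat_def by (intro Sup_least) auto
  then show ?thesis using ge by (rule antisym)
qed

end

section \<open>A one-parameter family of ideals\<close>

lemma additive_map_finsum:
  assumes M: "abelian_group M" and N: "abelian_group N"
    and \<psi>: "\<And>x. x \<in> carrier M \<Longrightarrow> \<psi> x \<in> carrier N"
      "\<And>x y. x \<in> carrier M \<Longrightarrow> y \<in> carrier M \<Longrightarrow> \<psi> (x \<oplus>\<^bsub>M\<^esub> y) = \<psi> x \<oplus>\<^bsub>N\<^esub> \<psi> y"
      "\<psi> \<zero>\<^bsub>M\<^esub> = \<zero>\<^bsub>N\<^esub>"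
    and f: "finite A" "\<And>i. i \<in> A \<Longrightarrow> f i \<in> carrier M"
  shows "\<psi> (\<Oplus>\<^bsub>M\<^esub>i\<in>A. f i) = (\<Oplus>\<^bsub>N\<^esub>i\<in>A. \<psi> (f i))"
proof -
  interpret M: abelian_group M by (rule M)
  interpret N: abelian_group N by (rule N)
  show ?thesis using f
  proof (induction A rule: finite_induct)
    case empty
    show ?case by (simp only: M.finsum_empty N.finsum_empty \<psi>(3))
  next
    case (insert a A)
    have "\<psi> (\<Oplus>\<^bsub>M\<^esub>i\<in>insert a A. f i) = \<psi> (f a \<oplus>\<^bsub>M\<^esub> (\<Oplus>\<^bsub>M\<^esub>i\<in>A. f i))"
      using insert by (subst M.finsum_insert) auto
    also have "\<dots> = \<psi> (f a) \<oplus>\<^bsub>N\<^esub> (\<Oplus>\<^bsub>N\<^esub>i\<in>A. \<psi> (f i))"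
      using insert by (subst \<psi>(2)) (auto intro: M.finsum_closed)
    also have "\<dots> = (\<Oplus>\<^bsub>N\<^esub>i\<in>insert a A. \<psi> (f i))"
      using insert \<psi>(1) by (intro N.finsum_insert[symmetric]) auto
    finally show ?case .
  qed
qed

text \<open>The target \<open>N\<close> is an arbitrary record: in the definition of countable type the list of representatives is not
  restricted to modules. The module laws for the composite are therefore checked after applying \<open>h2\<close>.\<close>

lemma module_hom_between_isomorphic:
  assumes h1: "h1 \<in> module_hom R M N" "bij_betw h1 (carrier M) (carrier N)"
    and h2: "h2 \<in> module_hom R M' N" "bij_betw h2 (carrier M') (carrier N)"
    and M: "module R M" and M': "module R M'"
  obtains \<phi> where "\<phi> \<in> module_hom R M M'" "\<phi> ` carrier M = carrier M'"
proof -
  interpret M: module R M by (rule M)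
  interpret M': module R M' by (rule M')
  define \<phi> where "\<phi> x = inv_into (carrier M') h2 (h1 x)" for x
  have bij: "bij_betw \<phi> (carrier M) (carrier M')"
    unfolding \<phi>_def using bij_betw_trans[OF h1(2) bij_betw_inv_into[OF h2(2)]] by (simp add: comp_def)
  have in': "\<phi> x \<in> carrier M'" if "x \<in> carrier M" for x using bij that by (auto simp: bij_betw_def)
  have h2\<phi>: "h2 (\<phi> x) = h1 x" if "x \<in> carrier M" for x
    unfolding \<phi>_def using h1(2) h2(2) that by (intro f_inv_into_f) (auto simp: bij_betw_def)
  have eqI: "\<phi> x = y" if "x \<in> carrier M" "y \<in> carrier M'" "h1 x = h2 y" for x y
    using h2\<phi>[OF that(1)] in'[OF that(1)] that h2(2) by (auto simp: bij_betw_def inj_on_def)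
  have "\<phi> \<in> module_hom R M M'"
    unfolding module_hom_def
  proof (intro CollectI conjI ballI)
    show "\<phi> \<in> carrier M \<rightarrow> carrier M'" using in' by auto
  next
    fix x y assume xy: "x \<in> carrier M" "y \<in> carrier M"
    show "\<phi> (x \<oplus>\<^bsub>M\<^esub> y) = \<phi> x \<oplus>\<^bsub>M'\<^esub> \<phi> y"
      using module_homD(2)[OF h1(1) xy] module_homD(2)[OF h2(1) in'[OF xy(1)] in'[OF xy(2)]]
        h2\<phi>[OF xy(1)] h2\<phi>[OF xy(2)] xy in' by (intro eqI) auto
  next
    fix a x assume ax: "a \<in> carrier R" "x \<in> carrier M"
    show "\<phi> (a \<odot>\<^bsub>M\<^esub> x) = a \<odot>\<^bsub>M'\<^esub> \<phi> x"
      using module_homD(3)[OF h1(1) ax] module_homD(3)[OF h2(1) ax(1) in'[OF ax(2)]]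
        h2\<phi>[OF ax(2)] ax in' by (intro eqI) auto
  qed
  then show thesis using that bij by (auto simp: bij_betw_def)
qed

context standard_graded
begin

lemma mult_mem_PIdl: "z \<in> carrier R \<Longrightarrow> t \<in> carrier R \<Longrightarrow> t \<otimes> z \<in> PIdl z" "z \<in> carrier R \<Longrightarrow> t \<in> carrier R \<Longrightarrow> z \<otimes> t \<in> PIdl z"
  unfolding cgenideal_def using m_comm by blast+

definition closed_products where
  "closed_products z f g \<longleftrightarrow> f \<otimes> f \<in> PIdl z \<and> f \<otimes> g \<in> PIdl z \<and> g \<otimes> g \<in> PIdl z"

lemma closed_products_span:
  assumes "closed_products z u v" and R: "z \<in> carrier R" "u \<in> carrier R" "v \<in> carrier R"
    "t \<in> carrier R" "a \<in> carrier R" "b \<in> carrier R" "t' \<in> carrier R" "a' \<in> carrier R" "b' \<in> carrier R"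
  shows "(t \<otimes> z \<oplus> a \<otimes> u \<oplus> b \<otimes> v) \<otimes> (t' \<otimes> z \<oplus> a' \<otimes> u \<oplus> b' \<otimes> v) \<in> PIdl z"
proof -
  interpret Z: ideal "PIdl z" R by (rule cgenideal_ideal[OF R(1)])
  define w w' where "w = a \<otimes> u \<oplus> b \<otimes> v" and "w' = a' \<otimes> u \<oplus> b' \<otimes> v"
  have wR: "w \<in> carrier R" "w' \<in> carrier R" unfolding w_def w'_def using R by simp_all
  have "w \<otimes> w' = (a \<otimes> a') \<otimes> (u \<otimes> u) \<oplus> ((a \<otimes> b' \<oplus> b \<otimes> a') \<otimes> (u \<otimes> v) \<oplus> (b \<otimes> b') \<otimes> (v \<otimes> v))"
    unfolding w_def w'_def using R by algebra
  moreover have "(a \<otimes> a') \<otimes> (u \<otimes> u) \<in> PIdl z" "(a \<otimes> b' \<oplus> b \<otimes> a') \<otimes> (u \<otimes> v) \<in> PIdl z"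
    "(b \<otimes> b') \<otimes> (v \<otimes> v) \<in> PIdl z"
    using assms(1) R unfolding closed_products_def by (simp_all add: Z.I_l_closed)
  ultimately have ww': "w \<otimes> w' \<in> PIdl z" by simp
  have "(t \<otimes> z \<oplus> w) \<otimes> (t' \<otimes> z \<oplus> w') = (t \<otimes> (t' \<otimes> z \<oplus> w') \<oplus> t' \<otimes> w) \<otimes> z \<oplus> w \<otimes> w'"
    using R wR by algebra
  also have "\<dots> \<in> PIdl z"
    by (rule Z.a_closed[OF mult_mem_PIdl(1)[OF R(1)] ww']) (use R wR in simp_all)
  finally show ?thesis using R by (simp add: w_def w'_def a_assoc)
qed

definition not_spanned where
  "not_spanned z \<longleftrightarrow> (\<forall>x\<in>G 1. \<exists>y\<in>G 1. \<forall>a\<in>G 0. \<forall>b\<in>G 0. y \<noteq> a \<otimes> z \<oplus> b \<otimes> x)"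

lemma extend_independent:
  assumes "not_spanned z" "z \<in> G 1" "z \<noteq> \<zero>" "x \<in> G 1" "\<And>a. a \<in> G 0 \<Longrightarrow> x \<noteq> a \<otimes> z"
  obtains y where "y \<in> G 1" "independent3 z x y"
proof -
  obtain y where y: "y \<in> G 1" "\<forall>a\<in>G 0. \<forall>b\<in>G 0. y \<noteq> a \<otimes> z \<oplus> b \<otimes> x"
    using assms(1,4) unfolding not_spanned_def by blast
  then show thesis using that independent3I[OF assms(2,4) y(1) assms(3,5)] by blast
qed

lemma exists_independent3:
  assumes "not_spanned z" "z \<in> G 1" "z \<noteq> \<zero>"
  obtains x y where "x \<in> G 1" "y \<in> G 1" "independent3 z x y"
proof -
  obtain x where x: "x \<in> G 1" "\<forall>a\<in>G 0. \<forall>b\<in>G 0. x \<noteq> a \<otimes> z \<oplus> b \<otimes> z"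
    using assms(1,2) unfolding not_spanned_def by blast
  have "x \<noteq> a \<otimes> z" if "a \<in> G 0" for a
    using x(2)[THEN bspec, OF that, THEN bspec, of \<zero>] that assms(2)[THEN G_carrier] by simp
  then obtain y where "y \<in> G 1" "independent3 z x y" using extend_independent[OF assms x(1)] by blast
  then show thesis using that x(1) by blast
qed

text \<open>Assume that the products are closed for every independent triple. A linear form \<open>x\<close> outside \<open>k z\<close> can be
  completed to an independent triple, whence \<open>x\<^sup>2 \<in> z R\<close>; a form \<open>y\<close> either lies in the span of \<open>z\<close> and \<open>x\<close> or is
  independent of them, and in both cases \<open>x y \<in> z R\<close>.\<close>

lemma exists_independent_not_closed:
  assumes ns: "not_spanned z" and z: "z \<in> G 1" "z \<noteq> \<zero>"
    and xy: "x \<in> G 1" "y \<in> G 1" "x \<otimes> y \<notin> PIdl z"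
  obtains f g where "f \<in> G 1" "g \<in> G 1" "independent3 z f g" "\<not> closed_products z f g"
proof (rule ccontr)
  assume no: "\<not> thesis"
  have "\<forall>f g. f \<in> G 1 \<longrightarrow> g \<in> G 1 \<longrightarrow> independent3 z f g \<longrightarrow> closed_products z f g"
    using no that by blast
  then have closed: "closed_products z f g" if "f \<in> G 1" "g \<in> G 1" "independent3 z f g" for f g
    using that by blast
  note zR = G_carrier[OF z(1)] and xR = G_carrier[OF xy(1)] and yR = G_carrier[OF xy(2)]
  interpret Z: ideal "PIdl z" R by (rule cgenideal_ideal[OF zR])
  show False
  proof (cases "\<exists>a\<in>G 0. x = a \<otimes> z")
    case True
    then obtain a where a: "a \<in> G 0" "x = a \<otimes> z" by blast
    have "x \<otimes> y = (a \<otimes> y) \<otimes> z" unfolding a(2) using G_carrier[OF a(1)] zR yR by algebra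
    then show False using xy(3) mult_mem_PIdl(1)[OF zR, of "a \<otimes> y"] a(1) yR by simp
  next
    case False
    then obtain g where g: "g \<in> G 1" "independent3 z x g" using extend_independent[OF ns z xy(1)] by blast
    then have xx: "x \<otimes> x \<in> PIdl z" using closed[OF xy(1)] by (simp add: closed_products_def)
    show False
    proof (cases "\<exists>a\<in>G 0. \<exists>b\<in>G 0. y = a \<otimes> z \<oplus> b \<otimes> x")
      case True
      then obtain a b where ab: "a \<in> G 0" "b \<in> G 0" "y = a \<otimes> z \<oplus> b \<otimes> x" by blast
      have "x \<otimes> y = (a \<otimes> x) \<otimes> z \<oplus> b \<otimes> (x \<otimes> x)"
        unfolding ab(3) using ab(1,2)[THEN G_carrier] zR xR by algebra
      also have "\<dots> \<in> PIdl z"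
        by (rule Z.a_closed[OF mult_mem_PIdl(1)[OF zR] Z.I_l_closed[OF xx]])
          (use ab(1,2)[THEN G_carrier] xR in simp_all)
      finally show False using xy(3) by blast
    next
      case no: False
      then have "independent3 z x y" using independent3I[OF z(1) xy(1,2) z(2)] False by blast
      then show False using closed[OF xy(1,2)] xy(3) by (simp add: closed_products_def)
    qed
  qed
qed

text \<open>For \<open>e = p z + q h\<close> the equation \<open>e\<^sup>2 = z e\<close> says that \<open>e/z\<close> is idempotent; if \<open>z\<close> and \<open>h\<close> are independent,
  \<open>q \<noteq> 0\<close> makes this idempotent different from \<open>0\<close> and \<open>1\<close>.\<close>

definition decomposing where
  "decomposing z h \<longleftrightarrow> (\<exists>p\<in>G 0. \<exists>q\<in>G 0. q \<noteq> \<zero> \<and>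
     (p \<otimes> z \<oplus> q \<otimes> h) \<otimes> (p \<otimes> z \<oplus> q \<otimes> h) = z \<otimes> (p \<otimes> z \<oplus> q \<otimes> h))"

text \<open>Put \<open>w = p z + q e + r e'\<close> with \<open>r = q c\<close>. In \<open>w\<^sup>2 = z w\<close> the only term outside \<open>z R\<close> is \<open>2 q r e e'\<close>, so \<open>2 q r = 0\<close>.
  In characteristic two this says nothing about \<open>c\<close>, but after cancelling \<open>z\<close> the coefficients of \<open>e\<close> and
  \<open>e'\<close> give \<open>2 p q + q\<^sup>2 = q\<close> and \<open>2 p r + r\<^sup>2 = r\<close>, hence \<open>q\<^sup>2 c (c - 1) = 0\<close>.\<close>

lemma decomposing_between_idempotents:
  assumes z: "z \<in> G 1" "nonzerodivisor z" and e: "e \<in> G 1" "e \<otimes> e = z \<otimes> e" "e' \<in> G 1" "e' \<otimes> e' = z \<otimes> e'"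
    and ind: "independent3 z e e'" and nc: "\<not> closed_products z e e'"
    and c: "c \<in> G 0" and dec: "decomposing z (e \<oplus> c \<otimes> e')"
  shows "c = \<zero> \<or> c = \<one>"
proof -
  note zR = G_carrier[OF z(1)] and eR = G_carrier[OF e(1)] and eR' = G_carrier[OF e(3)] and cR = G_carrier[OF c]
  interpret Z: ideal "PIdl z" R by (rule cgenideal_ideal[OF zR])
  obtain p q where pq: "p \<in> G 0" "q \<in> G 0" "q \<noteq> \<zero>"
    and eq: "(p \<otimes> z \<oplus> q \<otimes> (e \<oplus> c \<otimes> e')) \<otimes> (p \<otimes> z \<oplus> q \<otimes> (e \<oplus> c \<otimes> e')) = z \<otimes> (p \<otimes> z \<oplus> q \<otimes> (e \<oplus> c \<otimes> e'))"
    using dec unfolding decomposing_def by blast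
  note pR = G_carrier[OF pq(1)] and qR = G_carrier[OF pq(2)]
  have ee': "e \<otimes> e' \<notin> PIdl z"
    using nc mult_mem_PIdl(2)[OF zR] e eR eR' unfolding closed_products_def by auto
  define r where "r = q \<otimes> c"
  have rG: "r \<in> G 0" unfolding r_def using pq c by simp
  note rR = G_carrier[OF rG]
  define w where "w = p \<otimes> z \<oplus> q \<otimes> e \<oplus> r \<otimes> e'"
  have w: "w = p \<otimes> z \<oplus> q \<otimes> (e \<oplus> c \<otimes> e')"
    unfolding w_def r_def using zR eR eR' cR pR qR by algebra
  define k where "k = q \<otimes> r \<oplus> q \<otimes> r"
  have kG: "k \<in> G 0" unfolding k_def using pq rG by simp
  note kR = G_carrier[OF kG]
  define L where "L = (p \<otimes> p \<ominus> p) \<otimes> z \<oplus> (p \<otimes> q \<oplus> p \<otimes> q \<oplus> q \<otimes> q \<ominus> q) \<otimes> e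
     \<oplus> (p \<otimes> r \<oplus> p \<otimes> r \<oplus> r \<otimes> r \<ominus> r) \<otimes> e'"
  have LR: "L \<in> carrier R" unfolding L_def using zR eR eR' pR qR rR by simp
  define A B C where "A = p \<otimes> z" and "B = q \<otimes> e" and "C = r \<otimes> e'"
  define a b c' d f h where "a = p \<otimes> p \<otimes> z" and "b = q \<otimes> q \<otimes> e" and "c' = r \<otimes> r \<otimes> e'"
    and "d = p \<otimes> q \<otimes> e" and "f = p \<otimes> r \<otimes> e'" and "h = q \<otimes> r \<otimes> (e \<otimes> e')"
  have ABC: "A \<in> carrier R" "B \<in> carrier R" "C \<in> carrier R"
    unfolding A_def B_def C_def using zR eR eR' pR qR rR by simp_all
  have abc: "a \<in> carrier R" "b \<in> carrier R" "c' \<in> carrier R" "d \<in> carrier R" "f \<in> carrier R" "h \<in> carrier R"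
    unfolding a_def b_def c'_def d_def f_def h_def using zR eR eR' pR qR rR by simp_all
  have "B \<otimes> B = (q \<otimes> q) \<otimes> (e \<otimes> e)" "C \<otimes> C = (r \<otimes> r) \<otimes> (e' \<otimes> e')"
    unfolding B_def C_def using eR eR' qR rR by (simp_all add: m_ac)
  then have prods: "A \<otimes> A = z \<otimes> a" "B \<otimes> B = z \<otimes> b" "C \<otimes> C = z \<otimes> c'" "A \<otimes> B = z \<otimes> d" "A \<otimes> C = z \<otimes> f" "B \<otimes> C = h"
    unfolding e(2) e(4) A_def B_def C_def a_def b_def c'_def d_def f_def h_def
    using zR eR eR' pR qR rR by (simp_all add: m_ac)
  have "(p \<otimes> p \<ominus> p) \<otimes> z = a \<ominus> A" "(p \<otimes> q \<oplus> p \<otimes> q \<oplus> q \<otimes> q \<ominus> q) \<otimes> e = (d \<oplus> d \<oplus> b) \<ominus> B"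
    "(p \<otimes> r \<oplus> p \<otimes> r \<oplus> r \<otimes> r \<ominus> r) \<otimes> e' = (f \<oplus> f \<oplus> c') \<ominus> C"
    unfolding A_def B_def C_def a_def b_def c'_def d_def f_def using zR eR eR' pR qR rR by algebra+
  then have L_parts: "L = (a \<ominus> A) \<oplus> ((d \<oplus> d \<oplus> b) \<ominus> B) \<oplus> ((f \<oplus> f \<oplus> c') \<ominus> C)"
    unfolding L_def by simp
  have "w \<otimes> w = A \<otimes> A \<oplus> B \<otimes> B \<oplus> C \<otimes> C \<oplus> ((A \<otimes> B \<oplus> A \<otimes> B) \<oplus> (A \<otimes> C \<oplus> A \<otimes> C) \<oplus> (B \<otimes> C \<oplus> B \<otimes> C))"
    unfolding w_def A_def[symmetric] B_def[symmetric] C_def[symmetric] using ABC by algebra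
  also have "\<dots> = z \<otimes> (a \<oplus> b \<oplus> c' \<oplus> (d \<oplus> d) \<oplus> (f \<oplus> f)) \<oplus> (h \<oplus> h)"
    unfolding prods using zR abc by algebra
  also have "a \<oplus> b \<oplus> c' \<oplus> (d \<oplus> d) \<oplus> (f \<oplus> f) = L \<oplus> w"
  proof -
    have cancel: "(x \<ominus> A) \<oplus> (y \<ominus> B) \<oplus> (u \<ominus> C) \<oplus> (A \<oplus> B \<oplus> C) = x \<oplus> y \<oplus> u"
      if "x \<in> carrier R" "y \<in> carrier R" "u \<in> carrier R" for x y u
    proof -
      have "(x \<ominus> A) \<oplus> (y \<ominus> B) \<oplus> (u \<ominus> C) \<oplus> (A \<oplus> B \<oplus> C)
          = ((x \<ominus> A) \<oplus> A) \<oplus> ((y \<ominus> B) \<oplus> B) \<oplus> ((u \<ominus> C) \<oplus> C)"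
        using that ABC by (simp add: a_ac)
      then show ?thesis using that ABC by (simp add: minus_eq a_assoc l_neg)
    qed
    have "L \<oplus> w = a \<oplus> (d \<oplus> d \<oplus> b) \<oplus> (f \<oplus> f \<oplus> c')"
      unfolding L_parts w_def A_def[symmetric] B_def[symmetric] C_def[symmetric] using abc by (intro cancel) simp_all
    then show ?thesis using abc by (simp add: a_ac)
  qed
  also have "h \<oplus> h = k \<otimes> (e \<otimes> e')"
    unfolding h_def k_def using eR eR' qR rR by algebra
  finally have "z \<otimes> (L \<oplus> w) \<oplus> k \<otimes> (e \<otimes> e') = z \<otimes> w" using eq unfolding w by simp
  moreover have wR: "w \<in> carrier R" unfolding w_def using zR eR eR' pR qR rR by simp
  have "z \<otimes> L \<oplus> k \<otimes> (e \<otimes> e') = (z \<otimes> (L \<oplus> w) \<oplus> k \<otimes> (e \<otimes> e')) \<ominus> z \<otimes> w"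
    using zR LR wR kR eR eR' by algebra
  ultimately have zL: "z \<otimes> L \<oplus> k \<otimes> (e \<otimes> e') = \<zero>" using zR wR by (simp add: r_neg minus_eq)
  have k0: "k = \<zero>"
  proof (rule ccontr)
    assume "k \<noteq> \<zero>"
    then obtain d where d: "d \<in> G 0" "d \<otimes> k = \<one>" using G0_inverse[OF kG] by blast
    note dR = G_carrier[OF d(1)]
    have "(d \<otimes> k) \<otimes> (e \<otimes> e') = d \<otimes> (z \<otimes> L \<oplus> k \<otimes> (e \<otimes> e')) \<oplus> (\<ominus> (d \<otimes> L)) \<otimes> z"
      using dR G_carrier[OF kG] eR eR' zR LR by algebra
    then have "e \<otimes> e' = (\<ominus> (d \<otimes> L)) \<otimes> z" unfolding zL d(2) using eR eR' dR LR zR by simp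
    then show False using ee' mult_mem_PIdl(1)[OF zR, of "\<ominus> (d \<otimes> L)"] dR LR by simp
  qed
  then have L0: "L = \<zero>" using zL z(2) LR zR eR eR' by (simp add: nonzerodivisor_def)
  have coG: "p \<otimes> p \<ominus> p \<in> G 0" "p \<otimes> q \<oplus> p \<otimes> q \<oplus> q \<otimes> q \<ominus> q \<in> G 0"
    "p \<otimes> r \<oplus> p \<otimes> r \<oplus> r \<otimes> r \<ominus> r \<in> G 0"
    unfolding minus_eq using pq rG by simp_all
  note co = independent3D(2,3)[OF ind coG L0[unfolded L_def]]
  have "(q \<otimes> q \<otimes> c) \<otimes> (c \<ominus> \<one>) = (p \<otimes> r \<oplus> p \<otimes> r \<oplus> r \<otimes> r \<ominus> r)
     \<ominus> c \<otimes> (p \<otimes> q \<oplus> p \<otimes> q \<oplus> q \<otimes> q \<ominus> q)"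
    unfolding r_def using cR pR qR by algebra
  then have "(q \<otimes> q \<otimes> c) \<otimes> (c \<ominus> \<one>) = \<zero>" unfolding co using cR by simp
  then have "q \<otimes> q \<otimes> c = \<zero> \<or> c \<ominus> \<one> = \<zero>" using G0_mult_eq_zero[of "q \<otimes> q \<otimes> c" "c \<ominus> \<one>"] pq c cR by simp
  moreover have "q \<otimes> q \<noteq> \<zero>" using G0_mult_eq_zero[OF pq(2) qR] pq(3) by blast
  then have "q \<otimes> q \<otimes> c = \<zero> \<Longrightarrow> c = \<zero>" using G0_mult_eq_zero[of "q \<otimes> q" c] pq cR by simp
  ultimately show ?thesis using cR by auto
qed

text \<open>If there is a pair \<open>e, e'\<close> as in the previous lemma, it serves with the exceptions \<open>0\<close> and \<open>1\<close>. If there is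
  none, then \<open>f, g\<close> themselves serve with at most one exception: two exceptions \<open>c \<noteq> d\<close> would give elements
  \<open>e, e'\<close> that span the same space as \<open>f, g\<close> modulo \<open>z\<close>, and thus such a pair.\<close>

lemma exists_family_rarely_decomposing:
  assumes z: "z \<in> G 1" "nonzerodivisor z"
    and fg: "f \<in> G 1" "g \<in> G 1" "independent3 z f g" "\<not> closed_products z f g"
  obtains u v where "u \<in> G 1" "v \<in> G 1" "independent3 z u v" "\<not> closed_products z u v"
    "finite {c \<in> G 0. decomposing z (u \<oplus> c \<otimes> v)}"
proof (cases "\<exists>e\<in>G 1. \<exists>e'\<in>G 1. e \<otimes> e = z \<otimes> e \<and> e' \<otimes> e' = z \<otimes> e' \<and> independent3 z e e' \<and> \<not> closed_products z e e'")
  case True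
  then obtain e e' where e: "e \<in> G 1" "e \<otimes> e = z \<otimes> e" "e' \<in> G 1" "e' \<otimes> e' = z \<otimes> e'" "independent3 z e e'" "\<not> closed_products z e e'"
    by blast
  have "{c \<in> G 0. decomposing z (e \<oplus> c \<otimes> e')} \<subseteq> {\<zero>, \<one>}"
    using decomposing_between_idempotents[OF z e] by blast
  then have "finite {c \<in> G 0. decomposing z (e \<oplus> c \<otimes> e')}" by (rule finite_subset) simp
  then show thesis using that e by blast
next
  case False
  note zR = G_carrier[OF z(1)] and fR = G_carrier[OF fg(1)] and gR = G_carrier[OF fg(2)]
  have unique: "c = d" if c: "c \<in> G 0" "decomposing z (f \<oplus> c \<otimes> g)" and d: "d \<in> G 0" "decomposing z (f \<oplus> d \<otimes> g)" for c d
  proof (rule ccontr)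
    assume cd: "c \<noteq> d"
    note cR = G_carrier[OF c(1)] and dR = G_carrier[OF d(1)]
    obtain p q where pq: "p \<in> G 0" "q \<in> G 0" "q \<noteq> \<zero>"
      "(p \<otimes> z \<oplus> q \<otimes> (f \<oplus> c \<otimes> g)) \<otimes> (p \<otimes> z \<oplus> q \<otimes> (f \<oplus> c \<otimes> g)) = z \<otimes> (p \<otimes> z \<oplus> q \<otimes> (f \<oplus> c \<otimes> g))"
      using c(2) unfolding decomposing_def by blast
    obtain p' q' where pq': "p' \<in> G 0" "q' \<in> G 0" "q' \<noteq> \<zero>"
      "(p' \<otimes> z \<oplus> q' \<otimes> (f \<oplus> d \<otimes> g)) \<otimes> (p' \<otimes> z \<oplus> q' \<otimes> (f \<oplus> d \<otimes> g)) = z \<otimes> (p' \<otimes> z \<oplus> q' \<otimes> (f \<oplus> d \<otimes> g))"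
      using d(2) unfolding decomposing_def by blast
    note R = pq(1,2)[THEN G_carrier] pq'(1,2)[THEN G_carrier]
    define e where "e = p \<otimes> z \<oplus> q \<otimes> (f \<oplus> c \<otimes> g)"
    define e' where "e' = p' \<otimes> z \<oplus> q' \<otimes> (f \<oplus> d \<otimes> g)"
    have eG: "e \<in> G 1" "e' \<in> G 1" unfolding e_def e'_def using pq pq' z fg c d by simp_all
    note eR = eG[THEN G_carrier]
    have "c \<ominus> d \<in> G 0" unfolding minus_eq using c(1) d(1) by simp
    moreover have "c \<ominus> d \<noteq> \<zero>" using cd cR dR by (metis r_right_minus_eq)
    ultimately obtain \<delta> where \<delta>: "\<delta> \<in> G 0" "\<delta> \<otimes> (c \<ominus> d) = \<one>" "\<delta> \<noteq> \<zero>" using G0_inverse by blast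
    obtain \<kappa> where \<kappa>: "\<kappa> \<in> G 0" "\<kappa> \<otimes> q = \<one>" using G0_inverse[OF pq(2,3)] by blast
    obtain \<kappa>' where \<kappa>': "\<kappa>' \<in> G 0" "\<kappa>' \<otimes> q' = \<one>" using G0_inverse[OF pq'(2,3)] by blast
    note R' = G_carrier[OF \<delta>(1)] G_carrier[OF \<kappa>(1)] G_carrier[OF \<kappa>'(1)]
    have ind: "independent3 z e e'"
      unfolding independent3_def
    proof (intro ballI impI)
      fix a b b' assume abc: "a \<in> G 0" "b \<in> G 0" "b' \<in> G 0" and eq: "a \<otimes> z \<oplus> b \<otimes> e \<oplus> b' \<otimes> e' = \<zero>"
      note Rabc = abc[THEN G_carrier]
      have "(a \<oplus> b \<otimes> p \<oplus> b' \<otimes> p') \<otimes> z \<oplus> (b \<otimes> q \<oplus> b' \<otimes> q') \<otimes> f \<oplus> (b \<otimes> q \<otimes> c \<oplus> b' \<otimes> q' \<otimes> d) \<otimes> g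
        = a \<otimes> z \<oplus> b \<otimes> e \<oplus> b' \<otimes> e'"
        unfolding e_def e'_def using R Rabc cR dR zR fR gR by algebra
      then have co: "a \<oplus> b \<otimes> p \<oplus> b' \<otimes> p' = \<zero>" "b \<otimes> q \<oplus> b' \<otimes> q' = \<zero>" "b \<otimes> q \<otimes> c \<oplus> b' \<otimes> q' \<otimes> d = \<zero>"
        using independent3D[OF fg(3), of "a \<oplus> b \<otimes> p \<oplus> b' \<otimes> p'" "b \<otimes> q \<oplus> b' \<otimes> q'" "b \<otimes> q \<otimes> c \<oplus> b' \<otimes> q' \<otimes> d"]
          eq abc pq pq' c d by simp_all
      have "(b \<otimes> q) \<otimes> (c \<ominus> d) = (b \<otimes> q \<otimes> c \<oplus> b' \<otimes> q' \<otimes> d) \<ominus> d \<otimes> (b \<otimes> q \<oplus> b' \<otimes> q')"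
        using R Rabc cR dR by algebra
      then have "(b \<otimes> q) \<otimes> (c \<ominus> d) = \<zero>" unfolding co using dR by simp
      then have "b \<otimes> q = \<zero>"
        using G0_mult_eq_zero[of "b \<otimes> q" "c \<ominus> d"] abc pq cR dR \<open>c \<ominus> d \<noteq> \<zero>\<close> by simp
      then have b: "b = \<zero>" using G0_mult_eq_zero[OF abc(2) R(2)] pq(3) by blast
      then have "b' \<otimes> q' = \<zero>" using co(2) R Rabc by simp
      then have b': "b' = \<zero>" using G0_mult_eq_zero[OF abc(3) R(4)] pq'(3) by blast
      then have "a = \<zero>" using co(1) b R Rabc by simp
      then show "a = \<zero> \<and> b = \<zero> \<and> b' = \<zero>" using b b' by simp
    qed
    have Fc: "f \<oplus> c \<otimes> g = \<kappa> \<otimes> e \<ominus> (\<kappa> \<otimes> p) \<otimes> z"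
    proof -
      have "\<kappa> \<otimes> e \<ominus> (\<kappa> \<otimes> p) \<otimes> z = (\<kappa> \<otimes> q) \<otimes> (f \<oplus> c \<otimes> g)"
        unfolding e_def using R R' cR zR fR gR by algebra
      then show ?thesis using \<kappa>(2) fR gR cR by simp
    qed
    have Fd: "f \<oplus> d \<otimes> g = \<kappa>' \<otimes> e' \<ominus> (\<kappa>' \<otimes> p') \<otimes> z"
    proof -
      have "\<kappa>' \<otimes> e' \<ominus> (\<kappa>' \<otimes> p') \<otimes> z = (\<kappa>' \<otimes> q') \<otimes> (f \<oplus> d \<otimes> g)"
        unfolding e'_def using R R' dR zR fR gR by algebra
      then show ?thesis using \<kappa>'(2) fR gR dR by simp
    qed
    have "g = (\<delta> \<otimes> (c \<ominus> d)) \<otimes> g" using \<delta>(2) gR by simp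
    also have "\<dots> = \<delta> \<otimes> ((f \<oplus> c \<otimes> g) \<ominus> (f \<oplus> d \<otimes> g))" using R' cR dR fR gR by algebra
    also have "\<dots> = (\<delta> \<otimes> (\<kappa>' \<otimes> p' \<ominus> \<kappa> \<otimes> p)) \<otimes> z \<oplus> (\<delta> \<otimes> \<kappa>) \<otimes> e \<oplus> (\<ominus> (\<delta> \<otimes> \<kappa>')) \<otimes> e'"
      unfolding Fc Fd using R R' eR zR by algebra
    finally have g: "g = (\<delta> \<otimes> (\<kappa>' \<otimes> p' \<ominus> \<kappa> \<otimes> p)) \<otimes> z \<oplus> (\<delta> \<otimes> \<kappa>) \<otimes> e \<oplus> (\<ominus> (\<delta> \<otimes> \<kappa>')) \<otimes> e'" .
    have "f = (f \<oplus> c \<otimes> g) \<ominus> c \<otimes> g" using fR gR cR by algebra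
    also have "\<dots> = (\<ominus> (\<kappa> \<otimes> p) \<ominus> c \<otimes> (\<delta> \<otimes> (\<kappa>' \<otimes> p' \<ominus> \<kappa> \<otimes> p))) \<otimes> z \<oplus> (\<kappa> \<ominus> c \<otimes> (\<delta> \<otimes> \<kappa>)) \<otimes> e \<oplus> (c \<otimes> (\<delta> \<otimes> \<kappa>')) \<otimes> e'"
      unfolding Fc by (subst g) (use R R' eR zR cR in algebra)
    finally have f: "f = (\<ominus> (\<kappa> \<otimes> p) \<ominus> c \<otimes> (\<delta> \<otimes> (\<kappa>' \<otimes> p' \<ominus> \<kappa> \<otimes> p))) \<otimes> z \<oplus> (\<kappa> \<ominus> c \<otimes> (\<delta> \<otimes> \<kappa>)) \<otimes> e \<oplus> (c \<otimes> (\<delta> \<otimes> \<kappa>')) \<otimes> e'" .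
    have "\<not> closed_products z e e'"
    proof
      assume cl: "closed_products z e e'"
      have sp: "\<exists>t\<in>carrier R. \<exists>a\<in>carrier R. \<exists>b\<in>carrier R. x = t \<otimes> z \<oplus> a \<otimes> e \<oplus> b \<otimes> e'" if x: "x = f \<or> x = g" for x
      proof (cases "x = f")
        case True
        show ?thesis
          by (intro bexI exI, unfold True, rule f) (use R R' cR in simp_all)
      next
        case False
        then have "x = g" using x by blast
        show ?thesis
          by (intro bexI exI, unfold \<open>x = g\<close>, rule g) (use R R' cR in simp_all)
      qed
      have "x \<otimes> y \<in> PIdl z" if xy: "x = f \<or> x = g" "y = f \<or> y = g" for x y
      proof -
        obtain t a b where x: "t \<in> carrier R" "a \<in> carrier R" "b \<in> carrier R" "x = t \<otimes> z \<oplus> a \<otimes> e \<oplus> b \<otimes> e'"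
          using sp[OF xy(1)] by blast
        obtain t' a' b' where y: "t' \<in> carrier R" "a' \<in> carrier R" "b' \<in> carrier R" "y = t' \<otimes> z \<oplus> a' \<otimes> e \<oplus> b' \<otimes> e'"
          using sp[OF xy(2)] by blast
        show ?thesis unfolding x(4) y(4) by (rule closed_products_span[OF cl zR eR x(1-3) y(1-3)])
      qed
      then have "closed_products z f g" unfolding closed_products_def by blast
      then show False using fg(4) by blast
    qed
    then show False using False eG ind pq(4) pq'(4) unfolding e_def[symmetric] e'_def[symmetric] by blast
  qed
  have "finite {c \<in> G 0. decomposing z (f \<oplus> c \<otimes> g)}"
  proof (cases "{c \<in> G 0. decomposing z (f \<oplus> c \<otimes> g)} = {}")
    case False
    then obtain d where "d \<in> G 0" "decomposing z (f \<oplus> d \<otimes> g)" by blast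
    then have "{c \<in> G 0. decomposing z (f \<oplus> c \<otimes> g)} \<subseteq> {d}" using unique by blast
    then show ?thesis by (rule finite_subset) simp
  qed (metis finite.emptyI)
  then show thesis using that fg by blast
qed

end

context standard_graded
begin

text \<open>A graded submodule contains the components of its elements. As sums are taken in the record restricted to
  \<open>H\<close>, they are first transported to \<open>R\<close>.\<close>

lemma linear_part_in_submodule:
  assumes zh: "z \<in> G 1" "h \<in> G 1" and H: "submodule H R (mod2 z h)"
    and gr: "graded_module R G ((mod2 z h)\<lparr>carrier := H\<rparr>, \<lambda>i. emb_grading G \<zero> (ideal2 z h) i \<inter> H)"
    and x: "emb x \<in> H"
  shows "emb (comp x 1) \<in> H"
proof -
  note c = zh[THEN G_carrier]
  let ?I = "ideal2 z h" and ?D = "emb_grading G \<zero> (ideal2 z h)"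
  note I = ideal_ideal2[OF c]
  interpret E: module R "mod2 z h" by (rule module_emb[OF I])
  have sub: "H \<subseteq> emb ` ?I" using E.submoduleE(1)[OF H] by simp
  let ?N = "(mod2 z h)\<lparr>carrier := H\<rparr>"
  have N: "abelian_group ?N" and ds: "internal_direct_sum ?N (\<lambda>i. ?D i \<inter> H)"
    using gr unfolding graded_module.simps module_def by auto
  obtain cc where cc: "\<And>i. cc i \<in> ?D i \<inter> H" "finite {i. cc i \<noteq> \<zero>\<^bsub>?N\<^esub>}"
    "emb x = (\<Oplus>\<^bsub>?N\<^esub> i\<in>{i. cc i \<noteq> \<zero>\<^bsub>?N\<^esub>}. cc i)"
  proof -
    have "emb x \<in> carrier ?N" using x by simp
    note ex = bspec[OF conjunct2[OF ds[unfolded internal_direct_sum_def]] this]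
    show thesis using ex that by (elim ex1E conjE) blast
  qed
  let ?A = "{i. cc i \<noteq> \<zero>\<^bsub>?N\<^esub>}"
  have un: "unemb U \<in> carrier R" if "U \<in> H" for U
    using sub that ideal.Icarr[OF I] by auto
  have hom: "unemb (cc i) \<in> G (nat i) \<and> (i < 0 \<longrightarrow> unemb (cc i) = \<zero>)" for i
    using cc(1)[of i] by (auto simp: emb_grading_def split: if_splits)
  have "unemb (emb x) = (\<Oplus>i\<in>?A. unemb (cc i))"
    unfolding cc(3)
    by (rule additive_map_finsum[OF N is_abelian_group _ _ _ cc(2)]) (use un cc(1) in auto)
  then have xs: "x = (\<Oplus>i\<in>?A. unemb (cc i))" by simp
  have "comp x 1 = (\<Oplus>i\<in>?A. comp (unemb (cc i)) 1)"
    unfolding xs using cc(1,2) un by (intro comp_finsum) auto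
  also have "\<dots> = (\<Oplus>i\<in>?A. if i = 1 then unemb (cc 1) else \<zero>)"
  proof (intro finsum_cong' refl)
    fix i
    have "comp (unemb (cc i)) 1 = (if (1::nat) = nat i then unemb (cc i) else \<zero>)"
      using hom[of i] by (intro comp_homogeneous) blast
    moreover have "1 = nat i \<longleftrightarrow> i = 1" by linarith
    ultimately show "comp (unemb (cc i)) 1 = (if i = 1 then unemb (cc 1) else \<zero>)" by simp
  qed (use un cc(1) in auto)
  also have "\<dots> = unemb (cc 1)"
  proof (cases "1 \<in> ?A")
    case True
    then show ?thesis using add.finprod_singleton_swap[OF True cc(2), of "\<lambda>i. unemb (cc 1)"] un cc(1) by (simp add: eq_commute)
  next
    case False
    then have "unemb (cc 1) = \<zero>" by simp
    moreover have "(if i = 1 then \<zero> else \<zero>) = \<zero>" for i :: int by simp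
    ultimately show ?thesis by (simp only: finsum_zero)
  qed
  finally have "emb (comp x 1) = emb (unemb (cc 1))" by simp
  moreover have "emb (unemb (cc 1)) = cc 1" using cc(1)[of 1] sub by auto
  ultimately show ?thesis using cc(1)[of 1] by simp
qed

text \<open>Let \<open>(z, h)\<close> be the direct sum of \<open>H\<close> and \<open>K\<close>, and let \<open>z = e + e'\<close> be the linear part of the corresponding
  decomposition of \<open>z\<close>. Then \<open>e e' \<in> H \<inter> K = 0\<close>, so \<open>e\<^sup>2 = z e\<close>, and since \<open>h\<close> is not decomposing, \<open>e\<close> is \<open>0\<close> or
  \<open>z\<close>. Hence \<open>z\<close> lies in one summand, and the other, being killed by \<open>z\<close>, is zero.\<close>

lemma indecomposable_gmod2:
  assumes dim: "krull_dim R = 1" and z: "z \<in> G 1" "nonzerodivisor z" and h: "h \<in> G 1"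
    and nd: "\<not> decomposing z h"
  shows "indecomposable_graded_MCM R G (gmod2 z h)"
proof -
  note zR = G_carrier[OF z(1)] and hR = G_carrier[OF h]
  let ?M = "mod2 z h" and ?I = "ideal2 z h" and ?D = "emb_grading G \<zero> (ideal2 z h)"
  note I = ideal_ideal2[OF zR hR]
  interpret I: ideal ?I R by (rule I)
  interpret E: module R ?M by (rule module_emb[OF I])
  have z0: "z \<noteq> \<zero>" using z(2) one_nz by (auto simp: nonzerodivisor_def)
  have zI: "z \<in> ?I" by (rule generators_ideal2(1)[OF zR hR])
  have "carrier ?M \<noteq> {\<zero>\<^bsub>?M\<^esub>}"
  proof
    assume "carrier ?M = {\<zero>\<^bsub>?M\<^esub>}"
    then have "emb z = emb \<zero>" using zI by auto
    then show False using z0 by (simp add: emb_inj)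
  qed
  then have mcm: "graded_MCM R G (gmod2 z h)"
    unfolding graded_MCM.simps
    using graded_gmod2[OF z(1) h] finitely_generated_mod2[OF z(1) h] depth_mod2[OF dim z h] dim by simp
  have no_zero: "H = {\<zero>\<^bsub>?M\<^esub>}"
    if H: "submodule H R ?M" "submodule K R ?M" "H \<inter> K = {\<zero>\<^bsub>?M\<^esub>}" and zK: "emb z \<in> K" for H K
  proof -
    have "U = emb \<zero>" if U: "U \<in> H" for U
    proof -
      obtain x where x: "x \<in> ?I" "U = emb x" using E.submoduleE(1)[OF H(1)] U by auto
      note xR = I.Icarr[OF x(1)]
      have "z \<odot>\<^bsub>?M\<^esub> U \<in> H" by (rule E.submoduleE(4)[OF H(1) zR U])
      moreover have "x \<odot>\<^bsub>?M\<^esub> emb z \<in> K" by (rule E.submoduleE(4)[OF H(2) xR zK])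
      ultimately have "emb (z \<otimes> x) \<in> H \<inter> K" using x(2) m_comm[OF xR zR] by simp
      then have "z \<otimes> x = \<zero>" using H(3) by (simp add: emb_inj)
      then have "x = \<zero>" using z(2) xR unfolding nonzerodivisor_def by blast
      then show ?thesis using x(2) by simp
    qed
    moreover have "emb \<zero> \<in> H" using H(3) by auto
    ultimately have "H = {emb \<zero>}" by blast
    then show ?thesis by simp
  qed
  have False
    if H: "submodule H R ?M" and K: "submodule K R ?M"
      and mH: "graded_MCM R G (?M\<lparr>carrier := H\<rparr>, \<lambda>i. ?D i \<inter> H)"
      and mK: "graded_MCM R G (?M\<lparr>carrier := K\<rparr>, \<lambda>i. ?D i \<inter> K)"
      and int: "H \<inter> K = {\<zero>\<^bsub>?M\<^esub>}" and sum: "H <+>\<^bsub>?M\<^esub> K = carrier ?M" for H K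
  proof -
    have gH: "graded_module R G (?M\<lparr>carrier := H\<rparr>, \<lambda>i. ?D i \<inter> H)" "H \<noteq> {\<zero>\<^bsub>?M\<^esub>}"
      and gK: "graded_module R G (?M\<lparr>carrier := K\<rparr>, \<lambda>i. ?D i \<inter> K)" "K \<noteq> {\<zero>\<^bsub>?M\<^esub>}"
      using mH mK unfolding graded_MCM.simps by auto
    have HI: "H \<subseteq> emb ` ?I" and KI: "K \<subseteq> emb ` ?I" using E.submoduleE(1)[OF H] E.submoduleE(1)[OF K] by auto
    have "emb z \<in> H <+>\<^bsub>?M\<^esub> K" unfolding sum using zI by simp
    then obtain U V where UV: "U \<in> H" "V \<in> K" "emb z = U \<oplus>\<^bsub>?M\<^esub> V" unfolding set_add_def' by blast
    obtain u v where uv: "u \<in> ?I" "U = emb u" "v \<in> ?I" "V = emb v" using UV HI KI by blast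
    note uR = I.Icarr[OF uv(1)] and vR = I.Icarr[OF uv(3)]
    have zuv: "z = u \<oplus> v" using UV(3) uv by (simp add: emb_inj)
    define e where "e = comp u 1"
    define e' where "e' = comp v 1"
    have eH: "emb e \<in> H" unfolding e_def
      by (rule linear_part_in_submodule[OF z(1) h H gH(1)]) (use UV uv in simp)
    have eK: "emb e' \<in> K" unfolding e'_def
      by (rule linear_part_in_submodule[OF z(1) h K gK(1)]) (use UV uv in simp)
    have eR: "e \<in> carrier R" "e' \<in> carrier R" unfolding e_def e'_def using uR vR by simp_all
    have ze: "z = e \<oplus> e'" using comp_add[OF uR vR, of 1] z(1) zuv e_def e'_def by simp
    have "e \<odot>\<^bsub>?M\<^esub> emb e' \<in> K" by (rule E.submoduleE(4)[OF K eR(1) eK])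
    moreover have "e' \<odot>\<^bsub>?M\<^esub> emb e \<in> H" by (rule E.submoduleE(4)[OF H eR(2) eH])
    ultimately have "emb (e \<otimes> e') \<in> H \<inter> K" using m_comm[OF eR] by simp
    then have ee': "e \<otimes> e' = \<zero>" using int by (simp add: emb_inj)
    have idem: "e \<otimes> e = z \<otimes> e"
    proof -
      have "z \<otimes> e = e \<otimes> e \<oplus> e \<otimes> e'" unfolding ze using eR by algebra
      then show ?thesis unfolding ee' using eR by simp
    qed
    obtain p q where pq: "p \<in> G 0" "q \<in> G 0" "e = p \<otimes> z \<oplus> q \<otimes> h"
      using ideal2_degree_1[OF z(1) h uv(1)] unfolding e_def by blast
    note pR = G_carrier[OF pq(1)]
    have "q = \<zero>" using nd idem pq unfolding decomposing_def by blast
    then have e: "e = p \<otimes> z" using pq pR zR hR by simp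
    have "z \<otimes> ((p \<otimes> (p \<ominus> \<one>)) \<otimes> z) = e \<otimes> e \<ominus> z \<otimes> e" unfolding e using pR zR by algebra
    also have "\<dots> = \<zero>" unfolding idem using zR eR by (simp add: r_neg minus_eq)
    finally have "(p \<otimes> (p \<ominus> \<one>)) \<otimes> z = \<zero>" using z(2) pR zR by (simp add: nonzerodivisor_def)
    then have "p \<otimes> (p \<ominus> \<one>) = \<zero>" using G0_mult_eq_zero[of "p \<otimes> (p \<ominus> \<one>)" z] pq(1) zR z0 by (simp add: minus_eq)
    then have "p = \<zero> \<or> p \<ominus> \<one> = \<zero>" using G0_mult_eq_zero[OF pq(1), of "p \<ominus> \<one>"] pR by simp
    then show False
    proof
      assume "p = \<zero>"
      then have "e' = z" using ze e eR zR by simp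
      then show False using no_zero[OF H K int] eK gH(2) by simp
    next
      assume "p \<ominus> \<one> = \<zero>"
      then have "p = \<one>" using pR by simp
      then have "emb z \<in> H" using eH e zR by simp
      then show False using no_zero[OF K H] int gK(2) by (simp add: Int_commute)
    qed
  qed
  then show ?thesis using mcm unfolding indecomposable_graded_MCM.simps by blast
qed

text \<open>The relation is the degree two part of \<open>h \<phi>(z) = z \<phi>(h)\<close>: the linear parts of \<open>\<phi>(z)\<close> and \<open>\<phi>(h)\<close> lie in the span
  of \<open>z\<close> and \<open>h'\<close>, whatever \<open>\<phi>\<close> does to degrees. If the linear part of \<open>\<phi>(z)\<close> vanished, so would that of
  \<open>\<phi>(h)\<close>, and \<open>z\<close> would not be in the image.\<close>

lemma isomorphism_relation:
  assumes z: "z \<in> G 1" "nonzerodivisor z" and h: "h \<in> G 1" "h' \<in> G 1"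
    and \<phi>: "\<phi> \<in> module_hom R (mod2 z h) (mod2 z h')" "\<phi> ` carrier (mod2 z h) = carrier (mod2 z h')"
  obtains p q r s where "p \<in> G 0" "q \<in> G 0" "r \<in> G 0" "s \<in> G 0" "p \<noteq> \<zero> \<or> q \<noteq> \<zero>"
    "h \<otimes> (p \<otimes> z \<oplus> q \<otimes> h') = z \<otimes> (r \<otimes> z \<oplus> s \<otimes> h')"
proof -
  note R = G_carrier[OF z(1)] h[THEN G_carrier]
  note I = ideal_ideal2[OF R(1,2)] and I' = ideal_ideal2[OF R(1,3)]
  interpret I': ideal "ideal2 z h'" R by (rule I')
  have z0: "z \<noteq> \<zero>" using z(2) one_nz by (auto simp: nonzerodivisor_def)
  define f where "f x = unemb (\<phi> (emb x))" for x
  have f: "f x \<in> ideal2 z h'" "\<phi> (emb x) = emb (f x)" if "x \<in> ideal2 z h" for x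
  proof -
    have "\<phi> (emb x) \<in> emb ` ideal2 z h'" using module_homD(1)[OF \<phi>(1), of "emb x"] that by simp
    then obtain y where "y \<in> ideal2 z h'" "\<phi> (emb x) = emb y" by blast
    then show "f x \<in> ideal2 z h'" "\<phi> (emb x) = emb (f x)" unfolding f_def by simp_all
  qed
  have f_add: "f (x \<oplus> y) = f x \<oplus> f y" if "x \<in> ideal2 z h" "y \<in> ideal2 z h" for x y
    using module_homD(2)[OF \<phi>(1), of "emb x" "emb y"] that by (simp add: f_def)
  have f_mult: "f (a \<otimes> x) = a \<otimes> f x" if "a \<in> carrier R" "x \<in> ideal2 z h" for a x
    using module_homD(3)[OF \<phi>(1), of a "emb x"] that by (simp add: f_def)
  note gen = generators_ideal2[OF R(1,2)]
  note fz = f(1)[OF gen(1)] and fh = f(1)[OF gen(2)]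
  note fR = I'.Icarr[OF fz] I'.Icarr[OF fh]
  obtain p q where pq: "p \<in> G 0" "q \<in> G 0" "comp (f z) 1 = p \<otimes> z \<oplus> q \<otimes> h'"
    using ideal2_degree_1[OF z(1) h(2) fz] .
  obtain r s where rs: "r \<in> G 0" "s \<in> G 0" "comp (f h) 1 = r \<otimes> z \<oplus> s \<otimes> h'"
    using ideal2_degree_1[OF z(1) h(2) fh] .
  have "h \<otimes> f z = z \<otimes> f h"
    using f_mult[OF R(2) gen(1)] f_mult[OF R(1) gen(2)] m_comm[OF R(1,2)] by simp
  then have "comp (h \<otimes> f z) 2 = comp (z \<otimes> f h) 2" by simp
  then have rel: "h \<otimes> (p \<otimes> z \<oplus> q \<otimes> h') = z \<otimes> (r \<otimes> z \<oplus> s \<otimes> h')"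
    using comp_homogeneous_mult[OF h(1) fR(1), of 2] comp_homogeneous_mult[OF z(1) fR(2), of 2] pq(3) rs(3) by simp
  have "p \<noteq> \<zero> \<or> q \<noteq> \<zero>"
  proof (rule ccontr)
    assume "\<not> (p \<noteq> \<zero> \<or> q \<noteq> \<zero>)"
    then have pq0: "p = \<zero>" "q = \<zero>" by auto
    have rsR: "r \<otimes> z \<oplus> s \<otimes> h' \<in> carrier R" using rs(1,2)[THEN G_carrier] R by simp
    have "z \<otimes> (r \<otimes> z \<oplus> s \<otimes> h') = \<zero>" using rel pq0 R by simp
    then have fh0: "comp (f h) 1 = \<zero>" using z(2) rsR rs(3) by (simp add: nonzerodivisor_def)
    have fz0: "comp (f z) 1 = \<zero>" using pq(3) pq0 R by simp
    have "emb z \<in> \<phi> ` carrier (mod2 z h)" unfolding \<phi>(2) using generators_ideal2[OF R(1,3)] by simp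
    then obtain x where x: "x \<in> ideal2 z h" "emb z = \<phi> (emb x)" by auto
    then have zf: "z = f x" using f(2)[OF x(1)] by (simp add: emb_inj)
    obtain a b where ab: "a \<in> carrier R" "b \<in> carrier R" "x = a \<otimes> z \<oplus> b \<otimes> h" using x(1) by (rule ideal2_cases)
    have "f x = a \<otimes> f z \<oplus> b \<otimes> f h"
      unfolding ab(3) using f_add[of "a \<otimes> z" "b \<otimes> h"] f_mult ab(1,2) gen
        ideal.I_l_closed[OF I] by simp
    then have "comp (f x) 1 = comp (a \<otimes> f z) 1 \<oplus> comp (b \<otimes> f h) 1"
      using comp_add[of "a \<otimes> f z" "b \<otimes> f h" 1] ab(1,2) fR by simp
    moreover have m: "f z \<in> \<mm>" "f h \<in> \<mm>" using ideal2_irrelevant[OF z(1) h(2)] fz fh by blast+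
    ultimately have "comp (f x) 1 = \<zero>"
      unfolding comp1_mult_irrelevant[OF ab(1) m(1)] comp1_mult_irrelevant[OF ab(2) m(2)] fh0 fz0 using ab(1,2) by simp
    then have "comp z 1 = \<zero>" unfolding zf[symmetric] .
    then show False using z(1) z0 by simp
  qed
  then show thesis using that pq rs rel by blast
qed

text \<open>With \<open>h = f + c g\<close> and \<open>h' = f + d g\<close>, all terms of the preceding relation except \<open>q h h'\<close> are multiples of \<open>z\<close>.
  If \<open>q = 0\<close>, cancelling \<open>z\<close> gives \<open>p h = r z + s h'\<close>, which contradicts independence because \<open>c \<noteq> d\<close>.\<close>

lemma isomorphic_family_members:
  assumes z: "z \<in> G 1" "nonzerodivisor z" and fg: "f \<in> G 1" "g \<in> G 1" "independent3 z f g"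
    and cd: "c \<in> G 0" "d \<in> G 0" "c \<noteq> d"
    and \<phi>: "\<phi> \<in> module_hom R (mod2 z (f \<oplus> c \<otimes> g)) (mod2 z (f \<oplus> d \<otimes> g))"
      "\<phi> ` carrier (mod2 z (f \<oplus> c \<otimes> g)) = carrier (mod2 z (f \<oplus> d \<otimes> g))"
  shows "(f \<oplus> c \<otimes> g) \<otimes> (f \<oplus> d \<otimes> g) \<in> PIdl z"
proof -
  note zR = G_carrier[OF z(1)] and fR = G_carrier[OF fg(1)] and gR = G_carrier[OF fg(2)]
    and cR = G_carrier[OF cd(1)] and dR = G_carrier[OF cd(2)]
  interpret Z: ideal "PIdl z" R by (rule cgenideal_ideal[OF zR])
  define h h' where "h = f \<oplus> c \<otimes> g" and "h' = f \<oplus> d \<otimes> g"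
  have hG: "h \<in> G 1" "h' \<in> G 1" unfolding h_def h'_def using fg cd by simp_all
  note hR = hG[THEN G_carrier]
  obtain p q r s where pq: "p \<in> G 0" "q \<in> G 0" "r \<in> G 0" "s \<in> G 0" "p \<noteq> \<zero> \<or> q \<noteq> \<zero>"
    and rel: "h \<otimes> (p \<otimes> z \<oplus> q \<otimes> h') = z \<otimes> (r \<otimes> z \<oplus> s \<otimes> h')"
    using isomorphism_relation[OF z hG] \<phi> unfolding h_def h'_def by blast
  note pqR = pq(1-4)[THEN G_carrier]
  have "q \<noteq> \<zero>"
  proof
    assume q: "q = \<zero>"
    then have p: "p \<noteq> \<zero>" using pq(5) by blast
    have "z \<otimes> (p \<otimes> h) = h \<otimes> (p \<otimes> z \<oplus> q \<otimes> h')" unfolding q using zR hR pqR by (simp add: m_ac)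
    then have "z \<otimes> (p \<otimes> h) = z \<otimes> (r \<otimes> z \<oplus> s \<otimes> h')" using rel by simp
    then have eq: "p \<otimes> h = r \<otimes> z \<oplus> s \<otimes> h'"
      by (rule nonzerodivisor_cancel[OF z(2), rotated 2]) (use zR hR pqR in simp_all)
    have "(\<ominus> r) \<otimes> z \<oplus> (p \<ominus> s) \<otimes> f \<oplus> (p \<otimes> c \<ominus> s \<otimes> d) \<otimes> g = p \<otimes> h \<ominus> (r \<otimes> z \<oplus> s \<otimes> h')"
      unfolding h_def h'_def using zR fR gR cR dR pqR by algebra
    also have "\<dots> = \<zero>" unfolding eq using zR hR pqR by (simp add: r_neg minus_eq)
    finally have *: "(\<ominus> r) \<otimes> z \<oplus> (p \<ominus> s) \<otimes> f \<oplus> (p \<otimes> c \<ominus> s \<otimes> d) \<otimes> g = \<zero>" .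
    have "\<ominus> r \<in> G 0" "p \<ominus> s \<in> G 0" "p \<otimes> c \<ominus> s \<otimes> d \<in> G 0" unfolding minus_eq using pq cd by simp_all
    note co = independent3D(2,3)[OF fg(3) this *]
    have "p = s" using co(1) pqR by simp
    then have "p \<otimes> (c \<ominus> d) = p \<otimes> c \<ominus> s \<otimes> d" using pqR cR dR by algebra
    then have "p \<otimes> (c \<ominus> d) = \<zero>" using co(2) by simp
    then have "c \<ominus> d = \<zero>" using G0_mult_eq_zero[OF pq(1), of "c \<ominus> d"] p cR dR by simp
    then show False using cd(3) cR dR by simp
  qed
  then obtain \<kappa> where \<kappa>: "\<kappa> \<in> G 0" "\<kappa> \<otimes> q = \<one>" using G0_inverse[OF pq(2)] by blast
  note kR = G_carrier[OF \<kappa>(1)]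
  have "(\<kappa> \<otimes> q) \<otimes> (h \<otimes> h') = \<kappa> \<otimes> (h \<otimes> (p \<otimes> z \<oplus> q \<otimes> h')) \<ominus> \<kappa> \<otimes> h \<otimes> p \<otimes> z"
    using kR zR hR pqR by algebra
  also have "\<dots> = (\<kappa> \<otimes> (r \<otimes> z \<oplus> s \<otimes> h') \<ominus> \<kappa> \<otimes> h \<otimes> p) \<otimes> z"
    unfolding rel using kR zR hR pqR by algebra
  finally have "h \<otimes> h' = (\<kappa> \<otimes> (r \<otimes> z \<oplus> s \<otimes> h') \<ominus> \<kappa> \<otimes> h \<otimes> p) \<otimes> z"
    unfolding \<kappa>(2) using hR by simp
  moreover have "(\<kappa> \<otimes> (r \<otimes> z \<oplus> s \<otimes> h') \<ominus> \<kappa> \<otimes> h \<otimes> p) \<otimes> z \<in> PIdl z"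
    by (rule mult_mem_PIdl(1)[OF zR]) (use kR zR hR pqR in simp)
  ultimately have "h \<otimes> h' \<in> PIdl z" by (metis (lifting))
  then show ?thesis unfolding h_def h'_def .
qed

lemma cancel_scalar:
  assumes "ideal I R" "a \<in> G 0" "a \<noteq> \<zero>" "x \<in> carrier R" "a \<otimes> x \<in> I"
  shows "x \<in> I"
proof -
  obtain d where d: "d \<in> G 0" "d \<otimes> a = \<one>" using G0_inverse[OF assms(2,3)] by blast
  have "d \<otimes> (a \<otimes> x) = (d \<otimes> a) \<otimes> x" using d(1) assms(2,4) by (simp add: m_assoc)
  then have "d \<otimes> (a \<otimes> x) = x" using d(2) assms(4) by simp
  then show ?thesis using ideal.I_l_closed[OF assms(1,5) G_carrier[OF d(1)]] by simp
qed

lemma diff_nonzero: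
  assumes "c \<in> G 0" "d \<in> G 0" "c \<noteq> d" shows "c \<ominus> d \<in> G 0" "c \<ominus> d \<noteq> \<zero>"
  using assms G_carrier[OF assms(1)] G_carrier[OF assms(2)] r_right_minus_eq[of c d] by (simp_all add: minus_eq)

text \<open>Products with a common factor \<open>f + c g\<close> differ by a nonzero multiple of \<open>(f + c g) g\<close>. Having this in \<open>z R\<close> for
  two values of \<open>c\<close> yields \<open>g\<^sup>2\<close>, then \<open>f g\<close>, then \<open>f\<^sup>2\<close>.\<close>

lemma closed_products_if_three_products:
  assumes z: "z \<in> carrier R" and fg: "f \<in> carrier R" "g \<in> carrier R"
    and cde: "c \<in> G 0" "d \<in> G 0" "e \<in> G 0" "c \<noteq> d" "c \<noteq> e" "d \<noteq> e"
    and prods: "(f \<oplus> c \<otimes> g) \<otimes> (f \<oplus> d \<otimes> g) \<in> PIdl z" "(f \<oplus> c \<otimes> g) \<otimes> (f \<oplus> e \<otimes> g) \<in> PIdl z"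
      "(f \<oplus> d \<otimes> g) \<otimes> (f \<oplus> e \<otimes> g) \<in> PIdl z"
  shows "closed_products z f g"
proof -
  interpret Z: ideal "PIdl z" R by (rule cgenideal_ideal[OF z])
  note Z = Z.is_ideal
  have diff: "x \<ominus> y \<in> PIdl z" if "x \<in> PIdl z" "y \<in> PIdl z" for x y
    unfolding minus_eq using that by (intro Z.a_closed Z.a_inv_closed)
  have step: "(f \<oplus> c \<otimes> g) \<otimes> g \<in> PIdl z \<and> (f \<oplus> c \<otimes> g) \<otimes> f \<in> PIdl z"
    if "c \<in> G 0" "d \<in> G 0" "e \<in> G 0" "d \<noteq> e"
      "(f \<oplus> c \<otimes> g) \<otimes> (f \<oplus> d \<otimes> g) \<in> PIdl z" "(f \<oplus> c \<otimes> g) \<otimes> (f \<oplus> e \<otimes> g) \<in> PIdl z" for c d e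
  proof -
    note R = that(1-3)[THEN G_carrier] fg
    have "(d \<ominus> e) \<otimes> ((f \<oplus> c \<otimes> g) \<otimes> g) = (f \<oplus> c \<otimes> g) \<otimes> (f \<oplus> d \<otimes> g) \<ominus> (f \<oplus> c \<otimes> g) \<otimes> (f \<oplus> e \<otimes> g)"
      using R by algebra
    then have "(d \<ominus> e) \<otimes> ((f \<oplus> c \<otimes> g) \<otimes> g) \<in> PIdl z" using diff[OF that(5,6)] by simp
    then have g: "(f \<oplus> c \<otimes> g) \<otimes> g \<in> PIdl z"
      by (rule cancel_scalar[OF Z diff_nonzero[OF that(2,3,4)], rotated]) (use R in simp)
    have "(f \<oplus> c \<otimes> g) \<otimes> f = (f \<oplus> c \<otimes> g) \<otimes> (f \<oplus> d \<otimes> g) \<ominus> d \<otimes> ((f \<oplus> c \<otimes> g) \<otimes> g)"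
      using R by algebra
    also have "\<dots> \<in> PIdl z" by (rule diff[OF that(5) Z.I_l_closed[OF g R(2)]])
    finally show ?thesis using g by blast
  qed
  note R = cde(1-3)[THEN G_carrier] fg
  have c: "(f \<oplus> c \<otimes> g) \<otimes> g \<in> PIdl z" "(f \<oplus> c \<otimes> g) \<otimes> f \<in> PIdl z" using step[OF cde(1-3,6) prods(1,2)] by auto
  have "(f \<oplus> d \<otimes> g) \<otimes> (f \<oplus> c \<otimes> g) \<in> PIdl z" using prods(1) R by (simp add: m_comm)
  then have d: "(f \<oplus> d \<otimes> g) \<otimes> g \<in> PIdl z" using step[OF cde(2,1,3,5) _ prods(3)] by auto
  have "(c \<ominus> d) \<otimes> (g \<otimes> g) = (f \<oplus> c \<otimes> g) \<otimes> g \<ominus> (f \<oplus> d \<otimes> g) \<otimes> g" using R by algebra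
  then have "(c \<ominus> d) \<otimes> (g \<otimes> g) \<in> PIdl z" using diff[OF c(1) d] by simp
  then have gg: "g \<otimes> g \<in> PIdl z"
    by (rule cancel_scalar[OF Z diff_nonzero[OF cde(1,2,4)], rotated]) (use R in simp)
  have "f \<otimes> g = (f \<oplus> c \<otimes> g) \<otimes> g \<ominus> c \<otimes> (g \<otimes> g)" using R by algebra
  also have "\<dots> \<in> PIdl z" by (rule diff[OF c(1) Z.I_l_closed[OF gg R(1)]])
  finally have fg': "f \<otimes> g \<in> PIdl z" .
  have "f \<otimes> f = (f \<oplus> c \<otimes> g) \<otimes> f \<ominus> c \<otimes> (f \<otimes> g)" using R by algebra
  also have "\<dots> \<in> PIdl z" by (rule diff[OF c(2) Z.I_l_closed[OF fg' R(1)]])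
  finally show ?thesis using fg' gg unfolding closed_products_def by blast
qed

text \<open>Every representative is isomorphic to at most two members of the family, so countably many representatives
  account for countably many parameters only.\<close>

lemma not_countable_type_if_independent_not_closed:
  assumes dim: "krull_dim R = 1" and z: "z \<in> G 1" "nonzerodivisor z" and unc: "uncountable (G 0)"
    and fg: "f \<in> G 1" "g \<in> G 1" "independent3 z f g" "\<not> closed_products z f g"
  shows "\<not> graded_countable_CM_type R G"
proof
  assume "graded_countable_CM_type R G"
  then obtain \<C> :: "('a, (nat \<Rightarrow> 'a) set) graded_mod set" where \<C>: "countable \<C>"
    "\<And>M :: ('a, (nat \<Rightarrow> 'a) set) graded_mod. indecomposable_graded_MCM R G M \<Longrightarrow>
       \<exists>N\<in>\<C>. \<exists>n. graded_isomorphic R M (shift n N)"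
    unfolding graded_countable_CM_type_def by blast
  obtain u v where uv: "u \<in> G 1" "v \<in> G 1" "independent3 z u v" "\<not> closed_products z u v"
    "finite {c \<in> G 0. decomposing z (u \<oplus> c \<otimes> v)}"
    using exists_family_rarely_decomposing[OF z fg] by blast
  define T where "T = {c \<in> G 0. \<not> decomposing z (u \<oplus> c \<otimes> v)}"
  have "G 0 \<subseteq> T \<union> {c \<in> G 0. decomposing z (u \<oplus> c \<otimes> v)}" unfolding T_def by blast
  then have uncT: "uncountable T" using unc countable_finite[OF uv(5)] countable_subset countable_Un by metis
  have F: "u \<oplus> c \<otimes> v \<in> G 1" if "c \<in> T" for c using that uv unfolding T_def by simp
  have "\<exists>N\<in>\<C>. \<exists>\<psi>. \<psi> \<in> module_hom R (mod2 z (u \<oplus> c \<otimes> v)) (fst N) \<and>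
      bij_betw \<psi> (carrier (mod2 z (u \<oplus> c \<otimes> v))) (carrier (fst N))" if c: "c \<in> T" for c
  proof -
    have "indecomposable_graded_MCM R G (gmod2 z (u \<oplus> c \<otimes> v))"
      using indecomposable_gmod2[OF dim z F[OF c]] c unfolding T_def by blast
    then obtain N n where N: "N \<in> \<C>" "graded_isomorphic R (gmod2 z (u \<oplus> c \<otimes> v)) (shift n N)" using \<C>(2) by blast
    obtain N' D where "N = (N', D)" by (cases N)
    then show ?thesis using N by (intro bexI[of _ N]) auto
  qed
  then obtain \<nu> where \<nu>: "\<And>c. c \<in> T \<Longrightarrow> \<nu> c \<in> \<C>"
    "\<And>c. c \<in> T \<Longrightarrow> \<exists>\<psi>. \<psi> \<in> module_hom R (mod2 z (u \<oplus> c \<otimes> v)) (fst (\<nu> c)) \<and>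
      bij_betw \<psi> (carrier (mod2 z (u \<oplus> c \<otimes> v))) (carrier (fst (\<nu> c)))" by metis
  have prod: "(u \<oplus> c \<otimes> v) \<otimes> (u \<oplus> d \<otimes> v) \<in> PIdl z" if cd: "c \<in> T" "d \<in> T" "c \<noteq> d" "\<nu> c = \<nu> d" for c d
  proof -
    have mods: "module R (mod2 z (u \<oplus> c \<otimes> v))" "module R (mod2 z (u \<oplus> d \<otimes> v))"
      using module_emb ideal_ideal2 F cd G_carrier z(1) by blast+
    obtain \<psi>1 \<psi>2 where \<psi>: "\<psi>1 \<in> module_hom R (mod2 z (u \<oplus> c \<otimes> v)) (fst (\<nu> d))"
      "bij_betw \<psi>1 (carrier (mod2 z (u \<oplus> c \<otimes> v))) (carrier (fst (\<nu> d)))"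
      "\<psi>2 \<in> module_hom R (mod2 z (u \<oplus> d \<otimes> v)) (fst (\<nu> d))"
      "bij_betw \<psi>2 (carrier (mod2 z (u \<oplus> d \<otimes> v))) (carrier (fst (\<nu> d)))"
      using \<nu>(2)[OF cd(1)] \<nu>(2)[OF cd(2)] cd(4) by metis
    obtain \<phi> where "\<phi> \<in> module_hom R (mod2 z (u \<oplus> c \<otimes> v)) (mod2 z (u \<oplus> d \<otimes> v))"
      "\<phi> ` carrier (mod2 z (u \<oplus> c \<otimes> v)) = carrier (mod2 z (u \<oplus> d \<otimes> v))"
      using module_hom_between_isomorphic[OF \<psi> mods] .
    then show ?thesis
      using isomorphic_family_members[OF z uv(1-3) _ _ cd(3)] cd(1,2) unfolding T_def by blast
  qed
  have "finite {c \<in> T. \<nu> c = N}" for N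
  proof (rule ccontr)
    assume inf: "infinite {c \<in> T. \<nu> c = N}"
    then obtain B where B: "B \<subseteq> {c \<in> T. \<nu> c = N}" "card B = 3" "finite B"
      using infinite_arbitrarily_large[OF inf, of 3] by blast
    then obtain c d e where cde: "B = {c, d, e}" "c \<noteq> d" "c \<noteq> e" "d \<noteq> e"
      by (auto simp: card_3_iff)
    have in_T: "c \<in> T" "d \<in> T" "e \<in> T" "\<nu> c = \<nu> d" "\<nu> c = \<nu> e" "\<nu> d = \<nu> e" using B(1) cde(1) by auto
    have "closed_products z u v"
    proof (rule closed_products_if_three_products[OF _ _ _ _ _ _ cde(2-4)])
      show "(u \<oplus> c \<otimes> v) \<otimes> (u \<oplus> d \<otimes> v) \<in> PIdl z" "(u \<oplus> c \<otimes> v) \<otimes> (u \<oplus> e \<otimes> v) \<in> PIdl z"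
        "(u \<oplus> d \<otimes> v) \<otimes> (u \<oplus> e \<otimes> v) \<in> PIdl z"
        using prod in_T cde by blast+
      show "z \<in> carrier R" "u \<in> carrier R" "v \<in> carrier R" using z(1) uv(1,2) G_carrier by blast+
      show "c \<in> G 0" "d \<in> G 0" "e \<in> G 0" using in_T unfolding T_def by blast+
    qed
    then show False using uv(4) by blast
  qed
  then have "countable {c \<in> T. \<nu> c = N}" for N by (simp add: countable_finite)
  then have "countable (\<Union>N\<in>\<C>. {c \<in> T. \<nu> c = N})" using \<C>(1) by blast
  moreover have "T \<subseteq> (\<Union>N\<in>\<C>. {c \<in> T. \<nu> c = N})" using \<nu>(1) by blast
  ultimately show False using uncT countable_subset by blast
qed

theorem linear_forms_spanned_by_two:
  assumes "krull_dim R = 1" "gorenstein_ring R" "uncountable (G 0)" "graded_countable_CM_type R G"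
  obtains z x where "z \<in> G 1" "nonzerodivisor z" "x \<in> G 1" "\<And>y. y \<in> G 1 \<Longrightarrow> \<exists>a\<in>G 0. \<exists>b\<in>G 0. y = a \<otimes> z \<oplus> b \<otimes> x"
proof -
  have "infinite (G 0)" using assms(3) countable_finite by blast
  moreover have "cohen_macaulay_ring R" using assms(4) unfolding graded_countable_CM_type_def by blast
  ultimately obtain z where z: "z \<in> G 1" "nonzerodivisor z"
    using exists_linear_nonzerodivisor exists_irrelevant_nonzerodivisor[OF assms(1)] by metis
  have z0: "z \<noteq> \<zero>" using z(2) one_nz by (auto simp: nonzerodivisor_def)
  have "\<not> not_spanned z"
  proof
    assume ns: "not_spanned z"
    obtain x1 x2 where x: "x1 \<in> G 1" "x2 \<in> G 1" "independent3 z x1 x2" using exists_independent3[OF ns z(1) z0] .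
    then obtain x y where xy: "x \<in> G 1" "y \<in> G 1" "x \<otimes> y \<notin> PIdl z"
      using not_gorenstein_if_minimal_multiplicity[OF z x] assms(2) by blast
    obtain f g where "f \<in> G 1" "g \<in> G 1" "independent3 z f g" "\<not> closed_products z f g"
      using exists_independent_not_closed[OF ns z(1) z0 xy] .
    then show False using not_countable_type_if_independent_not_closed[OF assms(1) z assms(3)] assms(4) by blast
  qed
  then show thesis using that z unfolding not_spanned_def by blast
qed

end

section \<open>Polynomial rings\<close>

lemma finite_submultisets: "finite {l. l \<subseteq># (m :: 'c multiset)}"
proof (induction m)
  case (add a m)
  have "{l. l \<subseteq># add_mset a m} \<subseteq> {l. l \<subseteq># m} \<union> add_mset a ` {l. l \<subseteq># m}"
  proof
    fix l assume "l \<in> {l. l \<subseteq># add_mset a m}"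
    then have l: "l \<subseteq># add_mset a m" by simp
    show "l \<in> {l. l \<subseteq># m} \<union> add_mset a ` {l. l \<subseteq># m}"
    proof (cases "a \<in># l")
      case True
      then obtain l' where l': "l = add_mset a l'" by (metis multi_member_split)
      then have "l' \<subseteq># m" using l by simp
      then show ?thesis using l' by blast
    next
      case False
      have "count l x \<le> count m x" for x
        using mset_subset_eq_count[OF l, of x] False by (cases "x = a") (auto simp: not_in_iff)
      then have "l \<subseteq># m" by (rule mset_subset_eqI)
      then show ?thesis by blast
    qed
  qed
  then show ?case using add by (meson finite_UnI finite_imageI finite_subset)
qed simp

locale polynomial_ring = cring R for R (structure) +
  fixes K :: "'a set" and n :: nat
  assumes K: "subring K R"
begin

abbreviation "PR \<equiv> mpoly_ring R K n"
abbreviation "PS \<equiv> indexed_pset {..<n} K"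
definition "pm p q = (\<lambda>m. \<Oplus>l\<in>{l. l \<subseteq># m}. p l \<otimes> q (m - l))"

lemma PR_simps:
  "carrier PR = PS" "p \<otimes>\<^bsub>PR\<^esub> q = pm p q" "\<one>\<^bsub>PR\<^esub> = indexed_const \<one>" "\<zero>\<^bsub>PR\<^esub> = indexed_const \<zero>"
  "p \<oplus>\<^bsub>PR\<^esub> q = indexed_padd p q"
  by (simp_all add: mpoly_ring_def pm_def)

lemma K_carrier: "k \<in> K \<Longrightarrow> k \<in> carrier R"
  using subringE(1)[OF K] by blast

lemma PS_const: "k \<in> K \<Longrightarrow> indexed_const k \<in> PS"
  and PS_padd: "p \<in> PS \<Longrightarrow> q \<in> PS \<Longrightarrow> indexed_padd p q \<in> PS"
  and PS_pmult: "p \<in> PS \<Longrightarrow> i < n \<Longrightarrow> indexed_pmult p i \<in> PS"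
  by (auto intro: indexed_pset.intros)

lemma PS_coeff_K: "p \<in> PS \<Longrightarrow> p m \<in> K"
proof (induction arbitrary: m rule: indexed_pset.induct)
  case (indexed_const k)
  then show ?case using subringE(2)[OF K] by (simp add: indexed_const_def)
next
  case (indexed_padd P Q)
  then show ?case using subringE(7)[OF K] by (simp add: indexed_padd_def)
next
  case (indexed_pmult P i)
  then show ?case using subringE(2)[OF K] by (simp add: indexed_pmult_def)
qed

lemma PS_coeff: "p \<in> PS \<Longrightarrow> p m \<in> carrier R"
  using PS_coeff_K K_carrier by blast

lemma PS_finite_support: "p \<in> PS \<Longrightarrow> finite {m. p m \<noteq> \<zero>}"
proof (induction rule: indexed_pset.induct)
  case (indexed_const k)
  have "{m. indexed_const k m \<noteq> \<zero>} \<subseteq> {{#}}" by (auto simp: indexed_const_def)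
  then show ?case by (rule finite_subset) simp
next
  case (indexed_padd P Q)
  have "{m. indexed_padd P Q m \<noteq> \<zero>} \<subseteq> {m. P m \<noteq> \<zero>} \<union> {m. Q m \<noteq> \<zero>}"
    by (auto simp: indexed_padd_def)
  then show ?case by (rule finite_subset) (use indexed_padd.IH in simp)
next
  case (indexed_pmult P i)
  have "{m. indexed_pmult P i m \<noteq> \<zero>} \<subseteq> add_mset i ` {m. P m \<noteq> \<zero>}"
  proof
    fix m assume "m \<in> {m. indexed_pmult P i m \<noteq> \<zero>}"
    then have "i \<in># m" "P (m - {#i#}) \<noteq> \<zero>" by (auto simp: indexed_pmult_def split: if_splits)
    then show "m \<in> add_mset i ` {m. P m \<noteq> \<zero>}" by (intro image_eqI[of _ _ "m - {#i#}"]) auto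
  qed
  then show ?case by (rule finite_subset) (use indexed_pmult.IH in simp)
qed

lemma PS_support: "p \<in> PS \<Longrightarrow> p m \<noteq> \<zero> \<Longrightarrow> set_mset m \<subseteq> {..<n}"
proof (induction arbitrary: m rule: indexed_pset.induct)
  case (indexed_const k)
  then show ?case by (auto simp: indexed_const_def split: if_splits)
next
  case (indexed_padd P Q)
  then have "P m \<noteq> \<zero> \<or> Q m \<noteq> \<zero>" by (auto simp: indexed_padd_def)
  then show ?case using indexed_padd.IH by blast
next
  case (indexed_pmult P i)
  then have "i \<in># m" "P (m - {#i#}) \<noteq> \<zero>" by (auto simp: indexed_pmult_def split: if_splits)
  then have "set_mset (m - {#i#}) \<subseteq> {..<n}" using indexed_pmult.IH[of "m - {#i#}"] by blast
  moreover have "set_mset m = insert i (set_mset (m - {#i#}))"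
    using \<open>i \<in># m\<close> by (metis insert_DiffM set_mset_add_mset_insert)
  ultimately show ?case using indexed_pmult.hyps(2) by simp
qed

lemma pm_const:
  assumes "k \<in> carrier R" "\<And>m. q m \<in> carrier R"
  shows "pm (indexed_const k) q = (\<lambda>m. k \<otimes> q m)"
proof
  fix m
  have "pm (indexed_const k) q m = (\<Oplus>l\<in>{{#}}. indexed_const k l \<otimes> q (m - l))"
    unfolding pm_def using assms finite_submultisets[of m]
    by (intro add.finprod_mono_neutral_cong_right[simplified]) (auto simp: indexed_const_def)
  then show "pm (indexed_const k) q m = k \<otimes> q m" using assms by (simp add: indexed_const_def)
qed

lemma pm_padd:
  assumes "\<And>m. p m \<in> carrier R" "\<And>m. q m \<in> carrier R" "\<And>m. r m \<in> carrier R"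
  shows "pm (indexed_padd p q) r = indexed_padd (pm p r) (pm q r)"
proof
  fix m
  have "pm (indexed_padd p q) r m = (\<Oplus>l\<in>{l. l \<subseteq># m}. p l \<otimes> r (m - l) \<oplus> q l \<otimes> r (m - l))"
    unfolding pm_def indexed_padd_def using assms by (simp add: l_distr)
  also have "\<dots> = indexed_padd (pm p r) (pm q r) m"
    unfolding pm_def indexed_padd_def using assms by (intro finsum_addf) auto
  finally show "pm (indexed_padd p q) r m = indexed_padd (pm p r) (pm q r) m" .
qed

lemma pm_pmult:
  assumes "\<And>m. p m \<in> carrier R" "\<And>m. q m \<in> carrier R"
  shows "pm (indexed_pmult p i) q = indexed_pmult (pm p q) i"
proof
  fix m
  show "pm (indexed_pmult p i) q m = indexed_pmult (pm p q) i m"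
  proof (cases "i \<in># m")
    case False
    then have "i \<notin># l" if "l \<subseteq># m" for l using that by (meson mset_subset_eqD)
    then have "pm (indexed_pmult p i) q m = (\<Oplus>l\<in>{l. l \<subseteq># m}. \<zero>)"
      unfolding pm_def using assms by (intro finsum_cong') (auto simp: indexed_pmult_def)
    then show ?thesis using False by (simp add: indexed_pmult_def)
  next
    case True
    then obtain m' where m: "m = add_mset i m'" by (metis multi_member_split)
    let ?f = "\<lambda>l. indexed_pmult p i l \<otimes> q (m - l)"
    have inj: "inj_on (add_mset i) A" for A by (auto simp: inj_on_def)
    have sub: "add_mset i ` {l. l \<subseteq># m'} \<subseteq> {l. l \<subseteq># m}" unfolding m by auto
    have zero: "?f l = \<zero>" if "l \<in> {l. l \<subseteq># m} - add_mset i ` {l. l \<subseteq># m'}" for l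
    proof -
      have "i \<notin># l"
      proof
        assume "i \<in># l"
        then obtain l' where "l = add_mset i l'" by (metis multi_member_split)
        then show False using that unfolding m by auto
      qed
      then show ?thesis using assms by (simp add: indexed_pmult_def)
    qed
    have fR: "?f l \<in> carrier R" for l using assms by (simp add: indexed_pmult_def)
    have "pm (indexed_pmult p i) q m = (\<Oplus>l\<in>add_mset i ` {l. l \<subseteq># m'}. ?f l)"
      unfolding pm_def using sub zero fR finite_submultisets[of m]
      by (intro add.finprod_mono_neutral_cong_right[simplified]) auto
    also have "\<dots> = (\<Oplus>l\<in>{l. l \<subseteq># m'}. ?f (add_mset i l))"
      using fR by (intro finsum_reindex inj) auto
    also have "\<dots> = pm p q m'" unfolding pm_def m by (simp add: indexed_pmult_def)
    finally show ?thesis using True m by (simp add: indexed_pmult_def)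
  qed
qed

lemma pm_carrier: "p \<in> PS \<Longrightarrow> q \<in> PS \<Longrightarrow> pm p q m \<in> carrier R"
  unfolding pm_def by (intro finsum_closed) (auto intro: PS_coeff)

lemma const_mult_PS:
  assumes "k \<in> K" "q \<in> PS" shows "(\<lambda>m. k \<otimes> q m) \<in> PS"
  using assms(2)
proof (induction rule: indexed_pset.induct)
  case (indexed_const j)
  have "(\<lambda>m :: nat multiset. k \<otimes> indexed_const j m) = indexed_const (k \<otimes> j)"
    using K_carrier[OF assms(1)] by (auto simp: indexed_const_def)
  then show ?case using subringE(6)[OF K assms(1) indexed_const] PS_const by simp
next
  case (indexed_padd P Q)
  have "(\<lambda>m. k \<otimes> indexed_padd P Q m) = indexed_padd (\<lambda>m. k \<otimes> P m) (\<lambda>m. k \<otimes> Q m)"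
    using K_carrier[OF assms(1)] PS_coeff indexed_padd.hyps by (auto simp: indexed_padd_def r_distr)
  then show ?case using indexed_padd.IH PS_padd by simp
next
  case (indexed_pmult P i)
  have "(\<lambda>m. k \<otimes> indexed_pmult P i m) = indexed_pmult (\<lambda>m. k \<otimes> P m) i"
    using K_carrier[OF assms(1)] by (auto simp: indexed_pmult_def)
  then show ?case using indexed_pmult PS_pmult by simp
qed

lemma pm_closed: "p \<in> PS \<Longrightarrow> q \<in> PS \<Longrightarrow> pm p q \<in> PS"
proof (induction rule: indexed_pset.induct)
  case (indexed_const k)
  then show ?case using pm_const[OF K_carrier[OF indexed_const(1)], of q] PS_coeff const_mult_PS by simp
next
  case (indexed_padd P Q)
  then show ?case using pm_padd[of P Q q] PS_coeff PS_padd by simp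
next
  case (indexed_pmult P i)
  then show ?case using pm_pmult[of P q i] PS_coeff PS_pmult by simp
qed

text \<open>Induction on the construction of \<open>p\<close> from constants by sums and multiplication with variables replaces the
  reindexing of a double sum.\<close>

lemma pm_assoc:
  assumes "p \<in> PS" "q \<in> PS" "r \<in> PS"
  shows "pm (pm p q) r = pm p (pm q r)"
  using assms(1)
proof (induction rule: indexed_pset.induct)
  case (indexed_const k)
  note kR = K_carrier[OF indexed_const]
  have "pm (pm (indexed_const k) q) r = (\<lambda>m. \<Oplus>l\<in>{l. l \<subseteq># m}. k \<otimes> (q l \<otimes> r (m - l)))"
    unfolding pm_const[OF kR PS_coeff[OF assms(2)]] using kR PS_coeff[OF assms(2)] PS_coeff[OF assms(3)]
    by (simp add: pm_def m_assoc)
  also have "\<dots> = (\<lambda>m. k \<otimes> pm q r m)"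
    unfolding pm_def using kR PS_coeff[OF assms(2)] PS_coeff[OF assms(3)] finite_submultisets
    by (subst finsum_rdistr) auto
  also have "\<dots> = pm (indexed_const k) (pm q r)"
    by (rule pm_const[OF kR pm_carrier[OF assms(2,3)], symmetric])
  finally show ?case .
next
  case (indexed_padd P Q)
  then show ?case
    using pm_padd[of P Q q] pm_padd[of P Q "pm q r"] pm_padd[of "pm P q" "pm Q q" r] PS_coeff pm_carrier assms by simp
next
  case (indexed_pmult P i)
  then show ?case
    using pm_pmult[of P q i] pm_pmult[of P "pm q r" i] pm_pmult[of "pm P q" r i] PS_coeff pm_carrier assms by simp
qed

lemma pm_comm:
  assumes "p \<in> PS" "q \<in> PS" shows "pm p q = pm q p"
proof
  fix m :: "nat multiset"
  have inj: "inj_on (\<lambda>l. m - l) {l. l \<subseteq># m}"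
    by (rule inj_onI) (metis diff_union_cancelL mem_Collect_eq subset_mset.diff_add)
  have im: "(\<lambda>l. m - l) ` {l. l \<subseteq># m} = {l. l \<subseteq># m}"
  proof (intro equalityI subsetI)
    fix l assume "l \<in> {l. l \<subseteq># m}"
    then have "l = m - (m - l)" "m - l \<subseteq># m"
      by (simp_all add: subset_mset.diff_diff_right)
    then show "l \<in> (\<lambda>l. m - l) ` {l. l \<subseteq># m}" by blast
  qed auto
  have "pm p q m = (\<Oplus>l\<in>(\<lambda>l. m - l) ` {l. l \<subseteq># m}. p l \<otimes> q (m - l))" unfolding pm_def im ..
  also have "\<dots> = (\<Oplus>l\<in>{l. l \<subseteq># m}. p (m - l) \<otimes> q (m - (m - l)))"
    using assms PS_coeff by (intro finsum_reindex inj) auto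
  also have "\<dots> = pm q p m"
    unfolding pm_def
  proof (rule finsum_cong')
    fix l assume "l \<in> {l. l \<subseteq># m}"
    then have "m - (m - l) = l" by (simp add: subset_mset.diff_diff_right)
    then show "p (m - l) \<otimes> q (m - (m - l)) = q l \<otimes> p (m - l)"
      using PS_coeff assms m_comm by simp
  qed (use assms PS_coeff in auto)
  finally show "pm p q m = pm q p m" .
qed

lemma cring_PR: "cring PR"
proof (rule cringI)
  show "abelian_group PR"
  proof (rule abelian_groupI, unfold PR_simps)
    fix p assume p: "p \<in> PS"
    let ?q = "\<lambda>m. (\<ominus> \<one>) \<otimes> p m"
    have "\<ominus> \<one> \<in> K" using subringE(3,5)[OF K] by blast
    then have "?q \<in> PS" using const_mult_PS p by blast
    moreover have "indexed_padd ?q p = indexed_const \<zero>"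
      using PS_coeff[OF p] by (auto simp: indexed_padd_def indexed_const_def l_minus l_neg)
    ultimately show "\<exists>q\<in>PS. indexed_padd q p = indexed_const \<zero>" by blast
    show "indexed_padd (indexed_const \<zero>) p = p"
      using PS_coeff[OF p] by (auto simp: indexed_padd_def indexed_const_def)
  qed (auto simp: indexed_padd_def a_ac PS_coeff subringE(2)[OF K]
      intro: PS_const PS_padd[unfolded indexed_padd_def])
  show "comm_monoid PR"
  proof (rule comm_monoidI, unfold PR_simps)
    fix p assume p: "p \<in> PS"
    show "pm (indexed_const \<one>) p = p" using pm_const[of \<one> p] PS_coeff[OF p] by simp
  qed (auto intro: pm_closed PS_const subringE(3)[OF K] pm_assoc pm_comm)
  show "(p \<oplus>\<^bsub>PR\<^esub> q) \<otimes>\<^bsub>PR\<^esub> r = p \<otimes>\<^bsub>PR\<^esub> r \<oplus>\<^bsub>PR\<^esub> q \<otimes>\<^bsub>PR\<^esub> r"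
    if "p \<in> carrier PR" "q \<in> carrier PR" "r \<in> carrier PR" for p q r
    using that pm_padd[of p q r] PS_coeff by (simp add: PR_simps)
qed

sublocale PR: cring PR by (rule cring_PR)

definition var where "var i = indexed_pmult (indexed_const \<one>) i"
abbreviation const where "const k \<equiv> indexed_const k"

lemma const_closed [simp]: "k \<in> K \<Longrightarrow> const k \<in> carrier PR"
  by (simp add: PR_simps PS_const)

lemma var_closed [simp]: "i < n \<Longrightarrow> var i \<in> carrier PR"
  unfolding var_def PR_simps using subringE(3)[OF K] by (intro indexed_pset.intros) auto

lemma pmult_eq_var:
  assumes "p \<in> carrier PR" "i < n"
  shows "indexed_pmult p i = p \<otimes>\<^bsub>PR\<^esub> var i"
proof -
  have p: "p \<in> PS" and v: "var i \<in> PS" using assms(1) var_closed[OF assms(2)] by (simp_all add: PR_simps)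
  have "pm p (var i) = pm (var i) p" by (rule pm_comm[OF p v])
  also have "\<dots> = indexed_pmult (pm (const \<one>) p) i"
    unfolding var_def using PS_coeff[OF p] by (intro pm_pmult) (auto simp: indexed_const_def)
  also have "pm (const \<one>) p = p" using pm_const[of \<one> p] PS_coeff[OF p] by simp
  finally show ?thesis by (simp add: PR_simps)
qed

abbreviation "PG \<equiv> mpoly_grading R K n"

lemma PG_iff: "p \<in> PG i \<longleftrightarrow> p \<in> carrier PR \<and> (\<forall>m. p m \<noteq> \<zero> \<longrightarrow> size m = i)"
  by (simp add: mpoly_grading_def)

definition hpart where "hpart i p = (\<lambda>m. if size m = i then p m else \<zero>)"

lemma hpart_const: "hpart i (const k) = (if i = 0 then const k else const \<zero>)"
  by (auto simp: hpart_def indexed_const_def)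

lemma hpart_padd: "hpart i (indexed_padd p q) = indexed_padd (hpart i p) (hpart i q)"
  by (auto simp: hpart_def indexed_padd_def)

lemma hpart_pmult: "hpart i (indexed_pmult p j) = (if i = 0 then const \<zero> else indexed_pmult (hpart (i - 1) p) j)"
proof
  fix m
  have "size (m - {#j#}) = i - 1 \<longleftrightarrow> size m = i" if j: "j \<in># m" "i \<noteq> 0"
  proof -
    obtain m' where "m = add_mset j m'" using j(1) by (metis multi_member_split)
    then show ?thesis using j(2) by auto
  qed
  moreover have "size m \<noteq> 0" if "j \<in># m" using that by auto
  ultimately show "hpart i (indexed_pmult p j) m = (if i = 0 then const \<zero> else indexed_pmult (hpart (i - 1) p) j) m"
    by (auto simp: hpart_def indexed_pmult_def indexed_const_def)
qed

lemma zero_PS: "const \<zero> \<in> PS"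
  using subringE(2)[OF K] by (rule PS_const)

lemma hpart_PS: "p \<in> PS \<Longrightarrow> hpart i p \<in> PS"
proof (induction arbitrary: i rule: indexed_pset.induct)
  case (indexed_const k)
  then show ?case using zero_PS PS_const by (simp add: hpart_const)
next
  case (indexed_padd P Q)
  then show ?case using PS_padd by (simp add: hpart_padd)
next
  case (indexed_pmult P j)
  then show ?case using PS_pmult zero_PS by (simp add: hpart_pmult)
qed

lemma hpart_PG: "p \<in> carrier PR \<Longrightarrow> hpart i p \<in> PG i"
  using hpart_PS by (auto simp: PG_iff PR_simps hpart_def)

lemma PG_mult:
  assumes "p \<in> PG i" "q \<in> PG j" shows "p \<otimes>\<^bsub>PR\<^esub> q \<in> PG (i + j)"
proof -
  have c: "p \<in> PS" "q \<in> PS" using assms by (auto simp: PG_iff PR_simps)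
  have "pm p q m = \<zero>" if "size m \<noteq> i + j" for m
  proof -
    have "p l \<otimes> q (m - l) = \<zero>" if l: "l \<subseteq># m" for l
    proof (cases "p l = \<zero>")
      case True
      then show ?thesis using PS_coeff[OF c(2)] by simp
    next
      case False
      then have "size l = i" using assms(1) by (simp add: PG_iff)
      then have "size (m - l) \<noteq> j" using \<open>size m \<noteq> i + j\<close> l size_Diff_submset[OF l] size_mset_mono[OF l] by linarith
      then have "q (m - l) = \<zero>" using assms(2) by (auto simp: PG_iff)
      then show ?thesis using PS_coeff[OF c(1)] by simp
    qed
    then have "pm p q m = (\<Oplus>l\<in>{l. l \<subseteq># m}. \<zero>)" unfolding pm_def by (intro finsum_cong') auto
    then show ?thesis by simp
  qed
  then show ?thesis using pm_closed[OF c] by (auto simp: PG_iff PR_simps)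
qed

lemma PG_add: "p \<in> PG i \<Longrightarrow> q \<in> PG i \<Longrightarrow> p \<oplus>\<^bsub>PR\<^esub> q \<in> PG i"
proof -
  assume p: "p \<in> PG i" and q: "q \<in> PG i"
  have "size m = i" if m: "(p \<oplus>\<^bsub>PR\<^esub> q) m \<noteq> \<zero>" for m
  proof (rule ccontr)
    assume "size m \<noteq> i"
    then have "p m = \<zero>" "q m = \<zero>" using p q by (auto simp: PG_iff)
    then show False using m by (simp add: PR_simps indexed_padd_def)
  qed
  then show ?thesis using p q by (auto simp: PG_iff)
qed

lemma PG_const: "k \<in> K \<Longrightarrow> const k \<in> PG 0"
  using const_closed[of k] unfolding PG_iff by (auto simp: indexed_const_def)

lemma PG_zero: "\<zero>\<^bsub>PR\<^esub> \<in> PG i"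
  using zero_PS by (auto simp: PG_iff PR_simps indexed_const_def)

lemma PG_var: "i < n \<Longrightarrow> var i \<in> PG 1"
proof -
  assume i: "i < n"
  have "size m = 1" if "var i m \<noteq> \<zero>" for m
  proof -
    have "i \<in># m" "m - {#i#} = {#}" using that
      by (auto simp: var_def indexed_pmult_def indexed_const_def split: if_splits)
    then have "m = {#i#}" by (metis insert_DiffM)
    then show ?thesis by simp
  qed
  then show ?thesis using var_closed[OF i] unfolding PG_iff by blast
qed

lemma PG_carrier: "p \<in> PG i \<Longrightarrow> p \<in> carrier PR"
  by (simp add: PG_iff)

lemma PG_var_pow: "i < n \<Longrightarrow> var i [^]\<^bsub>PR\<^esub> (j::nat) \<in> PG j"
proof (induction j)
  case 0
  show ?case using PG_const[OF subringE(3)[OF K]] by (simp add: PR_simps)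
next
  case (Suc j)
  then show ?case using PG_mult[of _ j _ 1] PG_var by simp
qed

lemma PG_minus: "p \<in> PG i \<Longrightarrow> \<ominus>\<^bsub>PR\<^esub> p \<in> PG i"
proof -
  assume p: "p \<in> PG i"
  have k: "\<ominus> \<one> \<in> K" using subringE(3,5)[OF K] by blast
  have "const (\<ominus> \<one>) \<oplus>\<^bsub>PR\<^esub> \<one>\<^bsub>PR\<^esub> = \<zero>\<^bsub>PR\<^esub>"
    by (auto simp: PR_simps indexed_padd_def indexed_const_def l_neg)
  then have "const (\<ominus> \<one>) = \<ominus>\<^bsub>PR\<^esub> \<one>\<^bsub>PR\<^esub>" using PR.minus_equality[of "const (\<ominus> \<one>)" "\<one>\<^bsub>PR\<^esub>"] k by simp
  then have "\<ominus>\<^bsub>PR\<^esub> p = const (\<ominus> \<one>) \<otimes>\<^bsub>PR\<^esub> p" using PG_carrier[OF p] by (simp add: PR.l_minus)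
  then show ?thesis using PG_mult[OF PG_const[OF k] p] by simp
qed

lemma PG_irrelevant:
  assumes "p \<in> PG d" "d \<noteq> 0" shows "p \<in> irrelevant_ideal PR PG"
  unfolding irrelevant_ideal_def
  using assms PG_carrier[OF assms(1)] by (intro CollectI exI[of _ "{d}"] exI[of _ "\<lambda>_. p"]) simp

lemma var_pow_coeff:
  assumes "i < n" shows "(var i [^]\<^bsub>PR\<^esub> (j::nat)) m = (if m = replicate_mset j i then \<one> else \<zero>)"
proof (induction j arbitrary: m)
  case 0
  show ?case by (simp add: PR_simps indexed_const_def)
next
  case (Suc j)
  have "var i [^]\<^bsub>PR\<^esub> Suc j = indexed_pmult (var i [^]\<^bsub>PR\<^esub> j) i"
    using assms by (simp add: pmult_eq_var)
  then have "(var i [^]\<^bsub>PR\<^esub> Suc j) m = (if i \<in># m \<and> m - {#i#} = replicate_mset j i then \<one> else \<zero>)"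
    unfolding indexed_pmult_def Suc.IH by simp
  moreover have "i \<in># m \<and> m - {#i#} = replicate_mset j i \<longleftrightarrow> m = replicate_mset (Suc j) i"
  proof
    assume "i \<in># m \<and> m - {#i#} = replicate_mset j i"
    then show "m = replicate_mset (Suc j) i" using insert_DiffM[of i m] by simp
  qed simp
  ultimately show ?case by simp
qed

end

section \<open>Presenting the ring by one equation\<close>

context standard_graded
begin

lemma subring_G0: "subring (G 0) R"
  using subfield_G0 by (meson subcring.axioms(1) subdomain.axioms(1) subfield.axioms(1))

end

locale spanned_by_two = standard_graded +
  fixes z x
  assumes z: "z \<in> G 1" and nzd: "nonzerodivisor z" and x: "x \<in> G 1"
    and span: "y \<in> G 1 \<Longrightarrow> \<exists>a\<in>G 0. \<exists>b\<in>G 0. y = a \<otimes> z \<oplus> b \<otimes> x"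

sublocale spanned_by_two \<subseteq> P: polynomial_ring R "G 0" 2
  by (intro polynomial_ring.intro polynomial_ring_axioms.intro is_cring subring_G0)

context spanned_by_two
begin

abbreviation "S \<equiv> mpoly_ring R (G 0) 2"
abbreviation "SG \<equiv> mpoly_grading R (G 0) 2"

lemma zx_carrier [simp]: "z \<in> carrier R" "x \<in> carrier R"
  using z x G_carrier by blast+

text \<open>\<open>ev\<close> is the evaluation \<open>y\<^sub>0 \<mapsto> z\<close>, \<open>y\<^sub>1 \<mapsto> x\<close>; \<open>mon\<close> gives the values of the monomials.\<close>

definition val where "val i = (if i = (0::nat) then z else x)"
definition mon where "mon m = z [^] count m 0 \<otimes> x [^] count m (1::nat)"
definition ev where "ev p = (\<Oplus>m\<in>{m. p m \<noteq> \<zero>}. p m \<otimes> mon m)"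

lemma mon_carrier [simp]: "mon m \<in> carrier R"
  by (simp add: mon_def)

lemma val_carrier [simp]: "val i \<in> carrier R" "val i \<in> G 1"
  using z x by (simp_all add: val_def)

lemma mon_add: "i < 2 \<Longrightarrow> mon (add_mset i m) = mon m \<otimes> val i"
proof -
  assume "i < 2"
  then have "i = 0 \<or> i = 1" by auto
  then show ?thesis by (auto simp: mon_def val_def m_ac)
qed

lemma ev_eq:
  assumes "finite A" "\<And>m. m \<notin> A \<Longrightarrow> p m = \<zero>" "\<And>m. p m \<in> carrier R"
  shows "ev p = (\<Oplus>m\<in>A. p m \<otimes> mon m)"
  unfolding ev_def by (rule add.finprod_mono_neutral_cong_left[simplified]) (use assms in auto)

lemma ev_closed: "p \<in> carrier S \<Longrightarrow> ev p \<in> carrier R"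
  unfolding ev_def using P.PS_coeff by (intro finsum_closed) (auto simp: P.PR_simps)

lemma ev_const:
  assumes "k \<in> G 0" shows "ev (indexed_const k) = k"
proof -
  note kR = G_carrier[OF assms]
  have "ev (indexed_const k) = (\<Oplus>m\<in>{{#}}. indexed_const k m \<otimes> mon m)"
    by (rule ev_eq) (use kR in \<open>auto simp: indexed_const_def\<close>)
  then show ?thesis using kR by (simp add: indexed_const_def mon_def)
qed

lemma ev_add:
  assumes "p \<in> carrier S" "q \<in> carrier S" shows "ev (p \<oplus>\<^bsub>S\<^esub> q) = ev p \<oplus> ev q"
proof -
  have c: "p \<in> P.PS" "q \<in> P.PS" using assms by (simp_all add: P.PR_simps)
  let ?A = "{m. p m \<noteq> \<zero>} \<union> {m. q m \<noteq> \<zero>}"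
  have A: "finite ?A" using P.PS_finite_support c by simp
  note co = P.PS_coeff[OF c(1)] P.PS_coeff[OF c(2)]
  have "ev (p \<oplus>\<^bsub>S\<^esub> q) = (\<Oplus>m\<in>?A. (p \<oplus>\<^bsub>S\<^esub> q) m \<otimes> mon m)"
    by (rule ev_eq[OF A]) (use co in \<open>auto simp: P.PR_simps indexed_padd_def\<close>)
  also have "\<dots> = (\<Oplus>m\<in>?A. p m \<otimes> mon m \<oplus> q m \<otimes> mon m)"
    using co by (intro finsum_cong') (auto simp: P.PR_simps indexed_padd_def l_distr)
  also have "\<dots> = (\<Oplus>m\<in>?A. p m \<otimes> mon m) \<oplus> (\<Oplus>m\<in>?A. q m \<otimes> mon m)"
    using co by (intro finsum_addf) auto
  also have "(\<Oplus>m\<in>?A. p m \<otimes> mon m) = ev p" by (rule ev_eq[OF A, symmetric]) (use co in auto)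
  also have "(\<Oplus>m\<in>?A. q m \<otimes> mon m) = ev q" by (rule ev_eq[OF A, symmetric]) (use co in auto)
  finally show ?thesis .
qed

lemma ev_pmult:
  assumes "p \<in> P.PS" "i < 2" shows "ev (indexed_pmult p i) = ev p \<otimes> val i"
proof -
  let ?A = "{m. p m \<noteq> \<zero>}"
  have A: "finite ?A" using P.PS_finite_support[OF assms(1)] .
  note co = P.PS_coeff[OF assms(1)]
  have inj: "inj_on (add_mset i) ?A" by (auto simp: inj_on_def)
  have zero: "indexed_pmult p i m = \<zero>" if "m \<notin> add_mset i ` ?A" for m
  proof (cases "i \<in># m")
    case True
    then have "m = add_mset i (m - {#i#})" by simp
    then have "m - {#i#} \<notin> ?A" using that by blast
    then show ?thesis by (simp add: indexed_pmult_def)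
  qed (simp add: indexed_pmult_def)
  have "ev (indexed_pmult p i) = (\<Oplus>m\<in>add_mset i ` ?A. indexed_pmult p i m \<otimes> mon m)"
    by (rule ev_eq) (use A zero co in \<open>auto simp: indexed_pmult_def\<close>)
  also have "\<dots> = (\<Oplus>m\<in>?A. indexed_pmult p i (add_mset i m) \<otimes> mon (add_mset i m))"
    using co by (intro finsum_reindex inj) (auto simp: indexed_pmult_def)
  also have "\<dots> = (\<Oplus>m\<in>?A. (p m \<otimes> mon m) \<otimes> val i)"
    using co assms(2) by (intro finsum_cong') (auto simp: indexed_pmult_def mon_add m_assoc)
  also have "\<dots> = ev p \<otimes> val i"
    unfolding ev_def using A co by (intro finsum_ldistr[symmetric]) auto
  finally show ?thesis .
qed

lemma ev_mult:
  assumes "p \<in> carrier S" "q \<in> carrier S" shows "ev (p \<otimes>\<^bsub>S\<^esub> q) = ev p \<otimes> ev q"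
proof -
  have c: "p \<in> P.PS" "q \<in> P.PS" using assms by (simp_all add: P.PR_simps)
  note qR = ev_closed[OF assms(2)]
  have "ev (P.pm p q) = ev p \<otimes> ev q"
    using c(1)
  proof (induction rule: indexed_pset.induct)
    case (indexed_const k)
    note kR = G_carrier[OF indexed_const]
    have "ev (P.pm (indexed_const k) q) = (\<Oplus>m\<in>{m. q m \<noteq> \<zero>}. (k \<otimes> q m) \<otimes> mon m)"
      unfolding P.pm_const[OF kR P.PS_coeff[OF c(2)]]
      by (rule ev_eq) (use P.PS_finite_support[OF c(2)] P.PS_coeff[OF c(2)] kR in auto)
    also have "\<dots> = (\<Oplus>m\<in>{m. q m \<noteq> \<zero>}. k \<otimes> (q m \<otimes> mon m))"
      using kR P.PS_coeff[OF c(2)] by (intro finsum_cong') (auto simp: m_assoc)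
    also have "\<dots> = k \<otimes> ev q"
      unfolding ev_def using kR P.PS_coeff[OF c(2)] P.PS_finite_support[OF c(2)] by (intro finsum_rdistr[symmetric]) auto
    finally show ?case using ev_const[OF indexed_const] by simp
  next
    case (indexed_padd A B)
    have AB: "A \<in> carrier S" "B \<in> carrier S" "P.pm A q \<in> carrier S" "P.pm B q \<in> carrier S"
      using indexed_padd.hyps P.pm_closed c(2) by (simp_all add: P.PR_simps)
    have "ev (P.pm (indexed_padd A B) q) = ev (P.pm A q \<oplus>\<^bsub>S\<^esub> P.pm B q)"
      using P.pm_padd[of A B q] P.PS_coeff indexed_padd.hyps c(2) by (simp add: P.PR_simps)
    also have "\<dots> = (ev A \<oplus> ev B) \<otimes> ev q"
      using ev_add[OF AB(3,4)] indexed_padd.IH ev_closed AB(1,2) qR by (simp add: l_distr)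
    also have "ev A \<oplus> ev B = ev (indexed_padd A B)" using ev_add[OF AB(1,2)] by (simp add: P.PR_simps)
    finally show ?case .
  next
    case (indexed_pmult A i)
    then have i: "i < 2" by simp
    have AR: "ev A \<in> carrier R" using ev_closed indexed_pmult.hyps(1) by (simp add: P.PR_simps)
    have "ev (P.pm (indexed_pmult A i) q) = ev (indexed_pmult (P.pm A q) i)"
      using P.pm_pmult[of A q i] P.PS_coeff indexed_pmult.hyps(1) c(2) by simp
    also have "\<dots> = ev (P.pm A q) \<otimes> val i" by (rule ev_pmult[OF P.pm_closed[OF indexed_pmult.hyps(1) c(2)] i])
    also have "\<dots> = (ev A \<otimes> val i) \<otimes> ev q" unfolding indexed_pmult.IH using AR qR by (simp add: m_ac)
    also have "ev A \<otimes> val i = ev (indexed_pmult A i)" by (rule ev_pmult[OF indexed_pmult.hyps(1) i, symmetric])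
    finally show ?case .
  qed
  then show ?thesis by (simp add: P.PR_simps)
qed

lemma ring_hom_ev: "ring_hom_ring S R ev"
  by (rule ring_hom_ringI[OF P.PR.ring_axioms ring_axioms])
    (use ev_closed ev_mult ev_add ev_const[OF G_one] in \<open>simp_all add: P.PR_simps(3)\<close>)

sublocale ev: ring_hom_ring S R ev by (rule ring_hom_ev)

lemma ev_var: "i < 2 \<Longrightarrow> ev (P.var i) = val i"
  unfolding P.var_def using ev_pmult[of "indexed_const \<one>" i] ev_const[OF G_one] P.PS_const[OF G_one] by simp

lemma ev_surj: "ev ` carrier S = carrier R"
proof
  show "ev ` carrier S \<subseteq> carrier R" using ev_closed by blast
  have "y \<in> ev ` carrier S" if "y \<in> generate_ring R (G 0 \<union> G 1)" for y
    using that
  proof (induction rule: generate_ring.induct)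
    case one
    show ?case using ev.hom_one P.PR.one_closed by (metis image_eqI)
  next
    case (incl h)
    then show ?case
    proof
      assume "h \<in> G 0"
      then show ?thesis using ev_const P.const_closed by (metis image_eqI)
    next
      assume "h \<in> G 1"
      then obtain a b where ab: "a \<in> G 0" "b \<in> G 0" "h = a \<otimes> z \<oplus> b \<otimes> x" using span by blast
      let ?p = "indexed_const a \<otimes>\<^bsub>S\<^esub> P.var 0 \<oplus>\<^bsub>S\<^esub> indexed_const b \<otimes>\<^bsub>S\<^esub> P.var 1"
      have "ev ?p = h" using ab ev_const ev_var by (simp add: val_def)
      moreover have "?p \<in> carrier S" using ab by simp
      ultimately show ?thesis by blast
    qed
  next
    case (a_inv h)
    then obtain p where "p \<in> carrier S" "h = ev p" by blast
    then have "\<ominus> h = ev (\<ominus>\<^bsub>S\<^esub> p)" "\<ominus>\<^bsub>S\<^esub> p \<in> carrier S" by simp_all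
    then show ?case by blast
  next
    case (eng_add h k)
    then obtain p q where "p \<in> carrier S" "h = ev p" "q \<in> carrier S" "k = ev q" by blast
    then have "h \<oplus> k = ev (p \<oplus>\<^bsub>S\<^esub> q)" "p \<oplus>\<^bsub>S\<^esub> q \<in> carrier S" by simp_all
    then show ?case by blast
  next
    case (eng_mult h k)
    then obtain p q where "p \<in> carrier S" "h = ev p" "q \<in> carrier S" "k = ev q" by blast
    then have "h \<otimes> k = ev (p \<otimes>\<^bsub>S\<^esub> q)" "p \<otimes>\<^bsub>S\<^esub> q \<in> carrier S" by simp_all
    then show ?case by blast
  qed
  then show "carrier R \<subseteq> ev ` carrier S" unfolding generated by blast
qed

lemma ev_hpart:
  assumes "p \<in> carrier S" shows "comp (ev p) i = ev (P.hpart i p)"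
proof -
  have "p \<in> P.PS" using assms by (simp add: P.PR_simps)
  then show ?thesis
  proof (induction arbitrary: i rule: indexed_pset.induct)
    case (indexed_const k)
    then show ?case using ev_const[of k] ev_const[OF G_zero] by (simp add: P.hpart_const comp_homogeneous)
  next
    case (indexed_padd A B)
    have AB: "A \<in> carrier S" "B \<in> carrier S" "P.hpart i A \<in> carrier S" "P.hpart i B \<in> carrier S"
      using indexed_padd.hyps P.hpart_PS by (simp_all add: P.PR_simps)
    have "comp (ev (indexed_padd A B)) i = comp (ev A \<oplus> ev B) i" using ev_add[OF AB(1,2)] by (simp add: P.PR_simps)
    also have "\<dots> = ev (P.hpart i A) \<oplus> ev (P.hpart i B)"
      using comp_add[OF ev_closed[OF AB(1)] ev_closed[OF AB(2)]] indexed_padd.IH by simp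
    also have "\<dots> = ev (P.hpart i (indexed_padd A B))"
      using ev_add[OF AB(3,4)] by (simp add: P.PR_simps P.hpart_padd)
    finally show ?case .
  next
    case (indexed_pmult A j)
    then have j: "j < 2" by simp
    have AR: "ev A \<in> carrier R" using ev_closed indexed_pmult.hyps(1) by (simp add: P.PR_simps)
    have "comp (ev (indexed_pmult A j)) i = comp (val j \<otimes> ev A) i"
      using ev_pmult[OF indexed_pmult.hyps(1) j] AR by (simp add: m_comm)
    also have "\<dots> = (if 1 \<le> i then val j \<otimes> comp (ev A) (i - 1) else \<zero>)"
      by (rule comp_homogeneous_mult[OF val_carrier(2) AR])
    also have "\<dots> = ev (P.hpart i (indexed_pmult A j))"
    proof (cases "i = 0")
      case True
      then show ?thesis using ev_const[OF G_zero] by (simp add: P.hpart_pmult)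
    next
      case False
      have "P.hpart (i - 1) A \<in> P.PS" by (rule P.hpart_PS[OF indexed_pmult.hyps(1)])
      then show ?thesis
        using False ev_pmult[OF _ j, of "P.hpart (i - 1) A"] indexed_pmult.IH[of "i - 1"] comp_carrier[OF AR, of "i - 1"]
        by (simp add: P.hpart_pmult m_comm)
    qed
    finally show ?case .
  qed
qed

lemma hpart_self: "p \<in> SG i \<Longrightarrow> P.hpart i p = p"
proof
  fix m assume "p \<in> SG i"
  then show "P.hpart i p m = p m" by (cases "p m = \<zero>") (simp_all add: P.PG_iff P.hpart_def)
qed

lemma ev_graded: "ev ` SG i = G i"
proof (intro equalityI subsetI)
  fix y assume "y \<in> ev ` SG i"
  then obtain p where p: "p \<in> SG i" "y = ev p" by blast
  note pS = P.PG_carrier[OF p(1)]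
  show "y \<in> G i" using ev_hpart[OF pS, of i] hpart_self[OF p(1)] comp_in[OF ev_closed[OF pS], of i] p(2) by simp
next
  fix y assume y: "y \<in> G i"
  then obtain p where p: "p \<in> carrier S" "y = ev p" using ev_surj G_carrier by blast
  have "y = ev (P.hpart i p)" using ev_hpart[OF p(1), of i] p(2) y by simp
  then show "y \<in> ev ` SG i" using P.hpart_PG[OF p(1)] by blast
qed

subsection \<open>The kernel is principal\<close>

lemma divide_var0:
  assumes "p \<in> P.PS" shows "(\<lambda>m. p (add_mset 0 m)) \<in> P.PS"
  using assms
proof (induction rule: indexed_pset.induct)
  case (indexed_const k)
  have "(\<lambda>m. indexed_const k (add_mset (0::nat) m)) = indexed_const \<zero>" by (auto simp: indexed_const_def)
  then show ?case using P.zero_PS by simp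
next
  case (indexed_padd A B)
  have "(\<lambda>m. indexed_padd A B (add_mset 0 m)) = indexed_padd (\<lambda>m. A (add_mset 0 m)) (\<lambda>m. B (add_mset 0 m))"
    by (simp add: indexed_padd_def)
  then show ?case using P.PS_padd[OF indexed_padd.IH] by simp
next
  case (indexed_pmult A i)
  show ?case
  proof (cases "i = 0")
    case True
    have "(\<lambda>m. indexed_pmult A i (add_mset 0 m)) = A" using True by (simp add: indexed_pmult_def)
    then show ?thesis using indexed_pmult.hyps(1) by simp
  next
    case False
    have "(\<lambda>m. indexed_pmult A i (add_mset 0 m)) = indexed_pmult (\<lambda>m. A (add_mset 0 m)) i"
      using False by (auto simp: indexed_pmult_def fun_eq_iff)
    then show ?thesis using P.PS_pmult[OF indexed_pmult.IH, of i] indexed_pmult.hyps(2) by simp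
  qed
qed

lemma homogeneous_decomposition:
  assumes "p \<in> SG i"
  obtains a p' where "a \<in> G 0" "p' \<in> SG (i - 1)" "i = 0 \<Longrightarrow> p' = \<zero>\<^bsub>S\<^esub>"
    "p = p' \<otimes>\<^bsub>S\<^esub> P.var 0 \<oplus>\<^bsub>S\<^esub> indexed_const a \<otimes>\<^bsub>S\<^esub> P.var 1 [^]\<^bsub>S\<^esub> i"
proof -
  have pP: "p \<in> P.PS" and hom: "\<And>m. p m \<noteq> \<zero> \<Longrightarrow> size m = i" using assms by (auto simp: P.PG_iff P.PR_simps)
  define p' where "p' = (\<lambda>m. p (add_mset 0 m))"
  define a where "a = p (replicate_mset i 1)"
  have aG: "a \<in> G 0" unfolding a_def by (rule P.PS_coeff_K[OF pP])
  have p'P: "p' \<in> P.PS" unfolding p'_def by (rule divide_var0[OF pP])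
  have hom': "size m = i - 1 \<and> i \<noteq> 0" if "p' m \<noteq> \<zero>" for m
    using hom[of "add_mset 0 m"] that by (auto simp: p'_def)
  have "p' \<in> SG (i - 1)" using p'P hom' by (simp add: P.PG_iff P.PR_simps)
  moreover have "p' = \<zero>\<^bsub>S\<^esub>" if "i = 0" using hom' that by (auto simp: P.PR_simps indexed_const_def fun_eq_iff)
  moreover have "p = p' \<otimes>\<^bsub>S\<^esub> P.var 0 \<oplus>\<^bsub>S\<^esub> indexed_const a \<otimes>\<^bsub>S\<^esub> P.var 1 [^]\<^bsub>S\<^esub> i"
  proof
    fix m
    have 1: "(p' \<otimes>\<^bsub>S\<^esub> P.var 0) m = (if 0 \<in># m then p m else \<zero>)"
      using P.pmult_eq_var[of p' 0] p'P by (simp add: P.PR_simps(1) indexed_pmult_def p'_def flip: P.pmult_eq_var)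
    have v: "P.var 1 [^]\<^bsub>S\<^esub> i \<in> carrier S" by simp
    then have "(indexed_const a \<otimes>\<^bsub>S\<^esub> P.var 1 [^]\<^bsub>S\<^esub> i) m = a \<otimes> (P.var 1 [^]\<^bsub>S\<^esub> i) m"
      using P.pm_const[OF G_carrier[OF aG], of "P.var 1 [^]\<^bsub>S\<^esub> i"] P.PS_coeff by (simp add: P.PR_simps(1,2))
    then have 2: "(indexed_const a \<otimes>\<^bsub>S\<^esub> P.var 1 [^]\<^bsub>S\<^esub> i) m = (if m = replicate_mset i 1 then a else \<zero>)"
      using P.var_pow_coeff[of 1 i m] G_carrier[OF aG] by simp
    have "m = replicate_mset i 1" if "p m \<noteq> \<zero>" "0 \<notin># m"
    proof -
      have "set_mset m \<subseteq> {..<2}" using P.PS_support[OF pP that(1)] .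
      then have "set_mset m \<subseteq> {1}" using that(2) by (auto simp: less_2_cases_iff)
      then show ?thesis using hom[OF that(1)] by (metis set_mset_subset_singletonD)
    qed
    moreover have "0 \<notin># replicate_mset i (1::nat)" by simp
    ultimately show "p m = (p' \<otimes>\<^bsub>S\<^esub> P.var 0 \<oplus>\<^bsub>S\<^esub> indexed_const a \<otimes>\<^bsub>S\<^esub> P.var 1 [^]\<^bsub>S\<^esub> i) m"
      using 1 2 P.PS_coeff[OF pP, of m] G_carrier[OF aG] by (auto simp: P.PR_simps(5) indexed_padd_def a_def)
  qed
  ultimately show thesis using that aG by blast
qed

text \<open>Induction on the degree of a homogeneous \<open>p\<close> in the kernel, written as \<open>y\<^sub>0 p' + a y\<^sub>1\<^sup>i\<close>. If \<open>a = 0\<close>, then \<open>z\<close> can be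
  cancelled and \<open>p'\<close> lies in the kernel. If \<open>a \<noteq> 0\<close>, then \<open>x\<^sup>i \<in> z R\<close>; the hypothesis allows to replace
  \<open>y\<^sub>1\<^sup>i\<close> modulo \<open>f\<close> by a multiple of \<open>y\<^sub>0\<close>, and \<open>z\<close> can be cancelled again.\<close>

lemma kernel_generator:
  assumes f: "f \<in> carrier S" "ev f = \<zero>"
    and rel: "\<And>i. x [^] (i::nat) \<in> PIdl z \<Longrightarrow> \<exists>h\<in>SG (i - 1). i \<noteq> 0 \<and> (P.var 1 [^]\<^bsub>S\<^esub> i \<ominus>\<^bsub>S\<^esub> P.var 0 \<otimes>\<^bsub>S\<^esub> h) \<in> PIdl\<^bsub>S\<^esub> f"
  shows "a_kernel S R ev = PIdl\<^bsub>S\<^esub> f"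
proof -
  interpret I: ideal "PIdl\<^bsub>S\<^esub> f" S by (rule P.PR.cgenideal_ideal[OF f(1)])
  have sub: "ev q = \<zero>" if q: "q \<in> PIdl\<^bsub>S\<^esub> f" for q
  proof -
    obtain r where "r \<in> carrier S" "q = r \<otimes>\<^bsub>S\<^esub> f" using q unfolding cgenideal_def by blast
    then show ?thesis using f ev_mult ev_closed by simp
  qed
  have homogeneous: "p \<in> PIdl\<^bsub>S\<^esub> f" if "p \<in> SG i" "ev p = \<zero>" for p i
    using that
  proof (induction i arbitrary: p rule: less_induct)
    case (less i)
    obtain a p' where p': "a \<in> G 0" "p' \<in> SG (i - 1)" "i = 0 \<Longrightarrow> p' = \<zero>\<^bsub>S\<^esub>"
      and p: "p = p' \<otimes>\<^bsub>S\<^esub> P.var 0 \<oplus>\<^bsub>S\<^esub> indexed_const a \<otimes>\<^bsub>S\<^esub> P.var 1 [^]\<^bsub>S\<^esub> i"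
      using homogeneous_decomposition[OF less.prems(1)] by metis
    note p'S = P.PG_carrier[OF p'(2)]
    note p'R = ev_closed[OF p'S]
    note aR = G_carrier[OF p'(1)]
    have v: "P.var 0 \<in> carrier S" "P.var 1 \<in> carrier S" "P.var 1 [^]\<^bsub>S\<^esub> i \<in> carrier S" by simp_all
    have ca: "indexed_const a \<in> carrier S" using p'(1) by simp
    have ev_pow: "ev (P.var 1 [^]\<^bsub>S\<^esub> i) = x [^] i"
      using ev.hom_nat_pow[OF v(2), of i] ev_var[of 1] by (simp add: val_def)
    have ev0: "ev (P.var 0) = z" using ev_var[of 0] by (simp add: val_def)
    have evp: "ev p' \<otimes> z \<oplus> a \<otimes> x [^] i = \<zero>"
      using less.prems(2) unfolding p using p'S v ca ev_pow ev0 ev_const[OF p'(1)] by simp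
    show ?case
    proof (cases "a = \<zero>")
      case True
      have "indexed_const a = \<zero>\<^bsub>S\<^esub>" using True by (simp add: P.PR_simps)
      then have p0: "p = p' \<otimes>\<^bsub>S\<^esub> P.var 0" unfolding p using p'S v by simp
      have "z \<otimes> ev p' = \<zero>" using evp True p'R by (simp add: m_comm)
      then have "ev p' = \<zero>" using nzd p'R by (simp add: nonzerodivisor_def)
      show ?thesis
      proof (cases "i = 0")
        case True
        then show ?thesis using p'(3) p0 v by simp
      next
        case False
        then have "p' \<in> PIdl\<^bsub>S\<^esub> f" using less.IH[of "i - 1" p'] p'(2) \<open>ev p' = \<zero>\<close> by simp
        then show ?thesis unfolding p0 using I.I_r_closed v(1) by blast
      qed
    next
      case False
      then obtain d where d: "d \<in> G 0" "d \<otimes> a = \<one>" using G0_inverse p'(1) by blast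
      note dR = G_carrier[OF d(1)]
      have "x [^] i = (d \<otimes> a) \<otimes> x [^] i" using d(2) by simp
      also have "\<dots> = d \<otimes> (ev p' \<otimes> z \<oplus> a \<otimes> x [^] i) \<oplus> (\<ominus> (d \<otimes> ev p')) \<otimes> z"
        using dR aR p'R zx_carrier nat_pow_closed[OF zx_carrier(2), of i] by algebra
      also have "\<dots> = (\<ominus> (d \<otimes> ev p')) \<otimes> z" unfolding evp using dR p'R by simp
      also have "\<dots> \<in> PIdl z" using dR p'R by (intro mult_mem_PIdl) simp_all
      finally obtain h where h: "h \<in> SG (i - 1)" "i \<noteq> 0" "(P.var 1 [^]\<^bsub>S\<^esub> i \<ominus>\<^bsub>S\<^esub> P.var 0 \<otimes>\<^bsub>S\<^esub> h) \<in> PIdl\<^bsub>S\<^esub> f"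
        using rel by blast
      note hS = P.PG_carrier[OF h(1)]
      let ?e = "P.var 1 [^]\<^bsub>S\<^esub> i \<ominus>\<^bsub>S\<^esub> P.var 0 \<otimes>\<^bsub>S\<^esub> h"
      define q where "q = p' \<oplus>\<^bsub>S\<^esub> indexed_const a \<otimes>\<^bsub>S\<^esub> h"
      have qS: "q \<in> carrier S" unfolding q_def using p'S ca hS by simp
      have pq: "p = q \<otimes>\<^bsub>S\<^esub> P.var 0 \<oplus>\<^bsub>S\<^esub> indexed_const a \<otimes>\<^bsub>S\<^esub> ?e"
        unfolding p q_def using p'S ca hS v by algebra
      have ce: "indexed_const a \<otimes>\<^bsub>S\<^esub> ?e \<in> PIdl\<^bsub>S\<^esub> f" by (rule I.I_l_closed[OF h(3) ca])
      have "ev p = ev q \<otimes> z \<oplus> ev (indexed_const a \<otimes>\<^bsub>S\<^esub> ?e)"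
        unfolding pq using ev_add[of "q \<otimes>\<^bsub>S\<^esub> P.var 0" "indexed_const a \<otimes>\<^bsub>S\<^esub> ?e"] ev_mult[OF qS v(1)] ev0 qS v I.Icarr[OF ce] by simp
      then have "ev q \<otimes> z \<oplus> \<zero> = \<zero>" unfolding sub[OF ce] less.prems(2) by simp
      then have "z \<otimes> ev q = \<zero>" using ev_closed[OF qS] by (simp add: m_comm)
      then have "ev q = \<zero>" using nzd ev_closed[OF qS] by (simp add: nonzerodivisor_def)
      moreover have "q \<in> SG (i - 1)"
        unfolding q_def using P.PG_add[OF p'(2)] P.PG_mult[OF P.PG_const[OF p'(1)] h(1)] by simp
      ultimately have "q \<in> PIdl\<^bsub>S\<^esub> f" using less.IH[of "i - 1" q] h(2) by simp
      then show ?thesis unfolding pq using I.I_r_closed[OF _ v(1)] ce I.a_closed by blast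
    qed
  qed
  have "p \<in> PIdl\<^bsub>S\<^esub> f" if p: "p \<in> carrier S" "ev p = \<zero>" for p
  proof -
    have part: "P.hpart i p \<in> PIdl\<^bsub>S\<^esub> f" for i
      using homogeneous[OF P.hpart_PG[OF p(1)]] ev_hpart[OF p(1), of i] p(2) by simp
    have pP: "p \<in> P.PS" using p(1) by (simp add: P.PR_simps)
    define N where "N = Suc (Max (insert 0 (size ` {m. p m \<noteq> \<zero>})))"
    have N: "size m < N" if "p m \<noteq> \<zero>" for m
      unfolding N_def using P.PS_finite_support[OF pP] that by (auto simp: less_Suc_eq_le intro!: Max_ge)
    have "(\<lambda>m. if size m < k then p m else \<zero>) \<in> PIdl\<^bsub>S\<^esub> f" for k
    proof (induction k)
      case 0
      have "(\<lambda>m::nat multiset. if size m < 0 then p m else \<zero>) = \<zero>\<^bsub>S\<^esub>" by (auto simp: P.PR_simps indexed_const_def)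
      then show ?case using I.zero_closed by simp
    next
      case (Suc k)
      have "(\<lambda>m. if size m < Suc k then p m else \<zero>) = (\<lambda>m. if size m < k then p m else \<zero>) \<oplus>\<^bsub>S\<^esub> P.hpart k p"
        using P.PS_coeff[OF pP] by (auto simp: P.PR_simps(5) indexed_padd_def P.hpart_def less_Suc_eq fun_eq_iff)
      then show ?case using I.a_closed[OF Suc.IH part[of k]] by simp
    qed
    moreover have "(\<lambda>m. if size m < N then p m else \<zero>) = p"
    proof
      fix m show "(if size m < N then p m else \<zero>) = p m" using N[of m] by (cases "p m = \<zero>") simp_all
    qed
    ultimately show ?thesis by metis
  qed
  then show ?thesis using sub I.a_subset unfolding a_kernel_def' by blast
qed

text \<open>The equation is \<open>f = y\<^sub>1\<^sup>d - y\<^sub>0 g\<close> for the least \<open>d\<close> with \<open>x\<^sup>d \<in> z R\<close>, where \<open>g\<close> is a form of degree \<open>d - 1\<close> with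
  \<open>x\<^sup>d = z g(z, x)\<close>; its multiples by powers of \<open>y\<^sub>1\<close> provide the relations for all \<open>i \<ge> d\<close>. If no power of \<open>x\<close>
  lies in \<open>z R\<close>, then \<open>f = 0\<close>.\<close>

theorem hypersurface: "hypersurface_ring R G"
proof -
  have "\<exists>f d. f \<in> SG d \<and> d \<noteq> 0 \<and> a_kernel S R ev = PIdl\<^bsub>S\<^esub> f"
  proof (cases "\<exists>i. x [^] (i::nat) \<in> PIdl z")
    case False
    have "a_kernel S R ev = PIdl\<^bsub>S\<^esub> \<zero>\<^bsub>S\<^esub>"
      by (rule kernel_generator) (use False in simp_all)
    then show ?thesis using P.PG_zero[of 1] by (intro exI[of _ "\<zero>\<^bsub>S\<^esub>"] exI[of _ 1]) simp
  next
    case True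
    define d where "d = (LEAST i. x [^] (i::nat) \<in> PIdl z)"
    have d: "x [^] d \<in> PIdl z" unfolding d_def using True by (rule LeastI_ex)
    have least: "d \<le> i" if "x [^] i \<in> PIdl z" for i unfolding d_def using that by (rule Least_le)
    have zm: "PIdl z \<subseteq> \<mm>" using cgenideal_minimal[OF ideal_irrelevant] G1_m[OF z] by blast
    have "d \<noteq> 0"
    proof
      assume "d = 0"
      then have "\<one> \<in> \<mm>" using d zm by auto
      then show False using one_nz irrelevantD[of \<one>] comp_homogeneous_same[OF G_one] by simp
    qed
    obtain t where t: "t \<in> carrier R" "x [^] d = t \<otimes> z" using d unfolding cgenideal_def by blast
    have xd: "x [^] (i::nat) \<in> G i" for i
    proof (induction i)
      case (Suc i)
      then show ?case using mult_G[OF Suc x] by simp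
    qed simp
    have "x [^] d = comp (z \<otimes> t) d" using xd[of d] t m_comm[OF t(1) zx_carrier(1)] by simp
    also have "\<dots> = z \<otimes> comp t (d - 1)" using comp_homogeneous_mult[OF z t(1), of d] \<open>d \<noteq> 0\<close> by simp
    finally have xt: "x [^] d = z \<otimes> comp t (d - 1)" .
    obtain g where g: "g \<in> SG (d - 1)" "ev g = comp t (d - 1)" using ev_graded comp_in[OF t(1)] by (metis imageE)
    note gS = P.PG_carrier[OF g(1)]
    have v: "P.var 0 \<in> carrier S" "P.var 1 \<in> carrier S" by simp_all
    define f where "f = P.var 1 [^]\<^bsub>S\<^esub> d \<ominus>\<^bsub>S\<^esub> P.var 0 \<otimes>\<^bsub>S\<^esub> g"
    have fS: "f \<in> carrier S" unfolding f_def using v gS by simp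
    have "P.var 0 \<otimes>\<^bsub>S\<^esub> g \<in> SG d" using P.PG_mult[OF P.PG_var[of 0] g(1)] \<open>d \<noteq> 0\<close> by simp
    then have fG: "f \<in> SG d"
      unfolding f_def a_minus_def using P.PG_add[OF P.PG_var_pow[of 1 d] P.PG_minus] by simp
    have ev_pow: "ev (P.var 1 [^]\<^bsub>S\<^esub> (i::nat)) = x [^] i" for i
      using ev.hom_nat_pow[OF v(2), of i] ev_var[of 1] by (simp add: val_def)
    have ev0: "ev (P.var 0) = z" using ev_var[of 0] by (simp add: val_def)
    have "ev f = x [^] d \<oplus> \<ominus> (z \<otimes> comp t (d - 1))"
      unfolding f_def a_minus_def using v gS ev_pow ev0 g(2) by simp
    then have evf: "ev f = \<zero>" unfolding xt using t(1) by (simp add: r_neg)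
    have "a_kernel S R ev = PIdl\<^bsub>S\<^esub> f"
    proof (rule kernel_generator[OF fS evf])
      fix i :: nat assume "x [^] i \<in> PIdl z"
      then have di: "d \<le> i" by (rule least)
      let ?w = "P.var 1 [^]\<^bsub>S\<^esub> (i - d)"
      let ?h = "?w \<otimes>\<^bsub>S\<^esub> g"
      have wS: "?w \<in> carrier S" using v by simp
      have "?h \<in> SG (i - d + (d - 1))" by (rule P.PG_mult[OF P.PG_var_pow g(1)]) simp
      moreover have "i - d + (d - 1) = i - 1" using di \<open>d \<noteq> 0\<close> by simp
      ultimately have h: "?h \<in> SG (i - 1)" by simp
      have "P.var 1 [^]\<^bsub>S\<^esub> i = ?w \<otimes>\<^bsub>S\<^esub> P.var 1 [^]\<^bsub>S\<^esub> d" using P.PR.nat_pow_mult[OF v(2), of "i - d" d] di by simp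
      then have "P.var 1 [^]\<^bsub>S\<^esub> i \<ominus>\<^bsub>S\<^esub> P.var 0 \<otimes>\<^bsub>S\<^esub> ?h = ?w \<otimes>\<^bsub>S\<^esub> f"
        unfolding f_def using wS v gS P.PR.nat_pow_closed[OF v(2), of d] by algebra
      moreover have "?w \<otimes>\<^bsub>S\<^esub> f \<in> PIdl\<^bsub>S\<^esub> f" unfolding cgenideal_def using wS by blast
      ultimately show "\<exists>h\<in>SG (i - 1). i \<noteq> 0 \<and> (P.var 1 [^]\<^bsub>S\<^esub> i \<ominus>\<^bsub>S\<^esub> P.var 0 \<otimes>\<^bsub>S\<^esub> h) \<in> PIdl\<^bsub>S\<^esub> f"
        using h di \<open>d \<noteq> 0\<close> by (intro bexI[of _ ?h]) simp_all
    qed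
    then show ?thesis using fG \<open>d \<noteq> 0\<close> by blast
  qed
  then obtain f d where f: "f \<in> SG d" "d \<noteq> 0" "a_kernel S R ev = PIdl\<^bsub>S\<^esub> f" by blast
  let ?I = "PIdl\<^bsub>S\<^esub> f"
  define \<phi> where "\<phi> = inv_into (carrier (S Quot ?I)) (\<lambda>Y. the_elem (ev ` Y))"
  have iso: "(\<lambda>Y. the_elem (ev ` Y)) \<in> ring_iso (S Quot ?I) R"
    using ev.FactRing_iso_set[OF ev_surj] f(3) by simp
  have I: "ideal ?I S" by (rule P.PR.cgenideal_ideal[OF P.PG_carrier[OF f(1)]])
  have \<phi>: "\<phi> \<in> ring_iso R (S Quot ?I)"
    unfolding \<phi>_def by (rule ring_iso_set_sym[OF ideal.quotient_is_ring[OF I] iso])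
  have \<phi>_ev: "\<phi> (ev p) = ?I +>\<^bsub>S\<^esub> p" if p: "p \<in> carrier S" for p
  proof -
    have "?I +>\<^bsub>S\<^esub> p \<in> carrier (S Quot ?I)" using p by (auto simp: FactRing_def A_RCOSETS_def')
    moreover have "the_elem (ev ` (?I +>\<^bsub>S\<^esub> p)) = ev p" using ev.the_elem_simp[OF p] f(3) by simp
    moreover have "inj_on (\<lambda>Y. the_elem (ev ` Y)) (carrier (S Quot ?I))"
      using iso by (auto simp: ring_iso_def bij_betw_def)
    ultimately show ?thesis unfolding \<phi>_def by (metis (no_types, lifting) inv_into_f_f)
  qed
  have "\<phi> c = ?I +>\<^bsub>S\<^esub> indexed_const c" if "c \<in> G 0" for c
    using \<phi>_ev[of "indexed_const c"] ev_const[OF that] that by simp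
  moreover have "\<phi> ` G i = (\<lambda>p. ?I +>\<^bsub>S\<^esub> p) ` SG i" for i
  proof -
    have "\<phi> ` G i = \<phi> ` (ev ` SG i)" by (simp only: ev_graded)
    also have "\<dots> = (\<lambda>p. \<phi> (ev p)) ` SG i" by (rule image_image)
    also have "\<dots> = (\<lambda>p. ?I +>\<^bsub>S\<^esub> p) ` SG i" by (rule image_cong[OF refl]) (rule \<phi>_ev[OF P.PG_carrier])
    finally show ?thesis .
  qed
  ultimately show ?thesis
    unfolding hypersurface_ring_def Let_def
    using f(1) P.PG_irrelevant[OF f(1,2)] \<phi> by blast
qed

end

theorem corollary5p4:
  fixes R :: "('a, 'b) ring_scheme" and G :: "nat \<Rightarrow> 'a set"
  assumes "standard_graded_ring R G"
    and "krull_dim R = 1"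
    and "gorenstein_ring R"
    and "uncountable (G 0)"
    and "graded_countable_CM_type R G"
  shows "hypersurface_ring R G"
proof -
  have "cring R" "noetherian_ring R"
    using assms(1) unfolding standard_graded_ring_def graded_ring_def by auto
  then interpret standard_graded R G
    by (intro standard_graded.intro noetherian_cring.intro standard_graded_axioms.intro assms(1))
  obtain z x where zx: "z \<in> G 1" "nonzerodivisor z" "x \<in> G 1"
    "\<And>y. y \<in> G 1 \<Longrightarrow> \<exists>a\<in>G 0. \<exists>b\<in>G 0. y = a \<otimes>\<^bsub>R\<^esub> z \<oplus>\<^bsub>R\<^esub> b \<otimes>\<^bsub>R\<^esub> x"
    using linear_forms_spanned_by_two[OF assms(2-5)] by blast
  interpret spanned_by_two R G z x
    by (intro spanned_by_two.intro standard_graded_axioms spanned_by_two_axioms.intro zx)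
  show ?thesis by (rule hypersurface)
qed

end
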